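(* Let $n\ge2$, $\alpha\in(0,1)$, $\Lambda>0$, and let $K:\mathbb{R}^n\to[0,+\infty)$ be a nonnegative measurable kernel with $K(x)\le\Lambda|x|^{-n-\alpha}$ for all $x\in\mathbb{R}^n\setminus\{0\}$. Let $E\subset\mathbb{R}^n$ be a measurable set that is $2\pi$-periodic in the first coordinate $x_1$ and such that $\mathcal{P}_K[E]<+\infty$. Suppose, in addition, that $K$ satisfies, for almost every $x'\in\mathbb{R}^{n-1}$, one of the following: (1) $K(\cdot,x')$ is convex in $(0,+\infty)$; (2) the function $\tau>0\mapsto K(\sqrt{\tau},x')$ is completely monotonic; (3) $K(\cdot,x')$ is nonincreasing in $(0,\pi)$ and vanishes in $[\pi,+\infty)$. Then $\mathcal{P}_K[E^{*\mathrm{per}}]\le\mathcal{P}_K[E]$. If, moreover, $K$ satisfies, for almost every $x'\in\mathbb{R}^{n-1}$, one of the following: (1)' $K(\cdot,x')$ is convex in $(0,+\infty)$ and strictly convex in $(c,c+2\pi)$ for some $c\ge0$; (2)' $K$ is as in (2) and nonzero; (3)' $K(\cdot,x')$ is (strictly) decreasing in $(0,\pi)$ and vanishes in $[\pi,+\infty)$; then equality $\mathcal{P}_K[E^{*\mathrm{per}}]=\mathcal{P}_K[E]$ holds if, and only if, $E=E^{*\mathrm{per}}+ce_1$ for some $c\in\mathbb{R}$, with $e_1=(1,0,\dots,0)\in\mathbb{R}^n$, up to a set of measure zero.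
   Context: Points of $\mathbb{R}^n$ are written $x=(x_1,x')\in\mathbb{R}\times\mathbb{R}^{n-1}$. $\Omega=\{x\in\mathbb{R}^n:-\pi<x_1<\pi\}$, $E^c$ is the complement of $E$. A set $E$ is $2\pi$-periodic in $x_1$ if $E+2\pi ke_1=E$ for all $k\in\mathbb{Z}$. The periodic anisotropic nonlocal perimeter is $\mathcal{P}_K[E]=\int_{E\cap\Omega}\int_{E^c}K(x-y)\,dy\,dx\in[0,+\infty]$ ($x\in E\cap\Omega$, $y\in E^c$). For a set $A\subset\mathbb{R}^n$ and $x'\in\mathbb{R}^{n-1}$ let $A_{x'}=\{x_1\in\mathbb{R}:(x_1,x')\in A\}$. If all $A_{x'}$ have finite length, $A^*$ denotes the Steiner symmetrization of $A$ with respect to $\{x_1=0\}$: for every $x'$, $(A^* )_{x'}$ is the open interval centered at $0$ with the same one-dimensional Lebesgue measure as $A_{x'}$. For $E$ $2\pi$-periodic in $x_1$, its symmetric decreasing periodic rearrangement is $E^{*\mathrm{per}}=\bigcup_{k\in\mathbb{Z}}\{(E\cap\Omega)^*+2\pi ke_1\}$. A function $f:(0,+\infty)\to[0,+\infty)$ is completely monotonic if it has derivatives of all orders and $(-1)^m f^{(m)}(t)\ge0$ for every $m\ge1$, $t>0$. A function $f:I\to\mathbb{R}$ on an interval is strictly convex if $f(st_1+(1-s)t_2)<sf(t_1)+(1-s)f(t_2)$ for all $t_1\ne t_2$ in $I$, $s\in(0,1)$.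
   Formalization: The formal theorem additionally assumes that K is even in the first coordinate, K(-x_1,x') = K(x_1,x') for almost every x'; without this the statement is false, since conditions (1)-(3) constrain K(·,x') only on (0,+∞). *)

theory Defs
  imports "HOL-Analysis.Analysis"
begin

(* Points of R^n are pairs (x1, x') of type real \<times> real^'m with CARD('m) = n - 1; the norm
   and the Lebesgue measure of the product type are those of R^n. *)

definition e1 :: "real \<times> (real^'m)" where
  "e1 = (1, 0)"

definition translate :: "real \<times> (real^'m) \<Rightarrow> (real \<times> (real^'m)) set \<Rightarrow> (real \<times> (real^'m)) set" where
  "translate v A = (\<lambda>x. x + v) ` A"

definition slab :: "(real \<times> (real^'m)) set" where
  "slab = {x. - pi < fst x \<and> fst x < pi}"

definition periodic_set :: "(real \<times> (real^'m)) set \<Rightarrow> bool" where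
  "periodic_set E \<longleftrightarrow> (\<forall>k::int. translate ((2 * pi * of_int k) *\<^sub>R e1) E = E)"

definition periodic_perimeter ::
  "(real \<times> (real^'m) \<Rightarrow> real) \<Rightarrow> (real \<times> (real^'m)) set \<Rightarrow> ennreal" where
  "periodic_perimeter K E =
     (\<integral>\<^sup>+ x \<in> E \<inter> slab. (\<integral>\<^sup>+ y \<in> - E. ennreal (K (x - y)) \<partial>lebesgue) \<partial>lebesgue)"

definition slice :: "(real \<times> (real^'m)) set \<Rightarrow> real^'m \<Rightarrow> real set" where
  "slice A x' = {x1. (x1, x') \<in> A}"

(* Meant for sets all of whose slices have finite length. If A is Lebesgue measurable, almost
   all of its slices are measurable; a nonmeasurable slice has measure 0 by the library
   convention, so it is replaced by the empty set. *)
definition steiner :: "(real \<times> (real^'m)) set \<Rightarrow> (real \<times> (real^'m)) set" where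
  "steiner A = {(x1, x') | x1 x'.
     x1 \<in> {- (measure lebesgue (slice A x') / 2) <..< measure lebesgue (slice A x') / 2}}"

definition periodic_rearrangement ::
  "(real \<times> (real^'m)) set \<Rightarrow> (real \<times> (real^'m)) set" where
  "periodic_rearrangement E =
     (\<Union>k::int. translate ((2 * pi * of_int k) *\<^sub>R e1) (steiner (E \<inter> slab)))"

(* Only the values of f on the open half line matter: there, every iterate of deriv is
   determined by f restricted to (0, infinity). *)
definition completely_monotonic :: "(real \<Rightarrow> real) \<Rightarrow> bool" where
  "completely_monotonic f \<longleftrightarrow>
     (\<forall>t>0. 0 \<le> f t) \<and>
     (\<forall>m. \<forall>t>0. ((deriv ^^ m) f) differentiable (at t)) \<and>
     (\<forall>m\<ge>1. \<forall>t>0. 0 \<le> (-1) ^ m * (deriv ^^ m) f t)"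

definition strictly_convex_on :: "real set \<Rightarrow> (real \<Rightarrow> real) \<Rightarrow> bool" where
  "strictly_convex_on I f \<longleftrightarrow>
     (\<forall>t1\<in>I. \<forall>t2\<in>I. \<forall>s. t1 \<noteq> t2 \<longrightarrow> 0 < s \<longrightarrow> s < 1 \<longrightarrow>
        f (s * t1 + (1 - s) * t2) < s * f t1 + (1 - s) * f t2)"

(* Each of the following conditions is on a one-dimensional slice k = K(_, x') of the kernel
   and only constrains k on the half line (0, infinity); k is thought of as a function of |x1|,
   so it needs to be assumed even separately. *)

definition kernel_cond1 :: "(real \<Rightarrow> real) \<Rightarrow> bool" where
  "kernel_cond1 k \<longleftrightarrow> convex_on {0<..} k"

definition kernel_cond2 :: "(real \<Rightarrow> real) \<Rightarrow> bool" where
  "kernel_cond2 k \<longleftrightarrow> completely_monotonic (\<lambda>\<tau>. k (sqrt \<tau>))"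

definition kernel_cond3 :: "(real \<Rightarrow> real) \<Rightarrow> bool" where
  "kernel_cond3 k \<longleftrightarrow> antimono_on {0<..<pi} k \<and> (\<forall>t\<ge>pi. k t = 0)"

definition kernel_cond1_strict :: "(real \<Rightarrow> real) \<Rightarrow> bool" where
  "kernel_cond1_strict k \<longleftrightarrow>
     convex_on {0<..} k \<and> (\<exists>c\<ge>0. strictly_convex_on {c<..<c + 2 * pi} k)"

(* "Nonzero" means not identically zero on the half line where the slice is considered. *)
definition kernel_cond2_strict :: "(real \<Rightarrow> real) \<Rightarrow> bool" where
  "kernel_cond2_strict k \<longleftrightarrow> kernel_cond2 k \<and> (\<exists>\<tau>>0. k (sqrt \<tau>) \<noteq> 0)"

definition kernel_cond3_strict :: "(real \<Rightarrow> real) \<Rightarrow> bool" where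
  "kernel_cond3_strict k \<longleftrightarrow> strict_antimono_on {0<..<pi} k \<and> (\<forall>t\<ge>pi. k t = 0)"

end

theory Submission
  imports Defs "HOL-Probability.Probability"
begin

text \<open>For \<open>x' \<noteq> y'\<close> the kernel slice \<open>K (_, x' - y')\<close> is bounded and summable, so by Fubini the perimeter is
  the integral over \<open>(x', y')\<close> of \<open>\<integral>\<^sub>A \<integral>\<^sub>-\<^sub>B G (s - t)\<close> on the circle, where \<open>A\<close>, \<open>B\<close> are the slices of \<open>E\<close> and
  \<open>G\<close> is the periodised kernel slice. Each of the three conditions makes \<open>G\<close> decreasing in the distance to \<open>0\<close>: for
  convex kernels this holds for pairs of terms, and Bernstein's theorem reduces the completely monotonic case
  to the periodised Gaussian, which is handled by its convolution semigroup.

  On the circle the Riesz inequality follows by polarization: a polarization does not decrease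
  \<open>\<integral>\<^sub>A \<integral>\<^sub>B G (s - t)\<close>, and averaging over all reflections some polarization brings \<open>A\<close> and \<open>B\<close> closer to
  centred arcs. In the equality case no polarization gains anything, so for every reflection the two
  sets are ordered in the same direction; comparing first Fourier coefficients, \<open>A\<close> and \<open>B\<close> are arcs with a common
  centre, and this centre does not depend on the slice.\<close>

section \<open>The circle as a measure space\<close>

text \<open>The kernel may fail to be integrable at 0, so overlaps of \<open>E\<close> with itself
  can be infinite; for a pair of slices over x' \<noteq> y' all terms are finite. There
  \<open>riesz G A B + riesz G A (- B)\<close> depends on \<open>A\<close> only through its measure,
  which turns minimising the perimeter into maximising an overlap. The two slices are different
  sets, so a two-set inequality is required and one reflection must serve both sets at once. The
  slice conditions leave the value at 0 free, hence kernels are compared only at points with nonzero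
  sine and the pointwise arguments hold almost everywhere. For completely monotonic kernels the
  periodised sum cannot be compared pair by pair, since a wide Gaussian is concave near 0. The
  substitute is that convolving a symmetric decreasing function on the circle with itself preserves
  the property, and very narrow periodised Gaussians almost have it.\<close>

definition periodic :: "(real \<Rightarrow> 'a) \<Rightarrow> bool" where
  "periodic f \<longleftrightarrow> (\<forall>x. f (x + 2 * pi) = f x)"

lemma periodic_int:
  assumes "periodic f"
  shows "f (x + 2 * pi * of_int k) = f x"
proof -
  have nat: "f (x + 2 * pi * of_nat n) = f x" for n x
  proof (induction n arbitrary: x)
    case (Suc n)
    have "f (x + 2 * pi * of_nat (Suc n)) = f ((x + 2 * pi * of_nat n) + 2 * pi)"
      by (simp add: algebra_simps)
    then show ?case using assms Suc unfolding periodic_def by metis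
  qed simp
  show ?thesis
  proof (cases "0 \<le> k")
    case True then show ?thesis using nat[of x "nat k"] by simp
  next
    case False
    then show ?thesis using nat[of "x + 2 * pi * of_int k" "nat (- k)"] by simp
  qed
qed

lemma periodic_int': "periodic f \<Longrightarrow> f (x - 2 * pi * of_int k) = f x"
  using periodic_int[of f x "- k"] by simp

lemma periodic_cong_reflect:
  assumes "periodic f"
  shows "periodic (\<lambda>x. f (c - x))"
  unfolding periodic_def
proof
  fix x
  show "f (c - (x + 2 * pi)) = f (c - x)"
    using periodic_int'[OF assms, of "c - x" 1] by (simp add: diff_diff_eq)
qed

lemma periodic_shift:
  assumes "periodic f"
  shows "periodic (\<lambda>x. f (x + c))"
  unfolding periodic_def
proof
  fix x
  have "x + 2 * pi + c = (x + c) + 2 * pi" by simp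
  then show "f (x + 2 * pi + c) = f (x + c)" using assms unfolding periodic_def by metis
qed

lemma periodic_shift': "periodic f \<Longrightarrow> periodic (\<lambda>x. f (c + x))"
  using periodic_shift[of f c] by (simp add: add.commute)

lemma periodic_shift_minus: "periodic f \<Longrightarrow> periodic (\<lambda>x. f (x - c))"
  using periodic_shift[of f "- c"] by simp

lemma periodic_comp: "periodic f \<Longrightarrow> periodic (\<lambda>x. g (f x))"
  unfolding periodic_def by simp

lemma periodic_comp2: "periodic f \<Longrightarrow> periodic g \<Longrightarrow> periodic (\<lambda>x. h (f x) (g x))"
  unfolding periodic_def by simp

lemma periodic_const: "periodic (\<lambda>x. c)"
  unfolding periodic_def by simp

lemma periodic_cos: "periodic cos" and periodic_sin: "periodic sin"
  unfolding periodic_def by simp_all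

text \<open>The representative modulo \<open>2 * pi\<close> in the fundamental interval
  \<open>{- pi..<pi}\<close>, half-open so that it is unique.\<close>

definition wrap :: "real \<Rightarrow> real" where
  "wrap x = x - 2 * pi * of_int \<lfloor>(x + pi) / (2 * pi)\<rfloor>"

lemma wrap_bounds: "- pi \<le> wrap x" "wrap x < pi"
proof -
  define j :: real where "j = of_int \<lfloor>(x + pi) / (2 * pi)\<rfloor>"
  have "j \<le> (x + pi) / (2 * pi)" "(x + pi) / (2 * pi) < j + 1" unfolding j_def by linarith+
  then have "2 * pi * j \<le> x + pi" "x + pi < 2 * pi * j + 2 * pi"
    by (simp_all add: field_simps)
  then show "- pi \<le> wrap x" "wrap x < pi" unfolding wrap_def j_def by linarith+
qed

lemma wrap_unique:
  assumes "- pi \<le> x + 2 * pi * of_int k" "x + 2 * pi * of_int k < pi"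
  shows "k = - \<lfloor>(x + pi) / (2 * pi)\<rfloor>"
proof -
  have "\<lfloor>(x + pi) / (2 * pi)\<rfloor> = - k"
    using assms by (intro floor_unique) (simp_all add: field_simps)
  then show ?thesis by simp
qed

lemma periodic_wrap: "periodic wrap"
  unfolding periodic_def
proof
  fix x
  have "(x + 2 * pi + pi) / (2 * pi) = (x + pi) / (2 * pi) + 1" by (simp add: field_simps)
  then show "wrap (x + 2 * pi) = wrap x" unfolding wrap_def by (simp add: algebra_simps)
qed

lemma wrap_id: "- pi \<le> x \<Longrightarrow> x < pi \<Longrightarrow> wrap x = x"
  using wrap_unique[of x 0] unfolding wrap_def by simp

lemma periodic_wrap_eq: "periodic f \<Longrightarrow> f (wrap x) = f x"
  unfolding wrap_def by (rule periodic_int')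

lemma wrap_measurable [measurable]: "wrap \<in> borel_measurable borel"
  unfolding wrap_def[abs_def] by measurable

text \<open>The translates of the half-open fundamental interval partition the line. This partition
  of unity converts integrals over the line into integrals over one period.\<close>

lemma tile_sum: "(\<integral>\<^sup>+k. indicator {- pi..<pi} (x + 2 * pi * of_int k) \<partial>count_space (UNIV :: int set)) = 1"
proof -
  define j where "j = - \<lfloor>(x + pi) / (2 * pi)\<rfloor>"
  have "- pi \<le> x + 2 * pi * of_int j" "x + 2 * pi * of_int j < pi"
    using wrap_bounds[of x] unfolding wrap_def j_def by simp_all
  moreover have "k = j" if "- pi \<le> x + 2 * pi * of_int k" "x + 2 * pi * of_int k < pi" for k
    using wrap_unique[OF that] j_def by blast
  ultimately have iff: "x + 2 * pi * of_int k \<in> {- pi..<pi} \<longleftrightarrow> k \<in> {j}" for k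
    unfolding atLeastLessThan_iff singleton_iff by metis
  have "indicator {- pi..<pi} (x + 2 * pi * of_int k) = (1::ennreal) * indicator {j} k" for k
    unfolding indicator_def using iff[of k] by (simp only: if_True mult_1)
  then have "(\<integral>\<^sup>+k. indicator {- pi..<pi} (x + 2 * pi * of_int k) \<partial>count_space (UNIV :: int set))
     = (\<integral>\<^sup>+k. 1 * indicator {j} k \<partial>count_space (UNIV :: int set))" by (rule arg_cong[OF ext])
  also have "\<dots> = 1" by (subst nn_integral_indicator_finite) auto
  finally show ?thesis .
qed

lemma nn_integral_int_uminus:
  "(\<integral>\<^sup>+k. f (- k) \<partial>count_space (UNIV :: int set)) = (\<integral>\<^sup>+k. f k \<partial>count_space UNIV)"
  by (rule nn_integral_bij_count_space) (rule bij_uminus)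

lemma nn_integral_int_shift:
  "(\<integral>\<^sup>+k. f (k + j) \<partial>count_space (UNIV :: int set)) = (\<integral>\<^sup>+k. f k \<partial>count_space UNIV)"
  by (rule nn_integral_bij_count_space) (rule bij_plus_right)

lemma tile_sum': "(\<integral>\<^sup>+k. indicator {- pi..<pi} (x - 2 * pi * of_int k) \<partial>count_space (UNIV :: int set)) = 1"
proof -
  have "(\<integral>\<^sup>+k. indicator {- pi..<pi} (x - 2 * pi * of_int k) \<partial>count_space (UNIV :: int set))
    = (\<integral>\<^sup>+k. indicator {- pi..<pi} (x - 2 * pi * of_int (- k)) \<partial>count_space (UNIV :: int set))"
    by (rule nn_integral_int_uminus[symmetric])
  then show ?thesis using tile_sum[of x] by simp
qed

text \<open>An enumeration of the integers turns the sum into a series. As a raw rule it lets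
  \<open>measurable\<close> see through every periodisation below.\<close>

lemma borel_measurable_int_sum [measurable (raw)]:
  assumes "\<And>k::int. f k \<in> borel_measurable M"
  shows "(\<lambda>x. \<integral>\<^sup>+k. (f k x :: ennreal) \<partial>count_space UNIV) \<in> borel_measurable M"
proof -
  have inf: "infinite (UNIV :: int set)" by (rule infinite_UNIV_int)
  have bij: "bij_betw (from_nat_into UNIV) UNIV (UNIV :: int set)"
    by (rule bij_betw_from_nat_into) (use inf in auto)
  have "(\<lambda>x. \<integral>\<^sup>+k. (f k x :: ennreal) \<partial>count_space UNIV) =
     (\<lambda>x. \<Sum>n. f (from_nat_into UNIV n) x)"
    by (rule ext) (simp add: nn_integral_bij_count_space[symmetric, OF bij] nn_integral_count_space_nat)
  then show ?thesis using assms by simp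
qed

text \<open>For an even kernel, \<open>n\<close> and \<open>- n - 1\<close> contribute the points
  \<open>t + 2 * pi * n\<close> and \<open>2 * pi * (n + 1) - t\<close>, mirror images in
  \<open>2 * pi * n + pi\<close>; this is the form that convexity can use.\<close>

lemma nn_integral_int_pairs:
  fixes f :: "int \<Rightarrow> ennreal"
  shows "(\<integral>\<^sup>+k. f k \<partial>count_space UNIV) = (\<Sum>n. f (int n) + f (- int n - 1))"
proof -
  have split: "f k = f k * indicator (range int) k + f k * indicator (range (\<lambda>n. - int n - 1)) k" for k
  proof (cases "0 \<le> k")
    case True
    then have "k \<in> range int" "k \<notin> range (\<lambda>n. - int n - 1)"
      by (auto intro: range_eqI[of _ _ "nat k"])
    then show ?thesis by simp
  next
    case False
    then have "k \<notin> range int" "k \<in> range (\<lambda>n. - int n - 1)"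
      by (auto intro: range_eqI[of _ _ "nat (- k - 1)"])
    then show ?thesis by simp
  qed
  have 1: "(\<integral>\<^sup>+k. f k * indicator (range int) k \<partial>count_space UNIV) = (\<Sum>n. f (int n))"
    by (simp add: nn_integral_count_space_indicator[symmetric] nn_integral_count_space_nat
      nn_integral_bij_count_space[of int UNIV "range int" f, symmetric] inj_on_imp_bij_betw)
  have inj: "inj (\<lambda>n. - int n - 1)" by (auto simp: inj_on_def)
  have 2: "(\<integral>\<^sup>+k. f k * indicator (range (\<lambda>n. - int n - 1)) k \<partial>count_space UNIV) = (\<Sum>n. f (- int n - 1))"
    by (simp add: nn_integral_count_space_indicator[symmetric] nn_integral_count_space_nat
      nn_integral_bij_count_space[of "\<lambda>n. - int n - 1" UNIV "range (\<lambda>n. - int n - 1)" f, symmetric] inj_on_imp_bij_betw[OF inj])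
  have "(\<integral>\<^sup>+k. f k \<partial>count_space UNIV) = (\<Sum>n. f (int n)) + (\<Sum>n. f (- int n - 1))"
    by (subst split, subst nn_integral_add) (simp_all add: 1 2)
  then show ?thesis by (simp add: suminf_add)
qed

text \<open>The circle is one period of the line, seen as a finite measure on all reals. Functions
  on the circle are periodic functions on the line, so differences and reflections need no reduction
  modulo \<open>2 * pi\<close>.\<close>

definition circ :: "real measure" where
  "circ = density lborel (indicator {- pi..<pi})"

lemma sets_circ [simp, measurable_cong]: "sets circ = sets borel"
  and space_circ [simp]: "space circ = UNIV"
  unfolding circ_def by simp_all

lemma nn_integral_circ:
  "f \<in> borel_measurable borel \<Longrightarrow>
    (\<integral>\<^sup>+x. f x \<partial>circ) = (\<integral>\<^sup>+x. indicator {- pi..<pi} x * f x \<partial>lborel)"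
  unfolding circ_def by (subst nn_integral_density) auto

lemma AE_circ: "(AE x in circ. P x) \<longleftrightarrow> (AE x in lborel. - pi \<le> x \<and> x < pi \<longrightarrow> P x)"
  unfolding circ_def by (subst AE_density) (auto simp: indicator_def)

lemma emeasure_circ_UNIV: "emeasure circ UNIV = ennreal (2 * pi)"
proof -
  have "emeasure circ UNIV = (\<integral>\<^sup>+x. indicator {- pi..<pi} x \<partial>lborel)"
    unfolding circ_def by (subst emeasure_density) auto
  also have "\<dots> = ennreal (2 * pi)" by (simp add: nn_integral_indicator)
  finally show ?thesis .
qed

interpretation circ: finite_measure circ
  by (rule finite_measureI) (simp add: emeasure_circ_UNIV)

interpretation circ_pair: pair_sigma_finite circ circ ..
interpretation lborel_circ: pair_sigma_finite lborel circ ..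

lemma measure_circ_UNIV: "measure circ UNIV = 2 * pi"
  by (simp add: measure_def emeasure_circ_UNIV)

lemma measure_circ_le: "measure circ A \<le> 2 * pi"
  using circ.bounded_measure[of A] by (simp add: measure_circ_UNIV)

lemma nn_integral_lborel_unfold:
  fixes f :: "real \<Rightarrow> ennreal"
  assumes [measurable]: "f \<in> borel_measurable borel"
  shows "(\<integral>\<^sup>+x. f x \<partial>lborel) = (\<integral>\<^sup>+x. \<integral>\<^sup>+k. f (x + 2 * pi * of_int k) \<partial>count_space (UNIV::int set) \<partial>circ)"
proof -
  have "(\<integral>\<^sup>+x. \<integral>\<^sup>+k. f (x + 2 * pi * of_int k) \<partial>count_space (UNIV::int set) \<partial>circ)
     = (\<integral>\<^sup>+k. \<integral>\<^sup>+x. f (x + 2 * pi * of_int k) \<partial>circ \<partial>count_space (UNIV::int set))"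
    by (rule nn_integral_count_space_nn_integral) auto
  also have "\<dots> = (\<integral>\<^sup>+k. \<integral>\<^sup>+x. indicator {- pi..<pi} (x - 2 * pi * of_int k) * f x \<partial>lborel \<partial>count_space (UNIV::int set))"
  proof (rule nn_integral_cong)
    fix k :: int
    have "(\<integral>\<^sup>+x. indicator {- pi..<pi} (x - 2 * pi * of_int k) * f x \<partial>lborel)
      = ennreal \<bar>1\<bar> * (\<integral>\<^sup>+x. indicator {- pi..<pi} ((2 * pi * of_int k + 1 * x) - 2 * pi * of_int k) * f (2 * pi * of_int k + 1 * x) \<partial>lborel)"
      by (rule nn_integral_real_affine) auto
    then show "(\<integral>\<^sup>+x. f (x + 2 * pi * of_int k) \<partial>circ) =
      (\<integral>\<^sup>+x. indicator {- pi..<pi} (x - 2 * pi * of_int k) * f x \<partial>lborel)"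
      by (subst nn_integral_circ) (simp_all add: add.commute)
  qed
  also have "\<dots> = (\<integral>\<^sup>+x. \<integral>\<^sup>+k. indicator {- pi..<pi} (x - 2 * pi * of_int k) * f x \<partial>count_space (UNIV::int set) \<partial>lborel)"
    by (rule nn_integral_count_space_nn_integral[symmetric]) auto
  also have "\<dots> = (\<integral>\<^sup>+x. f x \<partial>lborel)"
    by (subst nn_integral_multc) (auto simp: tile_sum')
  finally show ?thesis by simp
qed

text \<open>A reflected fundamental interval is again fundamental. Unfolding over the integers and
  pulling out the periodic \<open>f\<close> leaves a sum of indicators equal to 1.\<close>

lemma nn_integral_circ_reflect:
  fixes f :: "real \<Rightarrow> ennreal"
  assumes [measurable]: "f \<in> borel_measurable borel" and per: "periodic f"
  shows "(\<integral>\<^sup>+x. f (c - x) \<partial>circ) = (\<integral>\<^sup>+x. f x \<partial>circ)"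
proof -
  have "(\<integral>\<^sup>+x. f (c - x) \<partial>circ) = (\<integral>\<^sup>+x. indicator {- pi..<pi} x * f (c - x) \<partial>lborel)"
    by (rule nn_integral_circ) auto
  also have "\<dots> = (\<integral>\<^sup>+x. indicator {- pi..<pi} (c - x) * f x \<partial>lborel)"
    by (subst nn_integral_real_affine[where c="-1" and t=c]) auto
  also have "\<dots> = (\<integral>\<^sup>+x. \<integral>\<^sup>+k. indicator {- pi..<pi} (c - (x + 2 * pi * of_int k)) * f (x + 2 * pi * of_int k) \<partial>count_space (UNIV::int set) \<partial>circ)"
    by (subst nn_integral_lborel_unfold) auto
  also have "\<dots> = (\<integral>\<^sup>+x. \<integral>\<^sup>+k. indicator {- pi..<pi} ((c - x) - 2 * pi * of_int k) * f x \<partial>count_space (UNIV::int set) \<partial>circ)"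
    by (simp add: periodic_int[OF per] diff_diff_eq)
  also have "\<dots> = (\<integral>\<^sup>+x. f x \<partial>circ)"
    by (subst nn_integral_multc) (auto simp: tile_sum')
  finally show ?thesis .
qed

text \<open>A translation is the product of two reflections.\<close>

lemma nn_integral_circ_shift:
  fixes f :: "real \<Rightarrow> ennreal"
  assumes [measurable]: "f \<in> borel_measurable borel" and per: "periodic f"
  shows "(\<integral>\<^sup>+x. f (x + c) \<partial>circ) = (\<integral>\<^sup>+x. f x \<partial>circ)"
  using nn_integral_circ_reflect[of "\<lambda>x. f (c - x)" 0] nn_integral_circ_reflect[of f c]
    periodic_cong_reflect[OF per] by (simp add: add.commute per)

text \<open>Followed by \<open>wrap\<close>, the reflection becomes a measure-preserving self-map,
  along which almost-everywhere statements and Bochner integrals are transported.\<close>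

lemma distr_circ_reflect: "distr circ circ (\<lambda>x. wrap (c - x)) = circ"
proof (rule measure_eqI)
  fix A assume "A \<in> sets (distr circ circ (\<lambda>x. wrap (c - x)))"
  then have [measurable]: "A \<in> sets borel" by simp
  have "emeasure (distr circ circ (\<lambda>x. wrap (c - x))) A = (\<integral>\<^sup>+x. indicator A (wrap (c - x)) \<partial>circ)"
    by (subst nn_integral_indicator[symmetric], simp, subst nn_integral_distr) auto
  also have "\<dots> = (\<integral>\<^sup>+x. indicator A (wrap x) \<partial>circ)"
    by (rule nn_integral_circ_reflect[where f="\<lambda>x. indicator A (wrap x)"])
      (auto intro!: periodic_comp[OF periodic_wrap])
  also have "\<dots> = (\<integral>\<^sup>+x. indicator A x \<partial>circ)"
    by (rule nn_integral_cong_AE) (auto simp: AE_circ wrap_id)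
  also have "\<dots> = emeasure circ A" by (simp add: nn_integral_indicator)
  finally show "emeasure (distr circ circ (\<lambda>x. wrap (c - x))) A = emeasure circ A" .
qed simp

lemma AE_circ_reflect:
  assumes "AE x in circ. P x" "periodic P"
  shows "AE x in circ. P (c - x)"
proof -
  have "AE x in distr circ circ (\<lambda>x. wrap (c - x)). P x" using assms(1) by (subst distr_circ_reflect)
  then have "AE x in circ. P (wrap (c - x))"
    by (rule AE_distrD[rotated]) simp
  then show ?thesis by (simp add: periodic_wrap_eq[OF assms(2)])
qed

lemma AE_circ_shift:
  assumes "AE x in circ. P x" "periodic P"
  shows "AE x in circ. P (x + c)"
  using AE_circ_reflect[OF AE_circ_reflect[OF assms] periodic_cong_reflect[OF assms(2)], of c 0]
  by (simp add: add.commute)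

lemma integral_circ_reflect:
  fixes f :: "real \<Rightarrow> real"
  assumes [measurable]: "f \<in> borel_measurable borel" and per: "periodic f"
  shows "(LINT x|circ. f (c - x)) = (LINT x|circ. f x)"
proof -
  have "(LINT x|circ. f x) = (LINT x|distr circ circ (\<lambda>x. wrap (c - x)). f x)"
    by (simp add: distr_circ_reflect)
  also have "\<dots> = (LINT x|circ. f (wrap (c - x)))" by (rule integral_distr) auto
  finally show ?thesis by (simp add: periodic_wrap_eq[OF per])
qed

lemma AE_circ_countable: "countable S \<Longrightarrow> AE x in circ. x \<notin> S"
  unfolding AE_circ by (rule AE_mp[OF AE_not_in[of S lborel]]) (auto simp: countable_imp_null_set_lborel)

text \<open>The zeros are, modulo \<open>2 * pi\<close>, the two fixed points of the reflection
  \<open>x \<mapsto> 2 * c - x\<close>. Without them all orbits have two points.\<close>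

lemma AE_sin_neq0: "AE x in circ. sin (x - c) \<noteq> 0"
proof -
  have "countable ((\<lambda>i::int. c + of_int i * pi) ` UNIV)" by simp
  from AE_circ_countable[OF this] show ?thesis
  proof eventually_elim
    case (elim x)
    show "sin (x - c) \<noteq> 0"
    proof
      assume "sin (x - c) = 0"
      then obtain i :: int where "x - c = of_int i * pi" unfolding sin_zero_iff_int2 by blast
      then have "x = c + of_int i * pi" by simp
      with elim show False by blast
    qed
  qed
qed

lemma AE_sin_neq0': "AE x in circ. sin (c - x) \<noteq> 0"
  using AE_sin_neq0[of c]
proof eventually_elim
  case (elim x)
  then show ?case using sin_minus[of "x - c"] by simp
qed

section \<open>Polarization and the Riesz inequality on the circle\<close>

definition pset :: "real set \<Rightarrow> bool" where
  "pset A \<longleftrightarrow> A \<in> sets borel \<and> periodic (\<lambda>x. x \<in> A)"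

lemma psetD: "pset A \<Longrightarrow> A \<in> sets borel" "pset A \<Longrightarrow> periodic (\<lambda>x. x \<in> A)"
  by (simp_all add: pset_def)

lemma pset_indicator: "pset A \<Longrightarrow> periodic (indicator A :: real \<Rightarrow> ennreal)"
  unfolding indicator_def[abs_def] using psetD(2) by (rule periodic_comp)

lemma pset_Diff: "pset A \<Longrightarrow> pset B \<Longrightarrow> pset (A - B)"
  using periodic_comp2[of "\<lambda>x. x \<in> A" "\<lambda>x. x \<in> B" "\<lambda>a b. a \<and> \<not> b"] by (auto simp: pset_def)

lemma pset_Compl: "pset A \<Longrightarrow> pset (- A)"
  using periodic_comp[of "\<lambda>x. x \<in> A" "\<lambda>a. \<not> a"] by (auto simp: pset_def)

lemma nn_integral_circ_fold:
  fixes f :: "real \<Rightarrow> ennreal"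
  assumes [measurable]: "f \<in> borel_measurable borel" and "periodic f"
  shows "2 * (\<integral>\<^sup>+x. f x \<partial>circ) = (\<integral>\<^sup>+x. f x + f (s - x) \<partial>circ)"
  by (subst nn_integral_add) (auto simp: nn_integral_circ_reflect[OF assms] mult_2)

lemma ennreal_cancel_mult:
  fixes a b :: ennreal
  assumes "of_nat (Suc n) * a \<le> of_nat (Suc n) * b" shows "a \<le> b"
proof -
  have "of_nat (Suc n) = ennreal (real (Suc n))" by (rule ennreal_of_nat_eq_real_of_nat)
  with assms show ?thesis
    by (cases a; cases b) (auto simp: ennreal_mult[symmetric] ennreal_mult_top ennreal_mult_eq_top_iff top_unique
        simp del: of_nat_Suc)
qed

text \<open>Integrals may be compared through sums over the orbits \<open>{x, s - x}\<close>, so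
  polarization estimates reduce to finite checks on one orbit.\<close>

lemma nn_integral_circ_mono_fold:
  fixes f g :: "real \<Rightarrow> ennreal"
  assumes f: "f \<in> borel_measurable borel" "periodic f"
    and g: "g \<in> borel_measurable borel" "periodic g"
    and le: "AE x in circ. f x + f (s - x) \<le> g x + g (s - x)"
  shows "(\<integral>\<^sup>+x. f x \<partial>circ) \<le> (\<integral>\<^sup>+x. g x \<partial>circ)"
proof -
  have "2 * (\<integral>\<^sup>+x. f x \<partial>circ) \<le> 2 * (\<integral>\<^sup>+x. g x \<partial>circ)"
    unfolding nn_integral_circ_fold[OF f, of s] nn_integral_circ_fold[OF g, of s]
    using le by (rule nn_integral_mono_AE)
  then show ?thesis using ennreal_cancel_mult[of 1] by simp
qed

lemma sin_reflect: "sin ((s - x) - s / 2) = - sin (x - s / 2 :: real)"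
proof -
  have "(s - x) - s / 2 = - (x - s / 2)" by (simp add: field_simps)
  then show ?thesis by (simp only: sin_minus)
qed

text \<open>Here \<open>s\<close> matters modulo \<open>4 * pi\<close>: the parameters \<open>s\<close> and \<open>s + 2 * pi\<close> give the same reflection of the
  circle, but prefer opposite half circles.\<close>

definition pol :: "real \<Rightarrow> real set \<Rightarrow> real set" where
  "pol s A = {x. if 0 < sin (x - s / 2) then x \<in> A \<or> s - x \<in> A
                 else if sin (x - s / 2) < 0 then x \<in> A \<and> s - x \<in> A else x \<in> A}"

lemma mem_pol:
  assumes "sin (x - s / 2) \<noteq> 0"
  shows "x \<in> pol s A \<longleftrightarrow> (if 0 < sin (x - s / 2) then x \<in> A \<or> s - x \<in> A else x \<in> A \<and> s - x \<in> A)"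
    and "s - x \<in> pol s A \<longleftrightarrow> (if 0 < sin (x - s / 2) then x \<in> A \<and> s - x \<in> A else x \<in> A \<or> s - x \<in> A)"
  using assms sin_reflect[of s x] unfolding pol_def by auto

text \<open>The sign rule behind polarization: \<open>x\<close> is nearer to \<open>y\<close> than
  its mirror image \<open>s - x\<close> exactly when \<open>x\<close> and \<open>y\<close> lie on
  the same side of the axis.\<close>

lemma cos_diff_cos_reflect:
  "cos (x - y) - cos ((s - x) - y) = 2 * sin (x - s / 2) * sin (y - s / 2 :: real)"
proof -
  have 1: "x - y = (x - s / 2) - (y - s / 2)" "s - x - y = - ((x - s / 2) + (y - s / 2))" by simp_all
  show ?thesis unfolding 1 cos_minus cos_add cos_diff by simp
qed

lemma pset_pol:
  assumes "pset A" shows "pset (pol s A)"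
proof -
  have [measurable]: "A \<in> sets borel" using assms by (rule psetD)
  have "pol s A \<in> sets borel" unfolding pol_def by measurable
  moreover have "periodic (\<lambda>x. x \<in> pol s A)"
    unfolding pol_def mem_Collect_eq periodic_def
  proof
    fix x
    have "sin (x + 2 * pi - s / 2) = sin (x - s / 2)"
      using sin_periodic[of "x - s / 2"] by (simp add: algebra_simps)
    moreover have "(x + 2 * pi \<in> A) = (x \<in> A)" using psetD(2)[OF assms] unfolding periodic_def by simp
    moreover have "(s - (x + 2 * pi) \<in> A) = (s - x \<in> A)"
      using periodic_cong_reflect[OF psetD(2)[OF assms], of s] unfolding periodic_def by simp
    ultimately show "(if 0 < sin (x + 2 * pi - s / 2) then x + 2 * pi \<in> A \<or> s - (x + 2 * pi) \<in> A
       else if sin (x + 2 * pi - s / 2) < 0 then x + 2 * pi \<in> A \<and> s - (x + 2 * pi) \<in> A else x + 2 * pi \<in> A) =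
      (if 0 < sin (x - s / 2) then x \<in> A \<or> s - x \<in> A
       else if sin (x - s / 2) < 0 then x \<in> A \<and> s - x \<in> A else x \<in> A)" by simp
  qed
  ultimately show ?thesis by (simp add: pset_def)
qed

lemma emeasure_circ_nn:
  "A \<in> sets borel \<Longrightarrow> emeasure circ A = (\<integral>\<^sup>+x. indicator A x \<partial>circ)"
  by (simp add: nn_integral_indicator)

text \<open>Polarization moves points only within an orbit, so the number of orbit points in the set
  does not change.\<close>

lemma emeasure_pol_le:
  assumes "pset A" shows "emeasure circ (pol s A) = emeasure circ A"
proof -
  note 1 = psetD(1)[OF assms] psetD(1)[OF pset_pol[OF assms, of s]]
  note 2 = pset_indicator[OF assms] pset_indicator[OF pset_pol[OF assms, of s]]
  have *: "AE x in circ. indicator (pol s A) x + indicator (pol s A) (s - x) =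
      (indicator A x + indicator A (s - x) :: ennreal)"
    using AE_sin_neq0[of "s/2"]
  proof eventually_elim
    case (elim x)
    then show ?case using sin_reflect[of s x]
      by (cases "x \<in> A"; cases "s - x \<in> A"; cases "0 < sin (x - s / 2)") (auto simp: pol_def indicator_def)
  qed
  show ?thesis unfolding emeasure_circ_nn[OF 1(1)] emeasure_circ_nn[OF 1(2)]
  proof (rule antisym)
    show "(\<integral>\<^sup>+x. indicator (pol s A) x \<partial>circ) \<le> (\<integral>\<^sup>+x. indicator A x \<partial>circ)"
      by (rule nn_integral_circ_mono_fold[where s=s]) (use 1 2 * in auto)
    show "(\<integral>\<^sup>+x. indicator A x \<partial>circ) \<le> (\<integral>\<^sup>+x. indicator (pol s A) x \<partial>circ)"
      by (rule nn_integral_circ_mono_fold[where s=s]) (use 1 2 * in auto)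
  qed
qed

lemma measure_pol: "pset A \<Longrightarrow> measure circ (pol s A) = measure circ A"
  by (simp add: measure_def emeasure_pol_le)

text \<open>The open arc of centre \<open>b\<close> and length \<open>m\<close>, for
  \<open>0 \<le> m\<close> and \<open>m \<le> 2 * pi\<close>; the cosine builds periodicity in. It
  is empty for \<open>m = 0\<close> and misses only the antipode of \<open>b\<close> for
  \<open>m = 2 * pi\<close>.\<close>

definition circ_arc :: "real \<Rightarrow> real \<Rightarrow> real set" where
  "circ_arc b m = {x. cos (m / 2) < cos (x - b)}"

lemma circ_arc_measurable [measurable]: "circ_arc b m \<in> sets borel"
  unfolding circ_arc_def by measurable

lemma pset_arc: "pset (circ_arc b m)"
  using periodic_comp[OF periodic_shift_minus[OF periodic_cos, of b], of "\<lambda>c. cos (m / 2) < c"]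
  by (simp add: pset_def) (simp add: circ_arc_def)

lemma cos_less_iff_abs: "\<bar>x\<bar> \<le> pi \<Longrightarrow> \<bar>y\<bar> \<le> pi \<Longrightarrow> cos x < cos y \<longleftrightarrow> \<bar>y\<bar> < \<bar>x\<bar>"
  using cos_mono_less_eq[of "\<bar>x\<bar>" "\<bar>y\<bar>"] by simp

lemma emeasure_arc:
  assumes "0 \<le> m" "m \<le> 2 * pi"
  shows "emeasure circ (circ_arc b m) = ennreal m"
proof -
  have "emeasure circ (circ_arc b m) = (\<integral>\<^sup>+x. indicator (circ_arc 0 m) (x - b) \<partial>circ)"
    unfolding emeasure_circ_nn[OF circ_arc_measurable]
    by (rule nn_integral_cong) (simp add: circ_arc_def split: split_indicator)
  also have "\<dots> = (\<integral>\<^sup>+x. indicator (circ_arc 0 m) x \<partial>circ)"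
    using nn_integral_circ_shift[of "indicator (circ_arc 0 m)" "- b"] pset_indicator[OF pset_arc, of 0 m] by simp
  also have "\<dots> = (\<integral>\<^sup>+x. indicator {- (m / 2)<..<m / 2} x \<partial>lborel)"
  proof (subst nn_integral_circ)
    have "indicator {- pi..<pi} x * indicator (circ_arc 0 m) x = (indicator {- (m / 2)<..<m / 2} x :: ennreal)" for x
    proof (cases "x \<in> {- pi..<pi}")
      case True
      then have "x \<in> circ_arc 0 m \<longleftrightarrow> \<bar>x\<bar> < m / 2"
        using cos_less_iff_abs[of "m / 2" x] assms by (auto simp: circ_arc_def abs_le_iff)
      with True show ?thesis by (auto simp: indicator_def)
    next
      case False
      then show ?thesis using assms by (auto simp: indicator_def)
    qed
    then show "(\<integral>\<^sup>+x. indicator {- pi..<pi} x * indicator (circ_arc 0 m) x \<partial>lborel) = (\<integral>\<^sup>+x. indicator {- (m / 2)<..<m / 2} x \<partial>lborel)"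
      by simp
  qed simp
  also have "\<dots> = ennreal m" using assms by simp
  finally show ?thesis .
qed

lemma measure_arc: "0 \<le> m \<Longrightarrow> m \<le> 2 * pi \<Longrightarrow> measure circ (circ_arc b m) = m"
  by (simp add: measure_def emeasure_arc)

text \<open>Polarization with \<open>sin (s / 2) \<le> 0\<close> moves mass towards \<open>0\<close>; the part of \<open>A\<close> outside the centred
  arc whose mirror image lies in the arc but not in \<open>A\<close> is transported into the arc.\<close>

lemma pol_gain:
  assumes A: "pset A" and s: "sin (s / 2) \<le> 0"
  shows "emeasure circ (pol s A - circ_arc 0 m) +
      emeasure circ {x. x \<in> A - circ_arc 0 m \<and> s - x \<in> circ_arc 0 m - A} \<le> emeasure circ (A - circ_arc 0 m)"
proof -
  let ?R = "circ_arc 0 m" let ?T = "{x. x \<in> A - circ_arc 0 m \<and> s - x \<in> circ_arc 0 m - A}"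
  have [measurable]: "A \<in> sets borel" "pol s A \<in> sets borel"
    using psetD(1)[OF A] psetD(1)[OF pset_pol[OF A]] by auto
  have T: "?T \<in> sets borel" by measurable
  have pT: "pset ?T"
    unfolding pset_def mem_Collect_eq
  proof (rule conjI[OF T])
    show "periodic (\<lambda>x. x \<in> A - ?R \<and> s - x \<in> ?R - A)"
      by (rule periodic_comp2[where h="(\<and>)", OF psetD(2)[OF pset_Diff[OF A pset_arc]]
        periodic_cong_reflect[OF psetD(2)[OF pset_Diff[OF pset_arc A]]]])
  qed
  have pP: "pset (pol s A - ?R)" by (intro pset_Diff pset_pol A pset_arc)
  have "emeasure circ (pol s A - ?R) + emeasure circ ?T = (\<integral>\<^sup>+x. indicator (pol s A - ?R) x + indicator ?T x \<partial>circ)"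
    using T by (subst nn_integral_add) auto
  also have "\<dots> \<le> (\<integral>\<^sup>+x. indicator (A - ?R) x \<partial>circ)"
  proof (rule nn_integral_circ_mono_fold[where s=s])
    show "periodic (\<lambda>x. indicator (pol s A - ?R) x + indicator ?T x :: ennreal)"
      by (rule periodic_comp2[OF pset_indicator[OF pP] pset_indicator[OF pT]])
    show "periodic (indicator (A - ?R) :: real \<Rightarrow> ennreal)"
      by (intro pset_indicator pset_Diff A pset_arc)
    show "AE x in circ. indicator (pol s A - ?R) x + indicator ?T x + (indicator (pol s A - ?R) (s - x) + indicator ?T (s - x))
       \<le> indicator (A - ?R) x + (indicator (A - ?R) (s - x) :: ennreal)"
      using AE_sin_neq0[of "s/2"]
    proof eventually_elim
      case (elim x)
      have cs: "cos x - cos (s - x) = - 2 * sin (s / 2) * sin (x - s / 2)"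
      proof -
        have "cos x = cos ((x - s / 2) + s / 2)" "cos (s - x) = cos (s / 2 - (x - s / 2))" by simp_all
        then show ?thesis unfolding cos_add[of "x - s / 2"] cos_diff[of "s / 2" "x - s / 2"] by simp
      qed
      consider "0 < sin (x - s / 2)" | "sin (x - s / 2) < 0" using elim by linarith
      then show ?case
      proof cases
        case 1
        \<comment> \<open>The preferred half circle contains 0 or borders on it, so a centred arc
          containing the mirror image \<open>s - x\<close> also contains \<open>x\<close>. The rest
          is a check of memberships.\<close>
        have "0 \<le> - 2 * sin (s / 2) * sin (x - s / 2)" using mult_nonpos_nonneg[of "sin (s / 2)" "sin (x - s / 2)"] 1 s
          by simp
        then have "s - x \<in> ?R \<Longrightarrow> x \<in> ?R" unfolding circ_arc_def using cs by simp
        then show ?thesis using 1 sin_reflect[of s x]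
          by (cases "x \<in> A"; cases "s - x \<in> A"; cases "x \<in> ?R"; cases "s - x \<in> ?R")
            (auto simp: pol_def indicator_def)
      next
        case 2
        have "- 2 * sin (s / 2) * sin (x - s / 2) \<le> 0" using mult_nonpos_nonpos[of "sin (s / 2)" "sin (x - s / 2)"] 2 s
          by simp
        then have "x \<in> ?R \<Longrightarrow> s - x \<in> ?R" unfolding circ_arc_def using cs by simp
        then show ?thesis using 2 sin_reflect[of s x]
          by (cases "x \<in> A"; cases "s - x \<in> A"; cases "x \<in> ?R"; cases "s - x \<in> ?R")
            (auto simp: pol_def indicator_def)
      qed
    qed
  qed (use T in auto)
  also have "\<dots> = emeasure circ (A - ?R)" by simp
  finally show ?thesis .
qed

text \<open>Integrated over all reflections, the overlap is a convolution of indicators and Tonelli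
  gives a product. Hence some reflection achieves at least the mean overlap.\<close>

lemma nn_integral_overlap:
  assumes "pset A" "pset B"
  shows "(\<integral>\<^sup>+s. emeasure circ {x. x \<in> A \<and> s - x \<in> B} \<partial>circ) = emeasure circ A * emeasure circ B"
proof -
  have [measurable]: "A \<in> sets borel" "B \<in> sets borel" using assms by (auto simp: pset_def)
  have "(\<integral>\<^sup>+s. emeasure circ {x. x \<in> A \<and> s - x \<in> B} \<partial>circ) =
     (\<integral>\<^sup>+s. \<integral>\<^sup>+x. indicator A x * indicator B (s - x) \<partial>circ \<partial>circ)"
  proof (rule nn_integral_cong)
    fix s
    have *: "{x. x \<in> A \<and> s - x \<in> B} \<in> sets borel" by measurable
    show "emeasure circ {x. x \<in> A \<and> s - x \<in> B} = (\<integral>\<^sup>+x. indicator A x * indicator B (s - x) \<partial>circ)"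
      unfolding emeasure_circ_nn[OF *] by (intro nn_integral_cong) (auto split: split_indicator)
  qed
  also have "\<dots> = (\<integral>\<^sup>+x. \<integral>\<^sup>+s. indicator A x * indicator B (s - x) \<partial>circ \<partial>circ)"
    by (rule circ_pair.Fubini') measurable
  also have "\<dots> = (\<integral>\<^sup>+x. indicator A x * emeasure circ B \<partial>circ)"
  proof (rule nn_integral_cong)
    fix x
    have "(\<integral>\<^sup>+s. indicator A x * indicator B (s - x) \<partial>circ) = indicator A x * (\<integral>\<^sup>+s. indicator B (s + (- x)) \<partial>circ)"
      by (subst nn_integral_cmult[symmetric]) auto
    also have "(\<integral>\<^sup>+s. indicator B (s + (- x)) \<partial>circ) = emeasure circ B"
      by (subst nn_integral_circ_shift[OF _ pset_indicator[OF assms(2)]]) auto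
    finally show "(\<integral>\<^sup>+s. indicator A x * indicator B (s - x) \<partial>circ) = indicator A x * emeasure circ B" .
  qed
  also have "\<dots> = emeasure circ A * emeasure circ B"
    by (subst nn_integral_multc) auto
  finally show ?thesis .
qed

lemma overlap_measurable:
  assumes "pset A" "pset B"
  shows "(\<lambda>s. emeasure circ {x. x \<in> A \<and> s - x \<in> B}) \<in> borel_measurable borel"
proof -
  have [measurable]: "A \<in> sets borel" "B \<in> sets borel" using assms by (auto simp: pset_def)
  have "(\<lambda>s. emeasure circ {x. x \<in> A \<and> s - x \<in> B}) =
     (\<lambda>s. \<integral>\<^sup>+x. indicator A x * indicator B (s - x) \<partial>circ)"
  proof (rule ext)
    fix s
    have *: "{x. x \<in> A \<and> s - x \<in> B} \<in> sets borel" by measurable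
    show "emeasure circ {x. x \<in> A \<and> s - x \<in> B} = (\<integral>\<^sup>+x. indicator A x * indicator B (s - x) \<partial>circ)"
      unfolding emeasure_circ_nn[OF *] by (intro nn_integral_cong) (auto split: split_indicator)
  qed
  also have "\<dots> \<in> borel_measurable borel" by measurable
  finally show ?thesis .
qed

lemma measure_Diff_swap:
  assumes "A \<in> sets borel" "B \<in> sets borel" "measure circ A = measure circ B"
  shows "measure circ (A - B) = measure circ (B - A)"
  using circ.finite_measure_Diff'[of A B] circ.finite_measure_Diff'[of B A] assms
  by (simp add: Int_commute)

text \<open>As \<open>A\<close> and its arc have equal measure, the surplus \<open>A - RA\<close>
  and the deficit \<open>RA - A\<close> have the same measure \<open>a\<close>; similarly
  \<open>b\<close> for \<open>B\<close>. The mean transported mass over all \<open>s\<close> is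
  \<open>(a * a + b * b) / (2 * pi)\<close>. The gains are added because one reflection has to serve
  both sets.\<close>

lemma exists_improving_pol:
  fixes A B :: "real set" and m n :: real
  defines "RA \<equiv> circ_arc 0 m" and "RB \<equiv> circ_arc 0 n"
  assumes A: "pset A" and B: "pset B"
    and mA: "measure circ A = measure circ RA" and mB: "measure circ B = measure circ RB"
    and pos: "0 < measure circ (A - RA) + measure circ (B - RB)"
  shows "\<exists>s. measure circ (pol s A - RA) + measure circ (pol s B - RB)
    \<le> measure circ (A - RA) + measure circ (B - RB)
       - (measure circ (A - RA) + measure circ (B - RB))\<^sup>2 / (8 * pi)"
proof -
  define a b where "a = measure circ (A - RA)" and "b = measure circ (B - RB)"
  note ps = A B pset_arc
  have a': "measure circ (RA - A) = a" and b': "measure circ (RB - B) = b"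
    using measure_Diff_swap[of A RA] measure_Diff_swap[of B RB] mA mB psetD(1)[OF A] psetD(1)[OF B]
    unfolding a_def b_def RA_def RB_def by auto
  have ab: "0 \<le> a" "0 \<le> b" "0 < a + b" using pos by (auto simp: a_def b_def)
  define h where "h s = emeasure circ {x. x \<in> A - RA \<and> s - x \<in> RA - A} + emeasure circ {x. x \<in> B - RB \<and> s - x \<in> RB - B}" for s
  have hm: "h \<in> borel_measurable borel" unfolding h_def[abs_def] RA_def RB_def
    by (intro borel_measurable_add overlap_measurable pset_Diff ps)
  have "(\<integral>\<^sup>+s. h s \<partial>circ) = emeasure circ (A - RA) * emeasure circ (RA - A) + emeasure circ (B - RB) * emeasure circ (RB - B)"
    unfolding h_def RA_def RB_def
    by (subst nn_integral_add)
      (simp_all only: overlap_measurable nn_integral_overlap pset_Diff ps measurable_cong_sets[OF sets_circ refl])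
  also have "\<dots> = ennreal (a * a + b * b)"
    unfolding circ.emeasure_eq_measure a' b' a_def[symmetric] b_def[symmetric] using ab
    by (simp add: ennreal_mult[symmetric] ennreal_plus[symmetric] del: ennreal_plus)
  finally have tot: "(\<integral>\<^sup>+s. h s \<partial>circ) = ennreal (a * a + b * b)" .
  \<comment> \<open>Only half of the mean is asked for; the slack makes positivity of
    \<open>a * a + b * b\<close> contradictory.\<close>
  have "\<exists>s. ennreal ((a * a + b * b) / (4 * pi)) \<le> h s"
  proof (rule ccontr)
    assume "\<not> ?thesis"
    then have "(\<integral>\<^sup>+s. h s \<partial>circ) \<le> (\<integral>\<^sup>+s. ennreal ((a * a + b * b) / (4 * pi)) \<partial>circ)"
      by (intro nn_integral_mono) (meson less_imp_le not_le)
    also have "\<dots> = ennreal ((a * a + b * b) / 2)"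
      by (simp add: emeasure_circ_UNIV ennreal_mult[symmetric])
    finally have "a * a + b * b \<le> (a * a + b * b) / 2" unfolding tot by (subst (asm) ennreal_le_iff) auto
    moreover have "0 < a * a + b * b" using ab
      by (metis add.right_neutral add_nonneg_pos add_pos_nonneg less_eq_real_def mult_pos_pos zero_le_square)
    ultimately show False by simp
  qed
  then obtain s0 where s0: "ennreal ((a * a + b * b) / (4 * pi)) \<le> h s0" by blast
  have hper: "h (x + 2 * pi) = h x" for x
  proof -
    have "(x + 2 * pi - y \<in> RA - A) = (x - y \<in> RA - A)" "(x + 2 * pi - y \<in> RB - B) = (x - y \<in> RB - B)" for y
      using psetD(2)[OF pset_Diff[OF ps(3) A], of 0 m] psetD(2)[OF pset_Diff[OF ps(3) B], of 0 n]
      unfolding periodic_def RA_def RB_def by (metis add_diff_eq diff_add_eq)+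
    then show ?thesis unfolding h_def by simp
  qed
  \<comment> \<open>Passing from \<open>s0\<close> to \<open>s0 + 2 * pi\<close> keeps the
    reflection, hence \<open>h\<close>, and swaps the preferred side, so the side of 0 can be
    chosen.\<close>
  obtain s where s: "sin (s / 2) \<le> 0" "h s = h s0"
  proof (cases "sin (s0 / 2) \<le> 0")
    case True then show ?thesis using that by blast
  next
    case False
    have "sin ((s0 + 2 * pi) / 2) = - sin (s0 / 2)"
      using sin_periodic_pi[of "s0 / 2"] by (simp add: field_simps)
    then show ?thesis using that[of "s0 + 2 * pi"] hper False by simp
  qed
  have "emeasure circ (pol s A - RA) + emeasure circ (pol s B - RB) + h s
     \<le> emeasure circ (A - RA) + emeasure circ (B - RB)"
    using add_mono[OF pol_gain[OF A s(1), of m] pol_gain[OF B s(1), of n]]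
    unfolding h_def RA_def RB_def by (simp add: ac_simps)
  then have "emeasure circ (pol s A - RA) + emeasure circ (pol s B - RB) + ennreal ((a * a + b * b) / (4 * pi))
     \<le> emeasure circ (A - RA) + emeasure circ (B - RB)"
    using s0 s(2) by (metis (no_types, lifting) add_left_mono order_trans)
  then have "ennreal (measure circ (pol s A - RA) + measure circ (pol s B - RB) + (a * a + b * b) / (4 * pi))
     \<le> ennreal (a + b)"
    unfolding circ.emeasure_eq_measure a_def[symmetric] b_def[symmetric] using ab
    by (simp add: ennreal_plus[symmetric] del: ennreal_plus)
  then have "measure circ (pol s A - RA) + measure circ (pol s B - RB) + (a * a + b * b) / (4 * pi) \<le> a + b"
    by (subst (asm) ennreal_le_iff) (use ab in auto)
  \<comment> \<open>The gain is expressed through the total distance \<open>a + b\<close> alone,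
    which turns \<open>4 * pi\<close> into \<open>8 * pi\<close>.\<close>
  moreover have "(a + b)\<^sup>2 / (8 * pi) \<le> (a * a + b * b) / (4 * pi)"
  proof -
    have "(a + b)\<^sup>2 \<le> 2 * (a * a + b * b)"
      using zero_le_power2[of "a - b"] by (simp add: algebra_simps power2_eq_square)
    then have "(a + b)\<^sup>2 / (8 * pi) \<le> 2 * (a * a + b * b) / (8 * pi)" by (rule divide_right_mono) simp
    also have "\<dots> = (a * a + b * b) / (4 * pi)" by (simp add: field_simps)
    finally show ?thesis .
  qed
  ultimately show ?thesis unfolding a_def[symmetric] b_def[symmetric] by (intro exI[of _ s]) linarith
qed

section \<open>The Riesz functional under polarization\<close>

definition riesz :: "(real \<Rightarrow> ennreal) \<Rightarrow> real set \<Rightarrow> real set \<Rightarrow> ennreal" where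
  "riesz G A B = (\<integral>\<^sup>+x. \<integral>\<^sup>+y. indicator A x * indicator B y * G (x - y) \<partial>circ \<partial>circ)"

text \<open>The integrand summed over the product of the orbits of \<open>x\<close> and
  \<open>y\<close>. For an even kernel the four differences produce only the two values
  \<open>G (x - y)\<close> and \<open>G ((s - x) - y)\<close>.\<close>

definition fold4 :: "(real \<Rightarrow> ennreal) \<Rightarrow> real \<Rightarrow> real set \<Rightarrow> real set \<Rightarrow> real \<Rightarrow> real \<Rightarrow> ennreal" where
  "fold4 G s A B x y =
     (indicator A x * indicator B y * G (x - y) + indicator A (s - x) * indicator B (s - y) * G (x - y)) +
     (indicator A (s - x) * indicator B y * G ((s - x) - y) + indicator A x * indicator B (s - y) * G ((s - x) - y))"

text \<open>\<open>cos s < cos t\<close> says that \<open>t\<close> is closer to 0 on the circle.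
  \<open>G_mono\<close> leaves out the null set of points with vanishing sine, because the slice
  conditions do not constrain a kernel at 0.\<close>

locale circ_kernel =
  fixes G :: "real \<Rightarrow> ennreal" and C :: real
  assumes G_meas [measurable]: "G \<in> borel_measurable borel"
    and G_periodic: "periodic G"
    and G_even: "G (- x) = G x"
    and G_le: "G x \<le> ennreal C" and C_nonneg: "0 \<le> C"
    and G_mono: "cos s < cos t \<Longrightarrow> sin s \<noteq> 0 \<Longrightarrow> sin t \<noteq> 0 \<Longrightarrow> G s \<le> G t"
begin

lemma fold4_measurable:
  assumes "pset A" "pset B"
  shows "(\<lambda>(x, y). fold4 G s A B x y) \<in> borel_measurable (circ \<Otimes>\<^sub>M circ)"
proof -
  have [measurable]: "A \<in> sets borel" "B \<in> sets borel" using assms by (auto simp: pset_def)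
  show ?thesis unfolding fold4_def by measurable
qed

text \<open>Each variable may be reflected separately, which gives four changes of variables that
  leave the double integral invariant.\<close>

lemma riesz_fold4:
  assumes "pset A" "pset B"
  shows "4 * riesz G A B = (\<integral>\<^sup>+x. \<integral>\<^sup>+y. fold4 G s A B x y \<partial>circ \<partial>circ)"
proof -
  have [measurable]: "A \<in> sets borel" "B \<in> sets borel" using assms by (auto simp: pset_def)
  define \<phi> where "\<phi> x = (\<integral>\<^sup>+y. indicator B y * G (x - y) \<partial>circ)" for x
  have [measurable]: "\<phi> \<in> borel_measurable borel" unfolding \<phi>_def by measurable
  have G_shift: "G (x + 2 * pi - y) = G (x - y)" for x y
    using G_periodic unfolding periodic_def by (metis add_diff_eq diff_add_eq)
  have per: "periodic \<phi>" unfolding periodic_def \<phi>_def G_shift by simp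
  have per2: "periodic (\<lambda>x. indicator A x * \<phi> x)"
    by (rule periodic_comp2[OF pset_indicator[OF assms(1)] per])
  have refl: "(\<integral>\<^sup>+y. indicator B (s - y) * G (x - y) \<partial>circ) = \<phi> (s - x)" for x
  proof -
    have "periodic (\<lambda>y. indicator B y * G ((s - x) - y))"
      by (rule periodic_comp2[OF pset_indicator[OF assms(2)] periodic_cong_reflect[OF G_periodic]])
    from nn_integral_circ_reflect[OF _ this, of s]
    have "\<phi> (s - x) = (\<integral>\<^sup>+y. indicator B (s - y) * G ((s - x) - (s - y)) \<partial>circ)"
      unfolding \<phi>_def by simp
    also have "\<dots> = (\<integral>\<^sup>+y. indicator B (s - y) * G (x - y) \<partial>circ)"
      using G_even[of "x - y" for y] by simp
    finally show ?thesis by simp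
  qed
  have 1: "(\<integral>\<^sup>+x. \<integral>\<^sup>+y. indicator A x * indicator B y * G (x - y) \<partial>circ \<partial>circ) = (\<integral>\<^sup>+x. indicator A x * \<phi> x \<partial>circ)"
    unfolding \<phi>_def by (simp add: mult.assoc nn_integral_cmult)
  have 2: "(\<integral>\<^sup>+x. \<integral>\<^sup>+y. indicator A (s - x) * indicator B (s - y) * G (x - y) \<partial>circ \<partial>circ) = (\<integral>\<^sup>+x. indicator A x * \<phi> x \<partial>circ)"
    using nn_integral_circ_reflect[OF _ per2, of s]
    by (simp add: mult.assoc nn_integral_cmult refl)
  have 3: "(\<integral>\<^sup>+x. \<integral>\<^sup>+y. indicator A (s - x) * indicator B y * G ((s - x) - y) \<partial>circ \<partial>circ) = (\<integral>\<^sup>+x. indicator A x * \<phi> x \<partial>circ)"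
    using nn_integral_circ_reflect[OF _ per2, of s]
    by (simp add: mult.assoc nn_integral_cmult \<phi>_def)
  have 4: "(\<integral>\<^sup>+x. \<integral>\<^sup>+y. indicator A x * indicator B (s - y) * G ((s - x) - y) \<partial>circ \<partial>circ) = (\<integral>\<^sup>+x. indicator A x * \<phi> x \<partial>circ)"
    by (simp add: mult.assoc nn_integral_cmult refl[of "s - x" for x])
  have "4 * riesz G A B = ((\<integral>\<^sup>+x. indicator A x * \<phi> x \<partial>circ) + (\<integral>\<^sup>+x. indicator A x * \<phi> x \<partial>circ)) + ((\<integral>\<^sup>+x. indicator A x * \<phi> x \<partial>circ) + (\<integral>\<^sup>+x. indicator A x * \<phi> x \<partial>circ))"
    unfolding riesz_def 1 by (simp add: mult_2[symmetric])
  also have "\<dots> = (\<integral>\<^sup>+x. \<integral>\<^sup>+y. fold4 G s A B x y \<partial>circ \<partial>circ)"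
    unfolding fold4_def
    by (simp add: nn_integral_add 1 2 3 4)
  finally show ?thesis .
qed

text \<open>A two-point rearrangement inequality: polarization sorts both orbits towards the same
  side, and the larger kernel value is the one between points on the same side. The sixteen
  membership patterns are checked directly.\<close>

lemma fold4_pol:
  assumes "sin (x - s / 2) \<noteq> 0" "sin (y - s / 2) \<noteq> 0" "sin (x - y) \<noteq> 0" "sin ((s - x) - y) \<noteq> 0"
  shows "fold4 G s A B x y \<le> fold4 G s (pol s A) (pol s B) x y"
proof -
  note cs = cos_diff_cos_reflect[of x y s]
  define u v where "u = sin (x - s / 2)" and "v = sin (y - s / 2)"
  have le1: "G ((s - x) - y) \<le> G (x - y)" if "0 < u * v"
    using cs that assms by (intro G_mono) (auto simp: u_def v_def)
  have le2: "G (x - y) \<le> G ((s - x) - y)" if "u * v < 0"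
    using cs that assms by (intro G_mono) (auto simp: u_def v_def)
  note px = mem_pol[OF assms(1), folded u_def] mem_pol[OF assms(2), folded v_def]
  have uv: "u < 0 \<or> 0 < u" "v < 0 \<or> 0 < v" using assms by (auto simp: u_def v_def)
  from uv show ?thesis
  proof (elim disjE)
    assume *: "u < 0" "v < 0"
    then show ?thesis using le1[OF mult_neg_neg[OF *]] unfolding fold4_def indicator_def px
      by (cases "x \<in> A"; cases "s - x \<in> A"; cases "y \<in> B"; cases "s - y \<in> B") (simp_all add: ac_simps)
  next
    assume *: "u < 0" "0 < v"
    then show ?thesis using le2[OF mult_neg_pos[OF *]] unfolding fold4_def indicator_def px
      by (cases "x \<in> A"; cases "s - x \<in> A"; cases "y \<in> B"; cases "s - y \<in> B") (simp_all add: ac_simps)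
  next
    assume *: "0 < u" "v < 0"
    then show ?thesis using le2[OF mult_pos_neg[OF *]] unfolding fold4_def indicator_def px
      by (cases "x \<in> A"; cases "s - x \<in> A"; cases "y \<in> B"; cases "s - y \<in> B") (simp_all add: ac_simps)
  next
    assume *: "0 < u" "0 < v"
    then show ?thesis using le1[OF mult_pos_pos[OF *]] unfolding fold4_def indicator_def px
      by (cases "x \<in> A"; cases "s - x \<in> A"; cases "y \<in> B"; cases "s - y \<in> B") (simp_all add: ac_simps)
  qed
qed

lemma AE_generic: "AE x in circ. AE y in circ.
   sin (x - s / 2) \<noteq> 0 \<and> sin (y - s / 2) \<noteq> 0 \<and> sin (x - y) \<noteq> 0 \<and> sin ((s - x) - y) \<noteq> 0"
  using AE_sin_neq0[of "s / 2"]
proof eventually_elim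
  case (elim x)
  show ?case using AE_sin_neq0[of "s / 2"] AE_sin_neq0'[of x] AE_sin_neq0'[of "s - x"]
    by eventually_elim (use elim in auto)
qed

lemma AE_fold4_pol: "AE x in circ. AE y in circ. fold4 G s A B x y \<le> fold4 G s (pol s A) (pol s B) x y"
  using AE_generic[of s]
proof eventually_elim
  case (elim x)
  then show ?case by eventually_elim (intro fold4_pol, auto)
qed

lemma riesz_pol: 
  assumes "pset A" "pset B"
  shows "riesz G A B \<le> riesz G (pol s A) (pol s B)"
proof -
  have "4 * riesz G A B \<le> 4 * riesz G (pol s A) (pol s B)"
    unfolding riesz_fold4[OF assms, of s] riesz_fold4[OF pset_pol[OF assms(1)] pset_pol[OF assms(2)], where s=s]
    by (rule nn_integral_mono_AE, rule AE_mp[OF AE_fold4_pol[of s A B]], rule AE_I2)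
      (auto intro: nn_integral_mono_AE)
  then show ?thesis using ennreal_cancel_mult[of 3] by simp
qed

text \<open>The functional is Lipschitz in the measure of the parts outside the comparison sets, so
  it suffices to come close to the arcs; no limit of polarized sets has to be formed.\<close>

lemma riesz_perturb:
  assumes [measurable]: "A \<in> sets borel" "B \<in> sets borel" "R \<in> sets borel" "S \<in> sets borel"
  shows "riesz G A B \<le> riesz G R S + ennreal (2 * pi * C * (measure circ (A - R) + measure circ (B - S)))"
proof -
  have "riesz G A B \<le> (\<integral>\<^sup>+x. \<integral>\<^sup>+y. indicator R x * indicator S y * G (x - y)
      + (indicator (A - R) x * ennreal C + indicator (B - S) y * ennreal C) \<partial>circ \<partial>circ)"
    unfolding riesz_def
  proof (intro nn_integral_mono)
    fix x y
    show "indicator A x * indicator B y * G (x - y) \<le> indicator R x * indicator S y * G (x - y)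
      + (indicator (A - R) x * ennreal C + indicator (B - S) y * ennreal C)"
      using G_le[of "x - y"]
      by (cases "x \<in> A"; cases "y \<in> B"; cases "x \<in> R"; cases "y \<in> S") (simp_all add: add_increasing add_increasing2)
  qed
  also have "\<dots> = riesz G R S + (\<integral>\<^sup>+x. indicator (A - R) x * ennreal C * ennreal (2 * pi) + emeasure circ (B - S) * ennreal C \<partial>circ)"
    unfolding riesz_def
    by (simp add: nn_integral_add nn_integral_multc emeasure_circ_UNIV)
  also have "(\<integral>\<^sup>+x. indicator (A - R) x * ennreal C * ennreal (2 * pi) + emeasure circ (B - S) * ennreal C \<partial>circ)
     = emeasure circ (A - R) * ennreal C * ennreal (2 * pi) + emeasure circ (B - S) * ennreal C * ennreal (2 * pi)"
    by (simp add: nn_integral_add nn_integral_multc emeasure_circ_UNIV)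
  also have "\<dots> = ennreal (2 * pi * C * (measure circ (A - R) + measure circ (B - S)))"
    unfolding circ.emeasure_eq_measure using C_nonneg
    by (simp add: ennreal_mult[symmetric] ennreal_plus[symmetric] algebra_simps del: ennreal_plus)
  finally show ?thesis .
qed

text \<open>The distance to the arcs is minimised over all pairs with the given measures and no
  smaller functional. If the infimum \<open>\<delta>\<close> were positive, a pair within
  \<open>\<delta>\<^sup>2 / (8 * pi)\<close> of it could be polarized below it.\<close>

lemma riesz_rearrangement:
  assumes A: "pset A" and B: "pset B"
  shows "riesz G A B \<le> riesz G (circ_arc 0 (measure circ A)) (circ_arc 0 (measure circ B))"
proof -
  let ?RA = "circ_arc 0 (measure circ A)" and ?RB = "circ_arc 0 (measure circ B)"
  have mR: "measure circ ?RA = measure circ A" "measure circ ?RB = measure circ B"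
    by (simp_all add: measure_arc measure_circ_le)
  define \<P> where "\<P> = {(A', B'). pset A' \<and> pset B' \<and> measure circ A' = measure circ A
     \<and> measure circ B' = measure circ B \<and> riesz G A B \<le> riesz G A' B'}"
  define D where "D = (\<lambda>(A', B'). measure circ (A' - ?RA) + measure circ (B' - ?RB))"
  have AB: "(A, B) \<in> \<P>" using A B by (simp add: \<P>_def)
  have D0: "0 \<le> D p" for p by (cases p) (simp add: D_def)
  then have bdd: "bdd_below (D ` \<P>)" by (intro bdd_belowI2[where m=0]) auto
  define \<delta> where "\<delta> = Inf (D ` \<P>)"
  have \<delta>0: "0 \<le> \<delta>" unfolding \<delta>_def using AB D0 by (intro cInf_greatest) auto
  have \<delta>_le: "\<delta> \<le> D p" if "p \<in> \<P>" for p
    unfolding \<delta>_def using that bdd by (intro cInf_lower) auto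
  have near: "\<exists>p\<in>\<P>. D p < \<delta> + e" if "0 < e" for e
  proof -
    have "Inf (D ` \<P>) < \<delta> + e" using that \<delta>_def by simp
    then show ?thesis using cInf_lessD[of "D ` \<P>" "\<delta> + e"] AB by blast
  qed
  have "\<delta> = 0"
  proof (rule ccontr)
    assume "\<delta> \<noteq> 0"
    with \<delta>0 have pos: "0 < \<delta>" by simp
    then obtain p where p: "p \<in> \<P>" "D p < \<delta> + \<delta>\<^sup>2 / (8 * pi)"
      using near[of "\<delta>\<^sup>2 / (8 * pi)"] by auto
    obtain A' B' where p': "p = (A', B')" by (cases p)
    have P: "pset A'" "pset B'" "measure circ A' = measure circ A" "measure circ B' = measure circ B"
      "riesz G A B \<le> riesz G A' B'" using p(1) by (auto simp: p' \<P>_def)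
    have "0 < D p" using \<delta>_le[OF p(1)] pos by linarith
    then obtain s where s: "D (pol s A', pol s B') \<le> D p - (D p)\<^sup>2 / (8 * pi)"
      using exists_improving_pol[OF P(1,2), of "measure circ A" "measure circ B"] P(3,4) mR
      by (auto simp: D_def p')
    have "(pol s A', pol s B') \<in> \<P>"
      using P riesz_pol[OF P(1,2), of s] by (auto simp: \<P>_def pset_pol measure_pol)
    then have "\<delta> \<le> D p - (D p)\<^sup>2 / (8 * pi)" using \<delta>_le s by fastforce
    moreover have "\<delta>\<^sup>2 / (8 * pi) \<le> (D p)\<^sup>2 / (8 * pi)"
      using \<delta>_le[OF p(1)] pos by (intro divide_right_mono power_mono) auto
    ultimately show False using p(2) by linarith
  qed
  show ?thesis
  proof (rule ennreal_le_epsilon)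
    fix e :: real assume e: "0 < e"
    \<comment> \<open>The summand 1 keeps the divisor positive when \<open>C = 0\<close>.\<close>
    obtain p where p: "p \<in> \<P>" "D p < e / (2 * pi * C + 1)"
      using near[of "e / (2 * pi * C + 1)"] e C_nonneg \<open>\<delta> = 0\<close>
      by (auto simp: add_nonneg_pos)
    obtain A' B' where p': "p = (A', B')" by (cases p)
    have P: "pset A'" "pset B'" "riesz G A B \<le> riesz G A' B'" using p(1) by (auto simp: p' \<P>_def)
    note P(3)
    also have "riesz G A' B' \<le> riesz G ?RA ?RB + ennreal (2 * pi * C * D p)"
      using riesz_perturb[OF psetD(1)[OF P(1)] psetD(1)[OF P(2)], of ?RA ?RB] by (simp add: D_def p')
    also have "2 * pi * C * D p \<le> e"
    proof -
      have "2 * pi * C * D p \<le> (2 * pi * C + 1) * D p" using D0[of p] by (simp add: algebra_simps)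
      also have "\<dots> \<le> e"
      proof -
        have "0 < 2 * pi * C + 1" using C_nonneg by (simp add: add_nonneg_pos)
        then show ?thesis using p(2) by (simp only: pos_less_divide_eq mult.commute less_imp_le)
      qed
      finally show ?thesis .
    qed
    finally show "riesz G A B \<le> riesz G ?RA ?RB + ennreal e"
      by (auto simp: add_left_mono ennreal_leI)
  qed
qed

end

section \<open>The equality case on the circle\<close>

lemma circ_integrable_bounded:
  fixes f :: "real \<Rightarrow> real"
  assumes "f \<in> borel_measurable borel" "\<And>x. \<bar>f x\<bar> \<le> B"
  shows "integrable circ f"
  by (rule circ.integrable_const_bound[where B=B]) (use assms in auto)

lemma AE_circ_D:
  assumes "AE x in circ. P x" obtains x where "P x"
proof -
  have "\<not> (AE x in circ. False)"
  proof
    assume "AE x in circ. False"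
    then have "emeasure circ UNIV = emeasure circ {}" by (intro emeasure_eq_AE) auto
    then show False by (simp add: emeasure_circ_UNIV)
  qed
  then show ?thesis using assms that by (metis (mono_tags, lifting) AE_cong eventually_mono)
qed

lemma not_AE_D:
  assumes "\<not> (AE x in M. \<not> P x)" "AE x in M. Q x" obtains x where "P x" "Q x"
proof (rule ccontr)
  assume "\<not> thesis"
  then have *: "\<not> (P x \<and> Q x)" for x using that by blast
  have "AE x in M. \<not> P x" using assms(2) by eventually_elim (use * in blast)
  with assms(1) show False by blast
qed

text \<open>A single good \<open>x\<close> at which \<open>p\<close> has a strict sign already
  decides the sign of \<open>q\<close> almost everywhere.\<close>

lemma AE_product_sign:
  fixes p q :: "real \<Rightarrow> real"
  assumes "AE x in circ. AE y in circ. 0 \<le> p x * q y"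
  shows "(AE x in circ. 0 \<le> p x) \<and> (AE y in circ. 0 \<le> q y)
    \<or> (AE x in circ. p x \<le> 0) \<and> (AE y in circ. q y \<le> 0)
    \<or> (AE x in circ. p x = 0) \<or> (AE y in circ. q y = 0)"
proof -
  have pos: "AE y in circ. 0 \<le> q y" if "\<not> (AE x in circ. p x \<le> 0)"
  proof -
    obtain x where "0 < p x" "AE y in circ. 0 \<le> p x * q y"
    proof (rule ccontr)
      assume "\<not> thesis"
      then have "\<And>x. (AE y in circ. 0 \<le> p x * q y) \<Longrightarrow> p x \<le> 0" using that by (meson not_le)
      with assms \<open>\<not> (AE x in circ. p x \<le> 0)\<close> show False by (metis (mono_tags, lifting) eventually_mono)
    qed
    from this(2) show ?thesis by eventually_elim (use \<open>0 < p x\<close> in \<open>simp add: zero_le_mult_iff\<close>)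
  qed
  have neg: "AE y in circ. q y \<le> 0" if "\<not> (AE x in circ. 0 \<le> p x)"
  proof -
    obtain x where "p x < 0" "AE y in circ. 0 \<le> p x * q y"
    proof (rule ccontr)
      assume "\<not> thesis"
      then have "\<And>x. (AE y in circ. 0 \<le> p x * q y) \<Longrightarrow> 0 \<le> p x" using that by (meson not_le)
      with assms \<open>\<not> (AE x in circ. 0 \<le> p x)\<close> show False by (metis (mono_tags, lifting) eventually_mono)
    qed
    from this(2) show ?thesis by eventually_elim (use \<open>p x < 0\<close> in \<open>simp add: zero_le_mult_iff\<close>)
  qed
  show ?thesis
  proof (cases "(AE x in circ. p x \<le> 0)")
    case True
    show ?thesis
    proof (cases "(AE x in circ. 0 \<le> p x)")
      case True2: True
      have "AE x in circ. p x = 0" using True True2 by eventually_elim simp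
      then show ?thesis by blast
    next
      case False
      with True neg show ?thesis by blast
    qed
  next
    case False
    note q0 = pos[OF False]
    show ?thesis
    proof (cases "(AE x in circ. 0 \<le> p x)")
      case True
      with q0 show ?thesis by blast
    next
      case False
      have "AE y in circ. q y = 0" using q0 neg[OF False] by eventually_elim simp
      then show ?thesis by blast
    qed
  qed
qed

text \<open>Both factors are odd under \<open>x \<mapsto> s - x\<close>, so this is a function of
  the orbit: positive where \<open>A\<close> contains only the preferred point, negative where it
  contains only the other one. The sine weight relates its integral to first Fourier
  coefficients.\<close>

definition asym :: "real set \<Rightarrow> real \<Rightarrow> real \<Rightarrow> real" where
  "asym A s x = (indicat_real A x - indicat_real A (s - x)) * sin (x - s / 2)"

definition circ_cos :: "real set \<Rightarrow> real" where
  "circ_cos A = (LINT x|circ. indicat_real A x * cos x)"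

definition circ_sin :: "real set \<Rightarrow> real" where
  "circ_sin A = (LINT x|circ. indicat_real A x * sin x)"

lemma pset_indicat: "pset A \<Longrightarrow> periodic (indicat_real A)"
  unfolding indicator_def[abs_def] using psetD(2) by (rule periodic_comp)

lemma asym_measurable:
  assumes "pset A" shows "asym A s \<in> borel_measurable borel"
proof -
  have [measurable]: "A \<in> sets borel" using assms by (rule psetD)
  show ?thesis unfolding asym_def by measurable
qed

lemma asym_integrable: "pset A \<Longrightarrow> integrable circ (asym A s)"
  by (rule circ_integrable_bounded[OF asym_measurable, where B=1])
    (auto simp: asym_def indicator_def)

text \<open>If \<open>circ_cos A = r * cos \<beta>\<close> and
  \<open>circ_sin A = r * sin \<beta>\<close>, the value is
  \<open>2 * r * sin (\<beta> - s / 2)\<close>: its sign tells on which side of the axis the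
  direction \<open>\<beta>\<close> lies.\<close>

lemma integral_asym:
  assumes "pset A"
  shows "(LINT x|circ. asym A s x) = 2 * (circ_sin A * cos (s / 2) - circ_cos A * sin (s / 2))"
proof -
  have [measurable]: "A \<in> sets borel" using assms by (rule psetD)
  let ?f = "\<lambda>x. indicat_real A x * sin (x - s / 2)"
  have per: "periodic ?f"
    by (rule periodic_comp2[OF pset_indicat[OF assms] periodic_shift_minus[OF periodic_sin]])
  have int: "integrable circ ?f"
    by (rule circ_integrable_bounded[where B=1]) (auto simp: indicator_def)
  have int': "integrable circ (\<lambda>x. ?f (s - x))"
    by (rule circ_integrable_bounded[where B=1]) (auto simp: indicator_def)
  have ic: "integrable circ (\<lambda>x. indicat_real A x * sin x)" "integrable circ (\<lambda>x. indicat_real A x * cos x)"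
    by (rule circ_integrable_bounded[where B=1]; auto simp: indicator_def)+
  have "asym A s x = ?f x + ?f (s - x)" for x
    unfolding asym_def sin_reflect by (simp add: algebra_simps)
  then have "(LINT x|circ. asym A s x) = (LINT x|circ. ?f x) + (LINT x|circ. ?f (s - x))"
    using int int' by simp
  also have "(LINT x|circ. ?f (s - x)) = (LINT x|circ. ?f x)"
    by (rule integral_circ_reflect[OF _ per]) measurable
  also have "(LINT x|circ. ?f x) = (LINT x|circ. (indicat_real A x * sin x) * cos (s / 2) - (indicat_real A x * cos x) * sin (s / 2))"
    by (simp add: sin_diff algebra_simps)
  also have "\<dots> = circ_sin A * cos (s / 2) - circ_cos A * sin (s / 2)"
    unfolding circ_sin_def circ_cos_def using ic by simp
  finally show ?thesis by simp
qed

section \<open>Reflection and translation symmetries of subsets of the circle\<close>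

definition reflection_sym :: "real set \<Rightarrow> real \<Rightarrow> bool" where
  "reflection_sym A s \<longleftrightarrow> (AE x in circ. s - x \<in> A \<longleftrightarrow> x \<in> A)"

definition translation_sym :: "real set \<Rightarrow> real \<Rightarrow> bool" where
  "translation_sym A t \<longleftrightarrow> (AE x in circ. x + t \<in> A \<longleftrightarrow> x \<in> A)"

lemma asym_zero_imp_sym:
  assumes "AE x in circ. asym A s x = 0"
  shows "reflection_sym A s"
  unfolding reflection_sym_def using assms AE_sin_neq0[of "s / 2"]
  by eventually_elim (auto simp: asym_def indicator_def split: if_splits)

lemma translation_sym_add:
  assumes "pset A" "translation_sym A t" "translation_sym A u"
  shows "translation_sym A (t + u)"
proof -
  have "periodic (\<lambda>x. x + t \<in> A \<longleftrightarrow> x \<in> A)"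
    by (rule periodic_comp2[OF periodic_shift[OF psetD(2)[OF assms(1)]] psetD(2)[OF assms(1)]])
  from AE_circ_shift[OF assms(2)[unfolded translation_sym_def] this, of u]
  show ?thesis using assms(3) unfolding translation_sym_def
    by eventually_elim (simp add: add.commute add.left_commute)
qed

lemma translation_sym_uminus:
  assumes "pset A" "translation_sym A t"
  shows "translation_sym A (- t)"
proof -
  have "periodic (\<lambda>x. x + t \<in> A \<longleftrightarrow> x \<in> A)"
    by (rule periodic_comp2[OF periodic_shift[OF psetD(2)[OF assms(1)]] psetD(2)[OF assms(1)]])
  from AE_circ_shift[OF assms(2)[unfolded translation_sym_def] this, of "- t"]
  show ?thesis unfolding translation_sym_def
    by eventually_elim simp
qed

lemma reflection_sym_diff:
  assumes "pset A" "reflection_sym A s" "reflection_sym A r"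
  shows "translation_sym A (s - r)"
proof -
  have "periodic (\<lambda>x. s - x \<in> A \<longleftrightarrow> x \<in> A)"
    by (rule periodic_comp2[OF periodic_cong_reflect[OF psetD(2)[OF assms(1)]] psetD(2)[OF assms(1)]])
  from AE_circ_reflect[OF assms(2)[unfolded reflection_sym_def] this, of r]
  show ?thesis using assms(3) unfolding reflection_sym_def translation_sym_def
    by eventually_elim (simp add: algebra_simps)
qed

lemma AE_circ_swap:
  assumes "Measurable.pred (borel \<Otimes>\<^sub>M borel) (\<lambda>p. P (fst p) (snd p))" "AE x in circ. AE y in circ. P x y"
  shows "AE y in circ. AE x in circ. P x y"
proof -
  have *: "{x \<in> space (circ \<Otimes>\<^sub>M circ). P (fst x) (snd x)} \<in> sets (circ \<Otimes>\<^sub>M circ)"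
    using assms(1) by (simp add: sets_pair_measure_cong[OF sets_circ sets_circ] space_pair_measure pred_def)
  show ?thesis using circ_pair.AE_commute[of P] * assms(2) by simp
qed

text \<open>By Fubini there is a single \<open>x\<close> whose membership is shared by
  \<open>x + t\<close> for almost every \<open>t\<close>.\<close>

lemma translation_sym_all_trivial:
  assumes A: "pset A" and "\<And>t. translation_sym A t"
  shows "measure circ A = 0 \<or> measure circ A = 2 * pi"
proof -
  have [measurable]: "A \<in> sets borel" using A by (rule psetD)
  have "AE t in circ. AE x in circ. x + t \<in> A \<longleftrightarrow> x \<in> A"
    using assms(2) unfolding translation_sym_def by simp
  then have "AE x in circ. AE t in circ. x + t \<in> A \<longleftrightarrow> x \<in> A"
    by (rule AE_circ_swap[rotated]) measurable
  then obtain x where x: "AE t in circ. x + t \<in> A \<longleftrightarrow> x \<in> A" by (rule AE_circ_D)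
  have "periodic (\<lambda>t. x + t \<in> A \<longleftrightarrow> x \<in> A)"
    by (rule periodic_comp2[OF periodic_shift'[OF psetD(2)[OF A]] periodic_const])
  from AE_circ_shift[OF x this, of "- x"] have *: "AE t in circ. t \<in> A \<longleftrightarrow> x \<in> A" by simp
  show ?thesis
  proof (cases "x \<in> A")
    case True
    have "measure circ A = measure circ UNIV"
      by (rule circ.finite_measure_eq_AE) (use * True in auto)
    then show ?thesis by (simp add: measure_circ_UNIV)
  next
    case False
    have "measure circ A = measure circ {}"
      by (rule circ.finite_measure_eq_AE) (use * False in auto)
    then show ?thesis by simp
  qed
qed

text \<open>Among \<open>0\<close>, \<open>t\<close>, \<open>2 * t\<close> two are reflection symmetries of the same set, hence \<open>2 * t\<close> is a translation
  symmetry of \<open>A\<close> or of \<open>B\<close>; and a group is not the union of two proper subgroups.\<close>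

lemma reflection_cover_trivial:
  assumes A: "pset A" and B: "pset B" and cover: "\<And>s. reflection_sym A s \<or> reflection_sym B s"
  shows "measure circ A \<in> {0, 2 * pi} \<or> measure circ B \<in> {0, 2 * pi}"
proof -
  let ?TA = "translation_sym A" and ?TB = "translation_sym B"
  have dbl: "?TA (2 * t) \<or> ?TB (2 * t)" for t
  proof -
    have "?TA t" if "reflection_sym A t" "reflection_sym A 0"
      using reflection_sym_diff[OF A that] by simp
    moreover have "?TA (2 * t)" if "reflection_sym A (2 * t)" "reflection_sym A 0"
      using reflection_sym_diff[OF A that] by simp
    moreover have "?TA t" if "reflection_sym A (2 * t)" "reflection_sym A t"
      using reflection_sym_diff[OF A that] by simp
    moreover have "?TB t" if "reflection_sym B t" "reflection_sym B 0"
      using reflection_sym_diff[OF B that] by simp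
    moreover have "?TB (2 * t)" if "reflection_sym B (2 * t)" "reflection_sym B 0"
      using reflection_sym_diff[OF B that] by simp
    moreover have "?TB t" if "reflection_sym B (2 * t)" "reflection_sym B t"
      using reflection_sym_diff[OF B that] by simp
    ultimately have "?TA t \<or> ?TA (2 * t) \<or> ?TB t \<or> ?TB (2 * t)"
      using cover[of 0] cover[of t] cover[of "2 * t"] by blast
    then show ?thesis
      using translation_sym_add[OF A, of t t] translation_sym_add[OF B, of t t] unfolding mult_2 by blast
  qed
  \<comment> \<open>Every real is a double, so the two symmetry groups together cover the
    line.\<close>
  have all: "?TA t \<or> ?TB t" for t using dbl[of "t / 2"] by simp
  have "(\<forall>t. ?TA t) \<or> (\<forall>t. ?TB t)"
  proof (rule ccontr)
    assume "\<not> ?thesis"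
    then obtain u v where u: "\<not> ?TA u" and v: "\<not> ?TB v" by blast
    then have "?TB u" "?TA v" using all by blast+
    from all[of "u + v"] show False
    proof
      assume "?TA (u + v)"
      from translation_sym_add[OF A this translation_sym_uminus[OF A \<open>?TA v\<close>]] u show False by simp
    next
      assume "?TB (u + v)"
      from translation_sym_add[OF B this translation_sym_uminus[OF B \<open>?TB u\<close>]] v show False by simp
    qed
  qed
  then show ?thesis using translation_sym_all_trivial A B by blast
qed

lemma polar_form:
  fixes a b :: real
  assumes "a \<noteq> 0 \<or> b \<noteq> 0"
  obtains r \<beta> where "0 < r" "a = r * cos \<beta>" "b = r * sin \<beta>"
proof -
  define r where "r = sqrt (a\<^sup>2 + b\<^sup>2)"
  have "0 < a\<^sup>2 + b\<^sup>2" using assms by (simp add: sum_power2_gt_zero_iff)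
  then have r: "0 < r" unfolding r_def by (rule real_sqrt_gt_zero)
  have r2: "a\<^sup>2 + b\<^sup>2 = r\<^sup>2" by (simp add: r_def)
  have "(a / r)\<^sup>2 + (b / r)\<^sup>2 = (a\<^sup>2 + b\<^sup>2) / r\<^sup>2" by (simp add: power_divide add_divide_distrib)
  also have "\<dots> = 1" unfolding r2 using r by simp
  finally have "(a / r)\<^sup>2 + (b / r)\<^sup>2 = 1" .
  then obtain \<beta> where "a / r = cos \<beta>" "b / r = sin \<beta>" by (rule sincos_total_2pi)
  with r that show ?thesis by (simp add: field_simps)
qed

text \<open>The sign condition over all reflections says that, for almost all pairs, membership
  passes from a point to any point nearer to \<open>\<beta>\<close>. If \<open>A\<close> differed
  from the arc of equal measure, some point of \<open>A\<close> outside the arc and some arc point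
  outside \<open>A\<close> would contradict this.\<close>

lemma arc_from_asym:
  assumes A: "pset A" and "\<And>s. 0 < sin (\<beta> - s / 2) \<Longrightarrow> AE x in circ. 0 \<le> asym A s x"
  shows "AE x in circ. x \<in> A \<longleftrightarrow> x \<in> circ_arc \<beta> (measure circ A)"
proof -
  have Am [measurable]: "A \<in> sets borel" using A by (rule psetD)
  have perA: "x + 2 * pi \<in> A \<longleftrightarrow> x \<in> A" "x - 2 * pi \<in> A \<longleftrightarrow> x \<in> A" for x
    using psetD(2)[OF A] periodic_int'[OF psetD(2)[OF A], of x 1] unfolding periodic_def by auto
  have cs: "cos (x - \<beta>) - cos (s - x - \<beta>) = 2 * sin (\<beta> - s / 2) * sin (x - s / 2)" for s x
  proof -
    have 1: "x - \<beta> = (x - s / 2) - (\<beta> - s / 2)" "s - x - \<beta> = - ((x - s / 2) + (\<beta> - s / 2))" by simp_all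
    show ?thesis unfolding 1 cos_minus cos_add cos_diff by simp
  qed
  have step: "AE x in circ. cos (s - x - \<beta>) < cos (x - \<beta>) \<longrightarrow> s - x \<in> A \<longrightarrow> x \<in> A" for s
  proof -
    consider "sin (\<beta> - s / 2) = 0" | "0 < sin (\<beta> - s / 2)" | "sin (\<beta> - s / 2) < 0" by linarith
    then show ?thesis
    proof cases
      case 1
      then show ?thesis using cs[of _ s] by simp
    next
      case 2
      from assms(2)[OF 2] show ?thesis
      proof eventually_elim
        case (elim x)
        show ?case
        proof (intro impI)
          assume *: "cos (s - x - \<beta>) < cos (x - \<beta>)" "s - x \<in> A"
          then have "0 < 2 * sin (\<beta> - s / 2) * sin (x - s / 2)" using cs[of x s] by linarith
          then have "0 < sin (x - s / 2)" by (rule zero_less_mult_pos) (use 2 in simp)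
          with elim * show "x \<in> A" by (cases "x \<in> A") (auto simp: asym_def)
        qed
      qed
    next
      case 3
      \<comment> \<open>The parameter \<open>s + 2 * pi\<close> gives the same reflection with the
        opposite preferred side, which contains \<open>\<beta>\<close>.\<close>
      have sh: "\<beta> - (s + 2 * pi) / 2 = (\<beta> - s / 2) - pi" "x - (s + 2 * pi) / 2 = (x - s / 2) - pi" for x
        by (simp_all add: field_simps)
      have "0 < sin (\<beta> - (s + 2 * pi) / 2)" using 3 unfolding sh sin_diff by simp
      from assms(2)[OF this] show ?thesis
      proof eventually_elim
        case (elim x)
        show ?case
        proof (intro impI)
          assume *: "cos (s - x - \<beta>) < cos (x - \<beta>)" "s - x \<in> A"
          then have "0 < (2 * - sin (\<beta> - s / 2)) * - sin (x - s / 2)" using cs[of x s] by simp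
          then have "0 < - sin (x - s / 2)" by (rule zero_less_mult_pos) (use 3 in simp)
          then have "sin (x - s / 2) < 0" by simp
          then have "0 < sin (x - (s + 2 * pi) / 2)" unfolding sh sin_diff by simp
          moreover have "s + 2 * pi - x \<in> A" using perA(1)[of "s - x"] * by (simp add: algebra_simps)
          ultimately show "x \<in> A" using elim by (cases "x \<in> A") (auto simp: asym_def)
        qed
      qed
    qed
  qed
  then have "AE s in circ. AE x in circ. cos (s - x - \<beta>) < cos (x - \<beta>) \<longrightarrow> s - x \<in> A \<longrightarrow> x \<in> A" by simp
  then have "AE x in circ. AE s in circ. cos (s - x - \<beta>) < cos (x - \<beta>) \<longrightarrow> s - x \<in> A \<longrightarrow> x \<in> A"
    by (rule AE_circ_swap[rotated]) measurable
  \<comment> \<open>The substitution \<open>y = s - x\<close> turns almost every reflection into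
    almost every second point.\<close>
  then have main: "AE x in circ. AE y in circ. cos (y - \<beta>) < cos (x - \<beta>) \<longrightarrow> y \<in> A \<longrightarrow> x \<in> A"
  proof eventually_elim
    case (elim x)
    have "periodic (\<lambda>s. cos (s - x - \<beta>) < cos (x - \<beta>) \<longrightarrow> s - x \<in> A \<longrightarrow> x \<in> A)"
      unfolding periodic_def
    proof
      fix s
      have "s + 2 * pi - x - \<beta> = (s - x - \<beta>) + 2 * pi" "s + 2 * pi - x = (s - x) + 2 * pi" by simp_all
      then show "(cos (s + 2 * pi - x - \<beta>) < cos (x - \<beta>) \<longrightarrow> s + 2 * pi - x \<in> A \<longrightarrow> x \<in> A) =
        (cos (s - x - \<beta>) < cos (x - \<beta>) \<longrightarrow> s - x \<in> A \<longrightarrow> x \<in> A)"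
        by (simp only: cos_periodic perA)
    qed
    from AE_circ_shift[OF elim this, of x] show ?case by simp
  qed
  let ?R = "circ_arc \<beta> (measure circ A)"
  have mR: "measure circ ?R = measure circ A" by (simp add: measure_arc measure_circ_le)
  have eq: "measure circ (A - ?R) = measure circ (?R - A)"
    using measure_Diff_swap[OF Am circ_arc_measurable mR[symmetric]] .
  have "measure circ (A - ?R) = 0"
  proof (rule ccontr)
    assume ne: "measure circ (A - ?R) \<noteq> 0"
    have n1: "\<not> (AE x in circ. \<not> (x \<in> ?R - A))"
    proof
      assume "AE x in circ. \<not> (x \<in> ?R - A)"
      then have "measure circ (?R - A) = measure circ {}"
        by (intro circ.finite_measure_eq_AE) auto
      with ne eq show False by simp
    qed
    have n2: "\<not> (AE x in circ. \<not> (x \<in> A - ?R))"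
    proof
      assume "AE x in circ. \<not> (x \<in> A - ?R)"
      then have "measure circ (A - ?R) = measure circ {}"
        by (intro circ.finite_measure_eq_AE) auto
      with ne show False by simp
    qed
    obtain x where x: "x \<in> ?R - A" "AE y in circ. cos (y - \<beta>) < cos (x - \<beta>) \<longrightarrow> y \<in> A \<longrightarrow> x \<in> A"
      using n1 main by (rule not_AE_D)
    obtain y where y: "y \<in> A - ?R" "cos (y - \<beta>) < cos (x - \<beta>) \<longrightarrow> y \<in> A \<longrightarrow> x \<in> A"
      using n2 x(2) by (rule not_AE_D)
    have "cos (y - \<beta>) < cos (x - \<beta>)" using x(1) y(1) unfolding circ_arc_def by simp
    with x y show False by simp
  qed
  with eq have "emeasure circ (A - ?R) = 0" "emeasure circ (?R - A) = 0"
    by (simp_all add: circ.emeasure_eq_measure)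
  then have null: "A - ?R \<in> null_sets circ" "?R - A \<in> null_sets circ" by (simp_all add: null_sets_def)
  have "AE x in circ. x \<notin> A - ?R" "AE x in circ. x \<notin> ?R - A"
    by (rule AE_not_in[OF null(1)], rule AE_not_in[OF null(2)])
  then show ?thesis by eventually_elim auto
qed

lemma (in circ_kernel) riesz_finite: "riesz G A B < \<infinity>"
proof -
  have "riesz G A B \<le> (\<integral>\<^sup>+x. \<integral>\<^sup>+y. ennreal C \<partial>circ \<partial>circ)"
    unfolding riesz_def
    by (intro nn_integral_mono) (use G_le in \<open>auto simp: indicator_def\<close>)
  also have "\<dots> < \<infinity>" by (simp add: emeasure_circ_UNIV ennreal_mult_less_top)
  finally show ?thesis .
qed

section \<open>Equality for strictly decreasing kernels\<close>

locale strict_circ_kernel = circ_kernel +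
  assumes G_strict: "cos s < cos t \<Longrightarrow> sin s \<noteq> 0 \<Longrightarrow> sin t \<noteq> 0 \<Longrightarrow> G s < G t"
begin

text \<open>A negative product means that each set contains exactly one point of its orbit and that
  these two points lie on opposite sides of the axis. One summand survives, and polarization brings
  the points to the same side, where the kernel is strictly larger.\<close>

lemma fold4_pol_strict:
  assumes gen: "sin (x - s / 2) \<noteq> 0" "sin (y - s / 2) \<noteq> 0" "sin (x - y) \<noteq> 0" "sin ((s - x) - y) \<noteq> 0"
    and neg: "asym A s x * asym B s y < 0"
  shows "fold4 G s A B x y < fold4 G s (pol s A) (pol s B) x y"
proof -
  note cs = cos_diff_cos_reflect[of x y s]
  define u v where "u = sin (x - s / 2)" and "v = sin (y - s / 2)"
  have le1: "G ((s - x) - y) < G (x - y)" if "0 < u * v"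
    using cs that gen by (intro G_strict) (auto simp: u_def v_def)
  have le2: "G (x - y) < G ((s - x) - y)" if "u * v < 0"
    using cs that gen by (intro G_strict) (auto simp: u_def v_def)
  note px = mem_pol[OF gen(1), folded u_def] mem_pol[OF gen(2), folded v_def]
  have uv: "u < 0 \<or> 0 < u" "v < 0 \<or> 0 < v" using gen by (auto simp: u_def v_def)
  note neg' = neg[unfolded asym_def, folded u_def v_def]
  have ab: "(x \<in> A \<and> s - x \<notin> A \<or> x \<notin> A \<and> s - x \<in> A) \<and> (y \<in> B \<and> s - y \<notin> B \<or> y \<notin> B \<and> s - y \<in> B)"
  proof (rule ccontr)
    assume "\<not> ?thesis"
    then have "indicat_real A x - indicat_real A (s - x) = 0 \<or> indicat_real B y - indicat_real B (s - y) = 0"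
      by (auto simp: indicator_def)
    then show False using neg' by auto
  qed
  have neg'': "((indicat_real A x - indicat_real A (s - x)) * (indicat_real B y - indicat_real B (s - y))) * (u * v) < 0"
    using neg' by (simp only: mult.assoc mult.left_commute)
  from uv show ?thesis
  proof (elim disjE)
    assume *: "u < 0" "v < 0"
    note lt = le1[OF mult_neg_neg[OF *]]
    show ?thesis using ab *
      by (elim disjE conjE) (use neg'' mult_neg_neg[OF *] lt in \<open>simp_all add: fold4_def px\<close>)
  next
    assume *: "u < 0" "0 < v"
    note lt = le2[OF mult_neg_pos[OF *]]
    show ?thesis using ab *
      by (elim disjE conjE) (use neg'' mult_neg_pos[OF *] lt in \<open>simp_all add: fold4_def px\<close>)
  next
    assume *: "0 < u" "v < 0"
    note lt = le2[OF mult_pos_neg[OF *]]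
    show ?thesis using ab *
      by (elim disjE conjE) (use neg'' mult_pos_neg[OF *] lt in \<open>simp_all add: fold4_def px\<close>)
  next
    assume *: "0 < u" "0 < v"
    note lt = le1[OF mult_pos_pos[OF *]]
    show ?thesis using ab *
      by (elim disjE conjE) (use neg'' mult_pos_pos[OF *] lt in \<open>simp_all add: fold4_def px\<close>)
  qed
qed

text \<open>Polarization cannot lower the functional, and the rearrangement inequality keeps it from
  rising. Finiteness turns equality of the integrals into equality of the integrands, so a strict
  gain occurs almost nowhere.\<close>

lemma riesz_equality_asym:
  assumes A: "pset A" and B: "pset B"
    and eq: "riesz G A B = riesz G (circ_arc 0 (measure circ A)) (circ_arc 0 (measure circ B))"
  shows "AE x in circ. AE y in circ. 0 \<le> asym A s x * asym B s y"
proof -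
  have pP: "pset (pol s A)" "pset (pol s B)" using A B by (auto intro: pset_pol)
  have "riesz G (pol s A) (pol s B) \<le> riesz G A B"
    using riesz_rearrangement[OF pP] eq A B by (simp add: measure_pol)
  then have le4: "4 * riesz G (pol s A) (pol s B) \<le> 4 * riesz G A B" by (rule mult_left_mono) simp
  have m: "(\<lambda>z. fold4 G s A B (fst z) (snd z)) \<in> borel_measurable (circ \<Otimes>\<^sub>M circ)"
    "(\<lambda>z. fold4 G s (pol s A) (pol s B) (fst z) (snd z)) \<in> borel_measurable (circ \<Otimes>\<^sub>M circ)"
    using fold4_measurable[OF A B, of s] fold4_measurable[OF pP, of s] by (simp_all add: split_beta')
  have pint: "(\<integral>\<^sup>+z. fold4 G s A B (fst z) (snd z) \<partial>(circ \<Otimes>\<^sub>M circ)) = 4 * riesz G A B"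
    "(\<integral>\<^sup>+z. fold4 G s (pol s A) (pol s B) (fst z) (snd z) \<partial>(circ \<Otimes>\<^sub>M circ)) = 4 * riesz G (pol s A) (pol s B)"
    using riesz_fold4[OF A B, of s] riesz_fold4[OF pP, of s] circ.nn_integral_fst[OF m(1)] circ.nn_integral_fst[OF m(2)]
    by simp_all
  have ms: "{z \<in> space (circ \<Otimes>\<^sub>M circ). fold4 G s A B (fst z) (snd z) \<le> fold4 G s (pol s A) (pol s B) (fst z) (snd z)} \<in> sets (circ \<Otimes>\<^sub>M circ)"
    using m by measurable
  have ae: "AE z in circ \<Otimes>\<^sub>M circ. fold4 G s A B (fst z) (snd z) \<le> fold4 G s (pol s A) (pol s B) (fst z) (snd z)"
    by (rule circ_pair.AE_pair_measure[OF ms]) (use AE_fold4_pol[of s A B] in simp)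
  have fin: "(\<integral>\<^sup>+z. fold4 G s A B (fst z) (snd z) \<partial>(circ \<Otimes>\<^sub>M circ)) \<noteq> \<infinity>"
    using riesz_finite[of A B] unfolding pint by (simp add: ennreal_mult_eq_top_iff)
  have "AE z in circ \<Otimes>\<^sub>M circ. fold4 G s (pol s A) (pol s B) (fst z) (snd z) \<le> fold4 G s A B (fst z) (snd z)"
  proof (rule ccontr)
    assume "\<not> ?thesis"
    from nn_integral_less[OF m fin ae this] le4 show False unfolding pint by simp
  qed
  from circ_pair.AE_pair[OF this]
  have "AE x in circ. AE y in circ. fold4 G s (pol s A) (pol s B) x y \<le> fold4 G s A B x y" by simp
  then show ?thesis using AE_generic[of s]
  proof eventually_elim
    case (elim x)
    from elim show ?case
    proof eventually_elim
      case (elim y)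
      then show ?case using fold4_pol_strict[of x s y A B] by (meson not_le)
    qed
  qed
qed

text \<open>The centre is tied to the Fourier coefficients of \<open>A\<close> alone, so that the
  centres found for different partners \<open>B\<close> can be identified later.\<close>

lemma riesz_equality:
  assumes A: "pset A" and B: "pset B"
    and nt: "measure circ A \<notin> {0, 2 * pi}" "measure circ B \<notin> {0, 2 * pi}"
    and eq: "riesz G A B = riesz G (circ_arc 0 (measure circ A)) (circ_arc 0 (measure circ B))"
  shows "\<exists>r \<beta>. 0 < r \<and> circ_cos A = r * cos \<beta> \<and> circ_sin A = r * sin \<beta> \<and>
     (AE x in circ. x \<in> A \<longleftrightarrow> x \<in> circ_arc \<beta> (measure circ A)) \<and>
     (AE x in circ. x \<in> B \<longleftrightarrow> x \<in> circ_arc \<beta> (measure circ B))"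
proof -
  define u where "u A s = circ_sin A * cos (s / 2) - circ_cos A * sin (s / 2)" for A s
  have u: "(LINT x|circ. asym A s x) = 2 * u A s" "(LINT x|circ. asym B s x) = 2 * u B s" for s
    using integral_asym[OF A] integral_asym[OF B] by (simp_all add: u_def)
  have zero: "AE x in circ. asym X s x = 0" if "pset X" "u X s = 0"
    "(AE x in circ. 0 \<le> asym X s x) \<or> (AE x in circ. asym X s x \<le> 0)" for X s
  proof -
    have 0: "(LINT x|circ. asym X s x) = 0" using that(2) integral_asym[OF that(1)] by (simp add: u_def)
    from that(3) show ?thesis
    proof
      assume "AE x in circ. 0 \<le> asym X s x"
      from integral_nonneg_eq_0_iff_AE[OF asym_integrable[OF that(1)] this] 0 show ?thesis by simp
    next
      assume "AE x in circ. asym X s x \<le> 0"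
      then have "AE x in circ. 0 \<le> - asym X s x" by simp
      from integral_nonneg_eq_0_iff_AE[OF _ this] asym_integrable[OF that(1), of s] 0
      show ?thesis by simp
    qed
  qed
  note sgn = AE_product_sign[OF riesz_equality_asym[OF A B eq]]
  \<comment> \<open>If the coefficients of \<open>A\<close> vanished, every \<open>asym A s\<close>
    would have integral 0, and the sign alternatives would make each reflection a symmetry of
    \<open>A\<close> or of \<open>B\<close>.\<close>
  have nzA: "circ_cos A \<noteq> 0 \<or> circ_sin A \<noteq> 0"
  proof (rule ccontr)
    assume "\<not> ?thesis"
    then have "u A s = 0" for s by (simp add: u_def)
    then have "reflection_sym A s \<or> reflection_sym B s" for s
      using sgn[of s] zero[OF A, of s] asym_zero_imp_sym by blast
    with reflection_cover_trivial[OF A B] nt show False by blast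
  qed
  have nzB: "circ_cos B \<noteq> 0 \<or> circ_sin B \<noteq> 0"
  proof (rule ccontr)
    assume "\<not> ?thesis"
    then have "u B s = 0" for s by (simp add: u_def)
    then have "reflection_sym A s \<or> reflection_sym B s" for s
      using sgn[of s] zero[OF B, of s] asym_zero_imp_sym by blast
    with reflection_cover_trivial[OF A B] nt show False by blast
  qed
  obtain r \<beta> where r: "0 < r" "circ_cos A = r * cos \<beta>" "circ_sin A = r * sin \<beta>"
    using polar_form[OF nzA] .
  obtain r' \<beta>' where r': "0 < r'" "circ_cos B = r' * cos \<beta>'" "circ_sin B = r' * sin \<beta>'"
    using polar_form[OF nzB] .
  have uA: "u A s = r * sin (\<beta> - s / 2)" for s by (simp add: u_def r sin_diff algebra_simps)
  have uB: "u B s = r' * sin (\<beta>' - s / 2)" for s by (simp add: u_def r' sin_diff algebra_simps)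
  have signA: "0 \<le> u X s" if "pset X" "AE x in circ. 0 \<le> asym X s x" for X s
    using integral_nonneg_AE[OF that(2)] integral_asym[OF that(1)] by (simp add: u_def)
  have signA': "u X s \<le> 0" if "pset X" "AE x in circ. asym X s x \<le> 0" for X s
    using integral_nonneg_AE[where M=circ and f="\<lambda>x. - asym X s x"] that integral_asym[OF that(1)] by (simp add: u_def)
  have sign0: "u X s = 0" if "pset X" "AE x in circ. asym X s x = 0" for X s
  proof -
    have "AE x in circ. 0 \<le> asym X s x" "AE x in circ. asym X s x \<le> 0"
      using that(2) by (eventually_elim, simp)+
    then show ?thesis using signA[OF that(1)] signA'[OF that(1)] by (simp add: antisym)
  qed
  have uu: "0 \<le> u A s * u B s" for s
    using sgn[of s]
  proof (elim disjE conjE)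
    assume "AE x in circ. 0 \<le> asym A s x" "AE y in circ. 0 \<le> asym B s y"
    then show ?thesis using signA[OF A] signA[OF B] by (intro mult_nonneg_nonneg) blast+
  next
    assume "AE x in circ. asym A s x \<le> 0" "AE y in circ. asym B s y \<le> 0"
    then show ?thesis using signA'[OF A] signA'[OF B] by (intro mult_nonpos_nonpos) blast+
  next
    assume "AE x in circ. asym A s x = 0"
    from sign0[OF A this] show ?thesis by simp
  next
    assume "AE x in circ. asym B s x = 0"
    from sign0[OF B this] show ?thesis by simp
  qed
  have "1 \<le> cos (\<beta> - \<beta>')"
  proof -
    \<comment> \<open>For \<open>s = \<beta> + \<beta>'\<close> the axis bisects the two directions:
      the sines are opposite, their product is minus a square, and agreement of signs forces it to
      vanish.\<close>
    have "0 \<le> (r * r') * (sin (\<beta> - (\<beta> + \<beta>') / 2) * sin (\<beta>' - (\<beta> + \<beta>') / 2))"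
      using uu[of "\<beta> + \<beta>'"] unfolding uA uB by (simp add: algebra_simps)
    then have *: "0 \<le> sin (\<beta> - (\<beta> + \<beta>') / 2) * sin (\<beta>' - (\<beta> + \<beta>') / 2)"
      using r(1) r'(1) by (meson mult_pos_neg mult_pos_pos not_le)
    have h: "\<beta> - (\<beta> + \<beta>') / 2 = (\<beta> - \<beta>') / 2" "\<beta>' - (\<beta> + \<beta>') / 2 = - ((\<beta> - \<beta>') / 2)"
      by (simp_all add: field_simps)
    have "(sin ((\<beta> - \<beta>') / 2))\<^sup>2 \<le> 0" using * unfolding h sin_minus by (simp add: power2_eq_square)
    moreover have "cos (\<beta> - \<beta>') = 1 - 2 * (sin ((\<beta> - \<beta>') / 2))\<^sup>2"
      using cos_double_sin[of "(\<beta> - \<beta>') / 2"] unfolding times_divide_eq_right nonzero_mult_div_cancel_left[OF zero_neq_numeral[symmetric]] .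
    ultimately show ?thesis by simp
  qed
  then have c1: "cos (\<beta> - \<beta>') = 1" using cos_le_one[of "\<beta> - \<beta>'"] by linarith
  then have s0: "sin (\<beta> - \<beta>') = 0" using sin_cos_squared_add[of "\<beta> - \<beta>'"] by simp
  have same: "sin (\<beta> - t) = sin (\<beta>' - t)" for t
  proof -
    have "sin (\<beta> - t) = sin ((\<beta> - \<beta>') + (\<beta>' - t))" by simp
    also have "\<dots> = sin (\<beta>' - t)" unfolding sin_add c1 s0 by simp
    finally show ?thesis .
  qed
  have "(AE x in circ. 0 \<le> asym A s x) \<and> (AE y in circ. 0 \<le> asym B s y)" if "0 < sin (\<beta> - s / 2)" for s
  proof -
    have "0 < u A s" "0 < u B s" using that r(1) r'(1) same[of "s / 2"] by (auto simp: uA uB)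
    then have "\<not> (AE x in circ. asym A s x \<le> 0)" "\<not> (AE x in circ. asym A s x = 0)"
      "\<not> (AE x in circ. asym B s x = 0)"
      using signA'[OF A, of s] sign0[OF A, of s] sign0[OF B, of s] by linarith+
    then show ?thesis using sgn[of s] by blast
  qed
  then show ?thesis using arc_from_asym[OF A, of \<beta>] arc_from_asym[OF B, of \<beta>] r by blast
qed

end

section \<open>The periodised Gaussian\<close>

text \<open>The sum of \<open>exp (- l * (t + 2 * pi * k)\<^sup>2)\<close> over all integers \<open>k\<close>, grouping \<open>k = n\<close> with \<open>k = - n - 1\<close>.\<close>

definition theta_term :: "real \<Rightarrow> real \<Rightarrow> nat \<Rightarrow> real" where
  "theta_term l t n = exp (- l * (t + 2 * pi * real n)\<^sup>2) + exp (- l * (2 * pi * (real n + 1) - t)\<^sup>2)"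

definition theta :: "real \<Rightarrow> real \<Rightarrow> real" where
  "theta l t = (\<Sum>n. theta_term l t n)"

lemma theta_term_nonneg: "0 \<le> theta_term l t n"
  by (simp add: theta_term_def)

lemma nat_le_two_pi_sq: "real n \<le> (2 * pi * real n)\<^sup>2 / 2"
proof -
  have "1 * real n \<le> (2 * pi\<^sup>2) * (real n * real n)"
  proof (cases n)
    case (Suc m)
    have "1 \<le> pi" using pi_gt3 by linarith
    then have "1 \<le> pi\<^sup>2" by (simp add: one_le_power)
    moreover have "real n \<le> real n * real n" using Suc by simp
    ultimately show ?thesis by (intro mult_mono) auto
  qed simp
  then show ?thesis by (simp add: power2_eq_square algebra_simps)
qed

text \<open>\<open>(c + 2 * u)\<^sup>2 \<ge> 0\<close> gives
  \<open>c\<^sup>2 / 2 - u\<^sup>2 \<le> (c + u)\<^sup>2\<close>, and half of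
  \<open>(2 * pi * n)\<^sup>2\<close> is at least \<open>n\<close>. The geometric majorant is
  uniform for bounded \<open>t\<close>, as the Weierstrass test requires.\<close>

lemma theta_term_bound:
  assumes "0 < l" "\<bar>t\<bar> \<le> R"
  shows "theta_term l t n \<le> 2 * exp (l * R\<^sup>2) * exp (- l) ^ n"
proof -
  have shift: "c\<^sup>2 / 2 - R\<^sup>2 \<le> (c + u)\<^sup>2" if "\<bar>u\<bar> \<le> R" for c u :: real
  proof -
    have "u\<^sup>2 \<le> R\<^sup>2" using that by (metis abs_ge_zero power2_abs power_mono)
    moreover have "c\<^sup>2 / 2 - u\<^sup>2 \<le> (c + u)\<^sup>2"
      using zero_le_power2[of "c + 2 * u"] by (simp add: power2_eq_square algebra_simps)
    ultimately show ?thesis by linarith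
  qed
  have "real n \<le> real (Suc n)" by simp
  have 1: "real n - R\<^sup>2 \<le> (t + 2 * pi * real n)\<^sup>2"
    using shift[of t "2 * pi * real n"] assms(2) nat_le_two_pi_sq[of n] by (simp add: add.commute)
  have 2: "real n - R\<^sup>2 \<le> (2 * pi * (real n + 1) - t)\<^sup>2"
    using shift[of "- t" "2 * pi * (real n + 1)"] assms(2) nat_le_two_pi_sq[of "Suc n"]
    by (simp add: add.commute)
  have e: "exp (l * R\<^sup>2) * exp (- l) ^ n = exp (- l * (real n - R\<^sup>2))"
    by (simp add: exp_of_nat_mult[symmetric] exp_add[symmetric] algebra_simps)
  have "exp (- l * (t + 2 * pi * real n)\<^sup>2) \<le> exp (- l * (real n - R\<^sup>2))"
    "exp (- l * (2 * pi * (real n + 1) - t)\<^sup>2) \<le> exp (- l * (real n - R\<^sup>2))"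
    using 1 2 assms(1) by (simp_all add: mult_left_mono)
  then show ?thesis unfolding theta_term_def using e by linarith
qed

lemma summable_exp_pow: "0 < l \<Longrightarrow> summable (\<lambda>n. c * exp (- l :: real) ^ n)"
  by (intro summable_mult summable_geometric) simp

lemma summable_theta_term: "0 < l \<Longrightarrow> summable (theta_term l t)"
  by (rule summable_comparison_test'[OF summable_exp_pow[where c="2 * exp (l * \<bar>t\<bar>\<^sup>2)"]])
    (use theta_term_bound[of l t "\<bar>t\<bar>"] theta_term_nonneg in auto)

lemma theta_nonneg: "0 < l \<Longrightarrow> 0 \<le> theta l t"
  unfolding theta_def by (intro suminf_nonneg summable_theta_term theta_term_nonneg)

lemma theta_ennreal:
  assumes "0 < l"
  shows "(\<integral>\<^sup>+k. ennreal (exp (- l * (t + 2 * pi * of_int k)\<^sup>2)) \<partial>count_space (UNIV :: int set)) = ennreal (theta l t)"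
proof -
  have sq: "(t + 2 * pi * of_int (- int n - 1))\<^sup>2 = (2 * pi * (real n + 1) - t)\<^sup>2" for n
    by (simp add: power2_eq_square algebra_simps)
  have "(\<integral>\<^sup>+k. ennreal (exp (- l * (t + 2 * pi * of_int k)\<^sup>2)) \<partial>count_space (UNIV :: int set))
     = (\<Sum>n. ennreal (theta_term l t n))"
    unfolding nn_integral_int_pairs sq theta_term_def by (simp add: ennreal_plus)
  also have "\<dots> = ennreal (theta l t)"
    unfolding theta_def by (rule suminf_ennreal2[OF theta_term_nonneg summable_theta_term[OF assms]])
  finally show ?thesis .
qed

lemma theta_continuous: 
  assumes "0 < l" shows "continuous_on UNIV (theta l)"
proof -
  have on: "continuous_on {- R..R} (theta l)" for R
  proof -
    have "uniform_limit {- R..R} (\<lambda>n t. \<Sum>i<n. theta_term l t i) (\<lambda>t. \<Sum>i. theta_term l t i) sequentially"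
    proof (rule Weierstrass_m_test)
      show "summable (\<lambda>n. 2 * exp (l * R\<^sup>2) * exp (- l) ^ n)" by (rule summable_exp_pow[OF assms])
      show "norm (theta_term l t n) \<le> 2 * exp (l * R\<^sup>2) * exp (- l) ^ n" if "t \<in> {- R..R}" for n t
        using theta_term_bound[OF assms, of t R n] theta_term_nonneg[of l t n] that by auto
    qed
    then have "continuous_on {- R..R} (\<lambda>t. \<Sum>i. theta_term l t i)"
      by (rule uniform_limit_theorem[rotated]) (auto simp: theta_term_def intro!: continuous_intros always_eventually)
    then show ?thesis unfolding theta_def[abs_def] .
  qed
  have "isCont (theta l) t" for t
  proof -
    have "continuous_on {- (\<bar>t\<bar> + 1)<..<\<bar>t\<bar> + 1} (theta l)"
      by (rule continuous_on_subset[OF on[of "\<bar>t\<bar> + 1"]]) auto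
    then show ?thesis by (rule continuous_on_interior) (auto simp: interior_open)
  qed
  then show ?thesis by (simp add: continuous_on_eq_continuous_within continuous_at_imp_continuous_at_within)
qed

lemma theta_measurable [measurable]: "0 < l \<Longrightarrow> theta l \<in> borel_measurable borel"
  by (intro borel_measurable_continuous_onI theta_continuous)

lemma theta_periodic:
  assumes "0 < l" shows "periodic (theta l)"
  unfolding periodic_def
proof
  fix t
  have "ennreal (theta l (t + 2 * pi)) = ennreal (theta l t)"
    unfolding theta_ennreal[OF assms, symmetric]
    using nn_integral_int_shift[of "\<lambda>k. ennreal (exp (- l * (t + 2 * pi * of_int k)\<^sup>2))" 1]
    by (simp add: algebra_simps)
  then show "theta l (t + 2 * pi) = theta l t" using theta_nonneg[OF assms] by simp
qed

lemma theta_even: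
  assumes "0 < l" shows "theta l (- t) = theta l t"
proof -
  have "ennreal (theta l (- t)) = ennreal (theta l t)"
    unfolding theta_ennreal[OF assms, symmetric]
    by (subst nn_integral_int_uminus[symmetric]) (simp add: power2_eq_square algebra_simps)
  then show ?thesis using theta_nonneg[OF assms] by simp
qed

lemma theta_minus_commute: "0 < l \<Longrightarrow> theta l (x - y) = theta l (y - x)"
  using theta_even[of l "x - y"] by simp

lemma theta_fold: 
  assumes "0 < l" shows "theta l x = theta l \<bar>wrap x\<bar>"
  using periodic_wrap_eq[OF theta_periodic[OF assms], of x] theta_even[OF assms, of "wrap x"]
  by (cases "0 \<le> wrap x") auto

lemma cos_fold: "cos x = cos \<bar>wrap x\<bar>"
  using periodic_wrap_eq[OF periodic_cos, of x] by simp

lemma fold_bounds: "0 \<le> \<bar>wrap x\<bar>" "\<bar>wrap x\<bar> \<le> pi"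
  using wrap_bounds[of x] by auto

lemma theta_lower: 
  assumes "0 < l" shows "exp (- l * t\<^sup>2) \<le> theta l t"
proof -
  have "exp (- l * t\<^sup>2) \<le> (\<Sum>n<1. theta_term l t n)" by (simp add: theta_term_def)
  also have "\<dots> \<le> theta l t" unfolding theta_def
    by (rule sum_le_suminf[OF summable_theta_term[OF assms]]) (auto simp: theta_term_nonneg)
  finally show ?thesis .
qed

text \<open>On the half period all exponents are at least \<open>t\<^sup>2 + n\<close>, so the
  factor \<open>exp (- l * t\<^sup>2)\<close> survives, unlike in
  \<open>theta_term_bound\<close>.\<close>

lemma theta_term_bound':
  assumes l: "0 < l" and t: "0 \<le> t" "t \<le> pi"
  shows "theta_term l t n \<le> 2 * exp (- l * t\<^sup>2) * exp (- l) ^ n"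
proof -
  have "real n \<le> (2 * pi * real n)\<^sup>2" using nat_le_two_pi_sq[of n] zero_le_power2[of "2 * pi * real n"] by linarith
  moreover have "(2 * pi * real n)\<^sup>2 + t\<^sup>2 \<le> (t + 2 * pi * real n)\<^sup>2" using t by (simp add: power2_sum)
  ultimately have 1: "t\<^sup>2 + real n \<le> (t + 2 * pi * real n)\<^sup>2" by linarith
  have "(t + 2 * pi * real n)\<^sup>2 \<le> (2 * pi * (real n + 1) - t)\<^sup>2"
    using t by (intro power_mono) (auto simp: algebra_simps)
  then have 2: "t\<^sup>2 + real n \<le> (2 * pi * (real n + 1) - t)\<^sup>2" using 1 by linarith
  have e: "exp (- l * t\<^sup>2) * exp (- l) ^ n = exp (- l * (t\<^sup>2 + real n))"
    by (simp add: exp_of_nat_mult[symmetric] exp_add[symmetric] algebra_simps)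
  have "exp (- l * (t + 2 * pi * real n)\<^sup>2) \<le> exp (- l * (t\<^sup>2 + real n))"
    "exp (- l * (2 * pi * (real n + 1) - t)\<^sup>2) \<le> exp (- l * (t\<^sup>2 + real n))"
    using 1 2 l by (simp_all add: mult_left_mono)
  then show ?thesis unfolding theta_term_def using e by linarith
qed

lemma exp_ge1_le_half: "1 \<le> l \<Longrightarrow> exp (- l :: real) \<le> 1 / 2"
proof -
  assume "1 \<le> l"
  then have "2 \<le> exp l" using exp_ge_add_one_self[of l] by linarith
  then show ?thesis by (simp add: exp_minus field_simps)
qed

text \<open>For \<open>l \<ge> 1\<close> the geometric series is at most 2, whence 4. The
  multiplicative error serves to detect strict decrease for large \<open>l\<close>.\<close>

lemma theta_upper:
  assumes l: "1 \<le> l" and t: "0 \<le> t" "t \<le> pi"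
  shows "theta l t \<le> 4 * exp (- l * t\<^sup>2)"
proof -
  have l0: "0 < l" using l by simp
  have e: "exp (- l) < 1" using l0 by simp
  have "theta l t \<le> (\<Sum>n. 2 * exp (- l * t\<^sup>2) * exp (- l) ^ n)" unfolding theta_def
    by (intro suminf_le theta_term_bound'[OF l0 t] summable_theta_term summable_exp_pow l0)
  also have "\<dots> = 2 * exp (- l * t\<^sup>2) * (1 / (1 - exp (- l)))"
    using e by (subst suminf_mult) (auto simp: suminf_geometric intro!: summable_geometric)
  also have "\<dots> \<le> 2 * exp (- l * t\<^sup>2) * 2"
    using exp_ge1_le_half[OF l] e by (intro mult_left_mono) (auto simp: field_simps)
  finally show ?thesis by simp
qed

text \<open>Here the error is additive and independent of \<open>t\<close>: one
  \<open>exp (- l)\<close> from the mirror term of the first pair, four from the tail.\<close>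

lemma theta_upper':
  assumes l: "1 \<le> l" and t: "0 \<le> t" "t \<le> pi"
  shows "theta l t \<le> exp (- l * t\<^sup>2) + 5 * exp (- l)"
proof -
  have l0: "0 < l" using l by simp
  have e: "exp (- l) < 1" using l0 by simp
  have "theta l t = theta_term l t 0 + (\<Sum>n. theta_term l t (Suc n))"
    unfolding theta_def by (subst suminf_split_head[OF summable_theta_term[OF l0]]) simp
  also have "theta_term l t 0 \<le> exp (- l * t\<^sup>2) + exp (- l)"
  proof -
    have "1 \<le> (2 * pi - t)" using t pi_gt3 by linarith
    then have "1 \<le> (2 * pi - t)\<^sup>2" by (simp add: one_le_power)
    then show ?thesis using l0 by (simp add: theta_term_def)
  qed
  also have "(\<Sum>n. theta_term l t (Suc n)) \<le> (\<Sum>n. 2 * exp (- l) * exp (- l) ^ n)"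
  proof (rule suminf_le)
    show "theta_term l t (Suc n) \<le> 2 * exp (- l) * exp (- l) ^ n" for n
    proof -
      have "theta_term l t (Suc n) \<le> 2 * exp (- l * t\<^sup>2) * exp (- l) ^ Suc n" by (rule theta_term_bound'[OF l0 t])
      also have "\<dots> \<le> 2 * 1 * exp (- l) ^ Suc n" using l0 by (intro mult_right_mono mult_left_mono) auto
      finally show ?thesis by simp
    qed
    show "summable (\<lambda>n. theta_term l t (Suc n))" using summable_theta_term[OF l0] by (simp add: summable_Suc_iff)
    show "summable (\<lambda>n. 2 * exp (- l) * exp (- l) ^ n)" by (rule summable_exp_pow[OF l0])
  qed
  also have "(\<Sum>n. 2 * exp (- l) * exp (- l) ^ n) = 2 * exp (- l) * (1 / (1 - exp (- l)))"
    using e by (subst suminf_mult) (auto simp: suminf_geometric intro!: summable_geometric)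
  also have "\<dots> \<le> 2 * exp (- l) * 2"
    using exp_ge1_le_half[OF l] e by (intro mult_left_mono) (auto simp: field_simps)
  finally show ?thesis by simp
qed

section \<open>The convolution semigroup of periodised Gaussians\<close>

lemma nn_integral_gaussian:
  assumes l: "0 < l"
  shows "(\<integral>\<^sup>+x. ennreal (exp (- l * (x - c)\<^sup>2)) \<partial>lborel) = ennreal (sqrt (pi / l))"
proof -
  define \<sigma> where "\<sigma> = 1 / sqrt (2 * l)"
  have s: "0 < \<sigma>" "\<sigma>\<^sup>2 = 1 / (2 * l)" using l by (simp_all add: \<sigma>_def power_divide)
  have d: "exp (- l * (x - c)\<^sup>2) = sqrt (pi / l) * normal_density c \<sigma> x" for x
    unfolding normal_density_def s(2) using l by (simp add: real_sqrt_divide real_sqrt_mult field_simps)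
  have 1: "(\<integral>\<^sup>+x. ennreal (normal_density c \<sigma> x) \<partial>lborel) = 1"
    using s(1) by (subst nn_integral_eq_integral) auto
  have "(\<integral>\<^sup>+x. ennreal (exp (- l * (x - c)\<^sup>2)) \<partial>lborel) =
     (\<integral>\<^sup>+x. ennreal (sqrt (pi / l)) * ennreal (normal_density c \<sigma> x) \<partial>lborel)"
    unfolding d using l by (intro nn_integral_cong) (simp add: ennreal_mult)
  also have "\<dots> = ennreal (sqrt (pi / l))"
    by (subst nn_integral_cmult) (auto simp: 1)
  finally show ?thesis .
qed

lemma nn_integral_theta: 
  assumes "0 < l" shows "(\<integral>\<^sup>+x. ennreal (theta l x) \<partial>circ) = ennreal (sqrt (pi / l))"
  using nn_integral_lborel_unfold[of "\<lambda>x. ennreal (exp (- l * x\<^sup>2))"] nn_integral_gaussian[OF assms, of 0]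
  by (simp add: theta_ennreal[OF assms, symmetric])

text \<open>Completing the square, \<open>(a - y)\<^sup>2 + y\<^sup>2 = 2 * (y - a / 2)\<^sup>2 +
  a\<^sup>2 / 2\<close>, so self-convolution on the line halves \<open>l\<close>. Unfolding one of
  the two factors transfers this to the circle.\<close>

lemma nn_integral_theta_conv:
  assumes l: "0 < l"
  shows "(\<integral>\<^sup>+y. ennreal (theta l (t - y) * theta l y) \<partial>circ) = ennreal (sqrt (pi / (2 * l)) * theta (l / 2) t)"
proof -
  have [measurable]: "theta l \<in> borel_measurable borel" by (rule theta_measurable[OF l])
  have gauss: "(\<integral>\<^sup>+y. ennreal (exp (- l * (t + 2 * pi * of_int k - y)\<^sup>2)) * ennreal (exp (- l * y\<^sup>2)) \<partial>lborel)
     = ennreal (sqrt (pi / (2 * l))) * ennreal (exp (- (l / 2) * (t + 2 * pi * of_int k)\<^sup>2))" for k :: int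
  proof -
    let ?a = "t + 2 * pi * of_int k"
    have "exp (- l * (?a - y)\<^sup>2) * exp (- l * y\<^sup>2) = exp (- (2 * l) * (y - ?a / 2)\<^sup>2) * exp (- (l / 2) * ?a\<^sup>2)" for y
      unfolding exp_add[symmetric] by (simp add: power2_eq_square field_simps)
    then have "(\<integral>\<^sup>+y. ennreal (exp (- l * (?a - y)\<^sup>2)) * ennreal (exp (- l * y\<^sup>2)) \<partial>lborel) =
       (\<integral>\<^sup>+y. ennreal (exp (- (2 * l) * (y - ?a / 2)\<^sup>2)) * ennreal (exp (- (l / 2) * ?a\<^sup>2)) \<partial>lborel)"
      by (simp only: ennreal_mult[symmetric] exp_ge_zero)
    also have "\<dots> = (\<integral>\<^sup>+y. ennreal (exp (- (2 * l) * (y - ?a / 2)\<^sup>2)) \<partial>lborel) * ennreal (exp (- (l / 2) * ?a\<^sup>2))"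
      by (rule nn_integral_multc) measurable
    also have "\<dots> = ennreal (sqrt (pi / (2 * l))) * ennreal (exp (- (l / 2) * ?a\<^sup>2))"
      using l by (subst nn_integral_gaussian) auto
    finally show ?thesis .
  qed
  have "(\<integral>\<^sup>+y. ennreal (theta l (t - y) * theta l y) \<partial>circ) =
     (\<integral>\<^sup>+y. \<integral>\<^sup>+k. ennreal (theta l (t - (y + 2 * pi * of_int k))) * ennreal (exp (- l * (y + 2 * pi * of_int k)\<^sup>2)) \<partial>count_space (UNIV :: int set) \<partial>circ)"
  proof (rule nn_integral_cong)
    fix y
    have "theta l (t - (y + 2 * pi * of_int k)) = theta l (t - y)" for k
      using periodic_int'[OF theta_periodic[OF l], of "t - y" k] by (simp add: diff_diff_eq)
    then show "ennreal (theta l (t - y) * theta l y) = (\<integral>\<^sup>+k. ennreal (theta l (t - (y + 2 * pi * of_int k))) * ennreal (exp (- l * (y + 2 * pi * of_int k)\<^sup>2)) \<partial>count_space (UNIV :: int set))"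
      by (simp only: nn_integral_cmult[OF borel_measurable_count_space] theta_ennreal[OF l] ennreal_mult[OF theta_nonneg[OF l] theta_nonneg[OF l]])
  qed
  also have "\<dots> = (\<integral>\<^sup>+y. ennreal (theta l (t - y)) * ennreal (exp (- l * y\<^sup>2)) \<partial>lborel)"
    by (rule nn_integral_lborel_unfold[symmetric]) measurable
  also have "\<dots> = (\<integral>\<^sup>+y. \<integral>\<^sup>+k. ennreal (exp (- l * (t - y + 2 * pi * of_int k)\<^sup>2)) * ennreal (exp (- l * y\<^sup>2)) \<partial>count_space (UNIV :: int set) \<partial>lborel)"
    by (intro nn_integral_cong) (simp only: nn_integral_multc[OF borel_measurable_count_space] theta_ennreal[OF l])
  also have "\<dots> = (\<integral>\<^sup>+k. \<integral>\<^sup>+y. ennreal (exp (- l * (t - y + 2 * pi * of_int k)\<^sup>2)) * ennreal (exp (- l * y\<^sup>2)) \<partial>lborel \<partial>count_space (UNIV :: int set))"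
    by (rule nn_integral_count_space_nn_integral) auto
  also have "\<dots> = (\<integral>\<^sup>+k. ennreal (sqrt (pi / (2 * l))) * ennreal (exp (- (l / 2) * (t + 2 * pi * of_int k)\<^sup>2)) \<partial>count_space (UNIV :: int set))"
  proof (rule nn_integral_cong)
    fix k :: int
    have "t - y + 2 * pi * of_int k = t + 2 * pi * of_int k - y" for y by simp
    then show "(\<integral>\<^sup>+y. ennreal (exp (- l * (t - y + 2 * pi * of_int k)\<^sup>2)) * ennreal (exp (- l * y\<^sup>2)) \<partial>lborel) =
      ennreal (sqrt (pi / (2 * l))) * ennreal (exp (- (l / 2) * (t + 2 * pi * of_int k)\<^sup>2))"
      using gauss[of k] by (simp only:)
  qed
  also have "\<dots> = ennreal (sqrt (pi / (2 * l))) * ennreal (theta (l / 2) t)"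
    using l by (simp only: nn_integral_cmult[OF borel_measurable_count_space] theta_ennreal[of "l / 2"] half_gt_zero)
  also have "\<dots> = ennreal (sqrt (pi / (2 * l)) * theta (l / 2) t)"
    using l theta_nonneg[of "l / 2" t] by (simp add: ennreal_mult)
  finally show ?thesis .
qed

lemma theta_bounded:
  assumes "0 < l" obtains B where "\<And>x. \<bar>theta l x\<bar> \<le> B"
proof -
  have "compact (theta l ` {0..pi})"
    by (intro compact_continuous_image continuous_on_subset[OF theta_continuous[OF assms]]) auto
  then obtain B where B: "\<And>y. y \<in> theta l ` {0..pi} \<Longrightarrow> norm y \<le> B"
    using compact_imp_bounded bounded_iff by metis
  have "\<bar>theta l x\<bar> \<le> B" for x
    using B[of "theta l \<bar>wrap x\<bar>"] fold_bounds[of x] theta_fold[OF assms, of x] by auto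
  then show ?thesis by (rule that)
qed

lemma integral_theta:
  assumes "0 < l" shows "(LINT x|circ. theta l (x - c)) = sqrt (pi / l)"
proof -
  have "(\<integral>\<^sup>+x. ennreal (theta l (x + (- c))) \<partial>circ) = (\<integral>\<^sup>+x. ennreal (theta l x) \<partial>circ)"
    by (rule nn_integral_circ_shift[where f="\<lambda>x. ennreal (theta l x)"])
      (use assms in \<open>auto intro!: periodic_comp[OF theta_periodic, of l ennreal]\<close>)
  then show ?thesis using assms theta_nonneg[OF assms]
    by (subst integral_eq_nn_integral) (auto simp: nn_integral_theta)
qed

lemma integral_theta_conv:
  assumes "0 < l"
  shows "(LINT y|circ. theta l (y - t) * theta l y) = sqrt (pi / (2 * l)) * theta (l / 2) t"
  using assms nn_integral_theta_conv[OF assms, of t] theta_nonneg[OF assms] theta_nonneg[of "l / 2" t]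
  by (subst integral_eq_nn_integral) (auto simp: theta_minus_commute[of l _ t])

text \<open>Reflecting the convolution integral in \<open>y \<mapsto> t\<^sub>1 + t\<^sub>2 - y\<close> turns a difference of its values into
  the integral of a product of two differences, which have the same sign for a kernel decreasing
  with the distance to \<open>0\<close>.\<close>

lemma theta_conv_diff:
  assumes l: "0 < l"
  shows "2 * sqrt (pi / (2 * l)) * (theta (l / 2) t1 - theta (l / 2) t2) =
    (LINT y|circ. (theta l (y - t1) - theta l (y - t2)) * (theta l y - theta l (t1 + t2 - y)))"
proof -
  let ?s = "t1 + t2"
  have [measurable]: "theta l \<in> borel_measurable borel" by (rule theta_measurable[OF l])
  obtain B where B: "\<And>x. \<bar>theta l x\<bar> \<le> B" using theta_bounded[OF l] by blast
  have B0: "0 \<le> B" using B[of 0] by linarith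
  have int: "integrable circ (\<lambda>y. theta l (f y) * theta l (g y))"
    if [measurable]: "f \<in> borel_measurable borel" "g \<in> borel_measurable borel" for f g
  proof (rule circ_integrable_bounded[where B="B * B"])
    show "\<bar>theta l (f x) * theta l (g x)\<bar> \<le> B * B" for x
      unfolding abs_mult by (intro mult_mono B B0) auto
  qed measurable
  have mirror: "(LINT y|circ. theta l (y - t) * theta l (?s - y)) = (LINT y|circ. theta l (y - (?s - t)) * theta l y)" for t
  proof -
    have "periodic (\<lambda>y. theta l (y - t) * theta l (?s - y))"
      by (rule periodic_comp2[OF periodic_shift_minus[OF theta_periodic[OF l]] periodic_cong_reflect[OF theta_periodic[OF l]]])
    from integral_circ_reflect[OF _ this, of ?s]
    have "(LINT y|circ. theta l (y - t) * theta l (?s - y)) = (LINT y|circ. theta l (?s - y - t) * theta l (?s - (?s - y)))"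
      by simp
    also have "\<dots> = (LINT y|circ. theta l (y - (?s - t)) * theta l y)"
      using theta_minus_commute[OF l, of "?s - t"] by (simp add: algebra_simps)
    finally show ?thesis .
  qed
  have "(LINT y|circ. (theta l (y - t1) - theta l (y - t2)) * (theta l y - theta l (?s - y)))
    = (LINT y|circ. (theta l (y - t1) * theta l y - theta l (y - t2) * theta l y) -
        (theta l (y - t1) * theta l (?s - y) - theta l (y - t2) * theta l (?s - y)))"
    by (simp add: algebra_simps)
  also have "\<dots> = ((LINT y|circ. theta l (y - t1) * theta l y) - (LINT y|circ. theta l (y - t2) * theta l y)) -
     ((LINT y|circ. theta l (y - t1) * theta l (?s - y)) - (LINT y|circ. theta l (y - t2) * theta l (?s - y)))"
    by (subst Bochner_Integration.integral_diff;
        (intro Bochner_Integration.integrable_diff int; measurable)?)+ (rule refl)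
  also have "\<dots> = 2 * sqrt (pi / (2 * l)) * (theta (l / 2) t1 - theta (l / 2) t2)"
    unfolding mirror by (simp add: integral_theta_conv[OF l]) (simp add: algebra_simps)
  finally show ?thesis by simp
qed

text \<open>The product is \<open>- 4 * (sin a)\<^sup>2 * sin b * sin c\<close>, while
  \<open>cos t1 - cos t2 = - 2 * sin b * sin c\<close>. Thus the two differences in
  \<open>theta_conv_diff\<close> compare distances to 0 in the same order.\<close>

lemma conv_sign:
  assumes "cos t2 \<le> cos t1"
  shows "0 \<le> (cos (y - t1) - cos (y - t2)) * (cos y - cos (t1 + t2 - y :: real))"
proof -
  define a b c where "a = y - (t1 + t2) / 2" and "b = (t1 - t2) / 2" and "c = (t1 + t2) / 2"
  have e: "y - t1 = a - b" "y - t2 = a + b" "y = a + c" "t1 + t2 - y = c - a" "t1 = c + b" "t2 = c - b"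
    by (simp_all add: a_def b_def c_def field_simps)
  have "0 \<le> cos t1 - cos t2" using assms by simp
  then have 1: "sin c * sin b \<le> 0" unfolding e(5,6) cos_add cos_diff by (simp add: mult.commute)
  have "(cos (y - t1) - cos (y - t2)) * (cos y - cos (t1 + t2 - y)) = (sin a)\<^sup>2 * (4 * - (sin c * sin b))"
    unfolding e(1,2,4) unfolding e(3) cos_add cos_diff by (simp add: algebra_simps power2_eq_square)
  also have "0 \<le> \<dots>" using 1 by (intro mult_nonneg_nonneg) auto
  finally show ?thesis .
qed

text \<open>Halving \<open>l\<close> at most triples the failure of monotonicity, which is exponentially small for large \<open>l\<close>;
  hence there is none.\<close>

definition theta_defect :: "real \<Rightarrow> real \<Rightarrow> bool" where
  "theta_defect l d \<longleftrightarrow> (\<forall>x x'. cos x' \<le> cos x \<longrightarrow> theta l x' - theta l x \<le> d)"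

text \<open>The wrongly signed part of the convolution integrand is at most \<open>d\<close> times a
  sum of four translates of \<open>theta l\<close>. Dividing \<open>4 * sqrt (pi / l)\<close> by the
  prefactor \<open>2 * sqrt (pi / (2 * l))\<close> leaves \<open>2 * sqrt 2\<close>, rounded up to
  3.\<close>

lemma theta_defect_half:
  assumes l: "0 < l" and d: "0 \<le> d" and def: "theta_defect l d"
  shows "theta_defect (l / 2) (3 * d)"
  unfolding theta_defect_def
proof (intro allI impI)
  fix t1 t2 :: real assume c: "cos t2 \<le> cos t1"
  have [measurable]: "theta l \<in> borel_measurable borel" by (rule theta_measurable[OF l])
  obtain B where B: "\<And>x. \<bar>theta l x\<bar> \<le> B" using theta_bounded[OF l] by blast
  let ?p = "\<lambda>y. theta l (y - t1) - theta l (y - t2)" and ?q = "\<lambda>y. theta l y - theta l (t1 + t2 - y)"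
  have int: "integrable circ (\<lambda>y. theta l (f y))" if [measurable]: "f \<in> borel_measurable borel" for f
    by (rule circ_integrable_bounded[where B=B]) (auto simp: B)
  have bd: "\<bar>?p y\<bar> \<le> 2 * B" "\<bar>?q y\<bar> \<le> 2 * B" for y
    using B[of "y - t1"] B[of "y - t2"] B[of y] B[of "t1 + t2 - y"] by linarith+
  have B0: "0 \<le> B" using B[of 0] by linarith
  let ?S = "\<lambda>y. theta l (y - t1) + theta l (y - t2) + (theta l (y - 0) + theta l (y - (t1 + t2)))"
  have pt: "- (?p y * ?q y) \<le> d * ?S y" for y
  proof -
    have def': "theta l x' - theta l x \<le> d" if "cos x' \<le> cos x" for x x' using def that unfolding theta_defect_def by blast
    have ab: "\<bar>?p y\<bar> + \<bar>?q y\<bar> \<le> ?S y"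
      using theta_nonneg[OF l, of "y - t1"] theta_nonneg[OF l, of "y - t2"] theta_nonneg[OF l, of y]
        theta_nonneg[OF l, of "y - (t1 + t2)"] theta_minus_commute[OF l, of "t1 + t2" y] by simp
    \<comment> \<open>If \<open>p\<close> and \<open>q\<close> have opposite signs, one of them is a
      failure of monotonicity and hence at most \<open>d\<close> in absolute value.\<close>
    have key: "- (p * q) \<le> d * (\<bar>p\<bar> + \<bar>q\<bar>)" if "- d \<le> p \<and> - d \<le> q \<or> p \<le> d \<and> q \<le> d" for p q :: real
    proof (cases "0 \<le> p * q")
      case True
      have "0 \<le> d * (\<bar>p\<bar> + \<bar>q\<bar>)" using d by simp
      then show ?thesis using True by linarith
    next
      case False
      then have "p < 0 \<and> 0 < q \<or> 0 < p \<and> q < 0" by (auto simp: zero_le_mult_iff)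
      then have "\<bar>p\<bar> \<le> d \<or> \<bar>q\<bar> \<le> d" using that by auto
      then have "\<bar>p\<bar> * \<bar>q\<bar> \<le> d * (\<bar>p\<bar> + \<bar>q\<bar>)"
      proof
        assume "\<bar>p\<bar> \<le> d"
        then have "\<bar>p\<bar> * \<bar>q\<bar> \<le> d * \<bar>q\<bar>" by (rule mult_right_mono) simp
        also have "\<dots> \<le> d * (\<bar>p\<bar> + \<bar>q\<bar>)" using d by (intro mult_left_mono) auto
        finally show ?thesis .
      next
        assume "\<bar>q\<bar> \<le> d"
        then have "\<bar>p\<bar> * \<bar>q\<bar> \<le> \<bar>p\<bar> * d" by (rule mult_left_mono) simp
        also have "\<dots> = d * \<bar>p\<bar>" by (rule mult.commute)
        also have "\<dots> \<le> d * (\<bar>p\<bar> + \<bar>q\<bar>)" using d by (intro mult_left_mono) auto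
        finally show ?thesis .
      qed
      moreover have "- (p * q) \<le> \<bar>p\<bar> * \<bar>q\<bar>" unfolding abs_mult[symmetric] by simp
      ultimately show ?thesis by linarith
    qed
    have "- d \<le> ?p y \<and> - d \<le> ?q y \<or> ?p y \<le> d \<and> ?q y \<le> d"
      using conv_sign[OF c, of y] unfolding zero_le_mult_iff
      using def'[of "y - t2" "y - t1"] def'[of "t1 + t2 - y" y] def'[of "y - t1" "y - t2"] def'[of y "t1 + t2 - y"]
      by force
    from key[OF this] mult_left_mono[OF ab d] show ?thesis by linarith
  qed
  have "2 * sqrt (pi / (2 * l)) * (theta (l / 2) t2 - theta (l / 2) t1) = (LINT y|circ. - (?p y * ?q y))"
  proof -
    have "2 * sqrt (pi / (2 * l)) * (theta (l / 2) t2 - theta (l / 2) t1) =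
      - (2 * sqrt (pi / (2 * l)) * (theta (l / 2) t1 - theta (l / 2) t2))" by (simp add: algebra_simps)
    also have "\<dots> = - (LINT y|circ. ?p y * ?q y)" by (simp only: theta_conv_diff[OF l])
    finally show ?thesis by simp
  qed
  also have "\<dots> \<le> (LINT y|circ. d * ?S y)"
  proof (rule integral_mono)
    show "integrable circ (\<lambda>y. - (?p y * ?q y))"
    proof (intro integrable_minus circ_integrable_bounded[where B="2 * B * (2 * B)"])
      show "\<bar>?p y * ?q y\<bar> \<le> 2 * B * (2 * B)" for y
        unfolding abs_mult using bd B0 by (intro mult_mono) auto
    qed measurable
    show "integrable circ (\<lambda>y. d * ?S y)"
      by (intro integrable_mult_right Bochner_Integration.integrable_add int) measurable
  qed (rule pt)
  also have "\<dots> = d * (4 * sqrt (pi / l))"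
    by (simp only: integral_mult_right_zero integral_theta[OF l] int Bochner_Integration.integral_add Bochner_Integration.integrable_add
       borel_measurable_diff borel_measurable_const measurable_ident_sets[OF refl]) simp
  finally have *: "2 * sqrt (pi / (2 * l)) * (theta (l / 2) t2 - theta (l / 2) t1) \<le> d * (4 * sqrt (pi / l))" .
  have sq: "sqrt (pi / l) = sqrt 2 * sqrt (pi / (2 * l))"
    unfolding real_sqrt_mult[symmetric] by simp
  define w where "w = sqrt (pi / (2 * l))"
  have w: "0 < w" using l by (simp add: w_def)
  have "w * (2 * (theta (l / 2) t2 - theta (l / 2) t1)) \<le> w * (2 * (2 * sqrt 2 * d))"
    using * unfolding sq w_def[symmetric] by (simp add: algebra_simps)
  then have "theta (l / 2) t2 - theta (l / 2) t1 \<le> 2 * sqrt 2 * d"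
    using w by (simp add: mult_le_cancel_left_pos)
  also have "2 * sqrt 2 \<le> (3 :: real)"
  proof -
    have "sqrt 2 \<le> 3 / 2" by (rule real_le_lsqrt) (auto simp: power2_eq_square)
    then show ?thesis by simp
  qed
  then have "2 * sqrt 2 * d \<le> 3 * d" using d by (rule mult_right_mono)
  finally show "theta (l / 2) t2 - theta (l / 2) t1 \<le> 3 * d" .
qed

lemma fold_mono: "cos x' \<le> cos x \<Longrightarrow> \<bar>wrap x\<bar> \<le> \<bar>wrap x'\<bar>"
  using cos_less_iff_abs[of "wrap x" "wrap x'"] fold_bounds[of x] fold_bounds[of x'] cos_fold[of x] cos_fold[of x']
  by (metis abs_idempotent cos_abs_real linorder_not_le)

lemma theta_defect_base:
  assumes "1 \<le> l" shows "theta_defect l (5 * exp (- l))"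
  unfolding theta_defect_def
proof (intro allI impI)
  fix x x' :: real assume "cos x' \<le> cos x"
  then have le: "\<bar>wrap x\<bar> \<le> \<bar>wrap x'\<bar>" by (rule fold_mono)
  have l0: "0 < l" using assms by simp
  have "\<bar>wrap x\<bar>\<^sup>2 \<le> \<bar>wrap x'\<bar>\<^sup>2" using le by (intro power_mono) auto
  then have "exp (- l * \<bar>wrap x'\<bar>\<^sup>2) \<le> exp (- l * \<bar>wrap x\<bar>\<^sup>2)" using l0 by simp
  then show "theta l x' - theta l x \<le> 5 * exp (- l)"
    using theta_upper'[OF assms fold_bounds[of x']] theta_lower[OF l0, of "\<bar>wrap x\<bar>"]
      theta_fold[OF l0, of x] theta_fold[OF l0, of x'] by linarith
qed

text \<open>Halving \<open>j\<close> times from \<open>2 ^ j * l\<close> leaves the defect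
  \<open>3 ^ j * (5 * exp (- (2 ^ j * l)))\<close>, which tends to 0.\<close>

lemma theta_mono:
  assumes l: "0 < l" and c: "cos x' \<le> cos x"
  shows "theta l x' \<le> theta l x"
proof -
  have it: "theta_defect (L / 2 ^ j) (3 ^ j * d)" if "0 < L" "0 \<le> d" "theta_defect L d" for L d j
  proof (induction j)
    case (Suc j)
    from theta_defect_half[OF _ _ Suc] that show ?case by (simp add: ac_simps)
  qed (use that in simp)
  have ev: "eventually (\<lambda>j. theta l x' - theta l x \<le> 3 ^ j * (5 * exp (- (2 ^ j * l)))) sequentially"
  proof -
    obtain N where N: "1 / l < 2 ^ N" using real_arch_pow[of 2 "1 / l"] by auto
    show ?thesis
    proof (rule eventually_sequentiallyI[of N])
      fix j assume "N \<le> j"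
      then have "(2::real) ^ N \<le> 2 ^ j" by (simp add: power_increasing)
      then have "1 / l < 2 ^ j" using N by linarith
      then have "1 < 2 ^ j * l" using l by (simp only: pos_divide_less_eq)
      then have "1 \<le> 2 ^ j * l" by simp
      from it[OF _ _ theta_defect_base[OF this], of j] l
      have "theta_defect l (3 ^ j * (5 * exp (- (2 ^ j * l))))" by simp
      then show "theta l x' - theta l x \<le> 3 ^ j * (5 * exp (- (2 ^ j * l)))" using c unfolding theta_defect_def by blast
    qed
  qed
  have lim: "(\<lambda>j. 3 ^ j * (5 * exp (- (2 ^ j * l)))) \<longlonglongrightarrow> 0"
  proof (rule tendsto_sandwich[OF _ _ tendsto_const])
    show "eventually (\<lambda>j. 0 \<le> 3 ^ j * (5 * exp (- (2 ^ j * l)))) sequentially" by simp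
    show "eventually (\<lambda>j. 3 ^ j * (5 * exp (- (2 ^ j * l))) \<le> (10 / l\<^sup>2) * (3 / 4) ^ j) sequentially"
    proof (rule always_eventually, rule allI)
      fix j
      let ?y = "2 ^ j * l"
      have y: "0 < ?y" using l by simp
      \<comment> \<open>The quadratic lower bound gains a factor \<open>4 ^ j\<close>, enough
        against \<open>3 ^ j\<close>.\<close>
      have 1: "?y\<^sup>2 / 2 \<le> exp ?y" using exp_lower_Taylor_quadratic[of ?y] y by simp
      have "0 < ?y\<^sup>2" using y by (rule zero_less_power)
      then have 2: "0 < ?y\<^sup>2 / 2" by (rule half_gt_zero)
      have "1 / exp ?y \<le> 1 / (?y\<^sup>2 / 2)"
        by (rule divide_left_mono[OF 1 zero_le_one mult_pos_pos[OF exp_gt_zero 2]])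
      then have "exp (- ?y) \<le> 2 / ?y\<^sup>2" by (simp only: exp_minus inverse_eq_divide divide_divide_eq_right mult_1)
      also have "\<dots> = (2 / l\<^sup>2) * (1 / 4) ^ j"
      proof -
        have "((2::real) ^ j)\<^sup>2 = (2 * 2) ^ j" by (simp only: power2_eq_square power_mult_distrib)
        then show ?thesis by (simp add: power_mult_distrib power_divide)
      qed
      finally have "3 ^ j * (5 * exp (- ?y)) \<le> 3 ^ j * (5 * ((2 / l\<^sup>2) * (1 / 4) ^ j))"
        by (intro mult_left_mono) auto
      also have "\<dots> = (10 / l\<^sup>2) * (3 / 4) ^ j" by (simp add: power_divide)
      finally show "3 ^ j * (5 * exp (- ?y)) \<le> (10 / l\<^sup>2) * (3 / 4) ^ j" .
    qed
    show "(\<lambda>j. (10 / l\<^sup>2) * (3 / 4) ^ j) \<longlonglongrightarrow> 0"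
      by (rule tendsto_mult_right_zero, rule LIMSEQ_power_zero) simp
  qed
  have "theta l x' - theta l x \<le> 0"
    by (rule tendsto_lowerbound[OF lim ev]) simp
  then show ?thesis by simp
qed

section \<open>Strict monotonicity of the periodised Gaussian\<close>

lemma continuous_AE_zero:
  fixes h :: "real \<Rightarrow> real"
  assumes h: "continuous_on UNIV h" and ae: "AE y in circ. h y = 0" and y: "- pi < y" "y < pi"
  shows "h y = 0"
proof (rule ccontr)
  assume "h y \<noteq> 0"
  let ?S = "{- pi<..<pi} \<inter> h -` (- {0})"
  have "open (h -` (- {0}))" using h by (intro open_vimage) auto
  then have "open ?S" by auto
  moreover have "?S \<noteq> {}" using y \<open>h y \<noteq> 0\<close> by auto
  moreover have "negligible ?S"
  proof -
    have "AE x in lborel. x \<notin> ?S" using ae unfolding AE_circ by eventually_elim auto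
    then have "?S \<in> null_sets lborel" using \<open>open ?S\<close> by (subst AE_iff_null_sets) auto
    then show ?thesis using negligible_iff_null_sets null_sets_completionI by blast
  qed
  ultimately show False using open_not_negligible by blast
qed

text \<open>A flat piece of the periodised Gaussian persists when \<open>l\<close> is doubled, which is impossible for large \<open>l\<close>.\<close>

lemma theta_flat_double:
  assumes l: "0 < l" and t: "0 \<le> t1" "t1 < t2" "t2 \<le> pi"
    and eq: "theta (l / 2) t1 = theta (l / 2) t2"
    and peak: "t1 = 0 \<or> theta l (t2 - t1) < theta l 0"
  shows "theta l t1 = theta l t2"
proof -
  let ?h = "\<lambda>y. (theta l (y - t1) - theta l (y - t2)) * (theta l y - theta l (t1 + t2 - y))"
  have [measurable]: "theta l \<in> borel_measurable borel" by (rule theta_measurable[OF l])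
  obtain B where B: "\<And>x. \<bar>theta l x\<bar> \<le> B" using theta_bounded[OF l] by blast
  have c: "cos t2 \<le> cos t1" using t by (intro cos_monotone_0_pi_le) auto
  have nn: "0 \<le> ?h y" for y
    using conv_sign[OF c, of y] theta_mono[OF l] unfolding zero_le_mult_iff by force
  have B0: "0 \<le> B" using B[of 0] by linarith
  have int: "integrable circ ?h"
  proof (rule circ_integrable_bounded[where B="2 * B * (2 * B)"])
    show "\<bar>?h y\<bar> \<le> 2 * B * (2 * B)" for y
      unfolding abs_mult using B[of "y - t1"] B[of "y - t2"] B[of y] B[of "t1 + t2 - y"] B0
      by (intro mult_mono) auto
  qed measurable
  have "(LINT y|circ. ?h y) = 0" using theta_conv_diff[OF l, of t1 t2] eq by simp
  then have ae: "AE y in circ. ?h y = 0" using integral_nonneg_eq_0_iff_AE[OF int] nn by simp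
  have cont: "continuous_on UNIV ?h"
    by (intro continuous_intros continuous_on_compose2[OF theta_continuous[OF l]]) auto
  \<comment> \<open>At \<open>y = t1\<close> the integrand is the drop from 0 to
    \<open>t2 - t1\<close> times the drop from \<open>t1\<close> to \<open>t2\<close>. The first
    factor is nonzero by \<open>peak\<close>, or equals the second when
    \<open>t1 = 0\<close>.\<close>
  have "?h t1 = 0" by (rule continuous_AE_zero[OF cont ae]) (use t pi_gt_zero in linarith)+
  then have "(theta l 0 - theta l (t2 - t1)) * (theta l t1 - theta l t2) = 0"
    using theta_minus_commute[OF l, of t1 t2] by simp
  then show ?thesis using peak by auto
qed

text \<open>The 4 is the constant of \<open>theta_upper\<close>, absorbed by the ratio of the two
  leading Gaussians.\<close>

lemma theta_strict_large:
  assumes t: "0 \<le> t1" "t1 < t2" "t2 \<le> pi" and L: "1 \<le> L" "4 \<le> L * (t2\<^sup>2 - t1\<^sup>2)"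
  shows "theta L t2 < theta L t1"
proof -
  have "4 < exp (L * (t2\<^sup>2 - t1\<^sup>2))" using exp_ge_add_one_self[of "L * (t2\<^sup>2 - t1\<^sup>2)"] L by linarith
  then have "4 * exp (- L * t2\<^sup>2) < exp (L * (t2\<^sup>2 - t1\<^sup>2)) * exp (- L * t2\<^sup>2)" by simp
  also have "\<dots> = exp (- L * t1\<^sup>2)" by (simp add: exp_add[symmetric] algebra_simps)
  finally show ?thesis using theta_upper[OF L(1), of t2] theta_lower[of L t1] t L by simp
qed

lemma theta_strict_step:
  assumes t: "0 \<le> t1" "t1 < t2" "t2 \<le> pi" and l: "0 < l"
    and peak: "t1 = 0 \<or> (\<forall>m>0. theta m (t2 - t1) < theta m 0)"
  shows "theta l t2 < theta l t1"
proof -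
  have "theta l t2 \<le> theta l t1"
    using t by (intro theta_mono[OF l] cos_monotone_0_pi_le) auto
  moreover have "theta l t1 \<noteq> theta l t2"
  proof
    assume eq: "theta l t1 = theta l t2"
    have flat: "theta (2 ^ j * l) t1 = theta (2 ^ j * l) t2" for j
    proof (induction j)
      case (Suc j)
      show ?case
        by (rule theta_flat_double[OF _ t]) (use l peak Suc in auto)
    qed (use eq in simp)
    have d: "0 < t2\<^sup>2 - t1\<^sup>2" using t by (simp add: power_strict_mono)
    obtain N where N: "max (1 / l) (4 / (l * (t2\<^sup>2 - t1\<^sup>2))) < 2 ^ N"
      using real_arch_pow[of 2 "max (1 / l) (4 / (l * (t2\<^sup>2 - t1\<^sup>2)))"] by auto
    have "1 \<le> 2 ^ N * l" using N l by (simp add: field_simps less_imp_le)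
    moreover have "4 \<le> (2 ^ N * l) * (t2\<^sup>2 - t1\<^sup>2)"
    proof -
      have "4 / (l * (t2\<^sup>2 - t1\<^sup>2)) < 2 ^ N" using N by simp
      then show ?thesis using l d by (simp add: pos_divide_less_eq mult.assoc less_imp_le)
    qed
    ultimately show False using theta_strict_large[OF t, of "2 ^ N * l"] flat[of N] by simp
  qed
  ultimately show ?thesis by simp
qed

text \<open>\<open>theta_strict_step\<close> is used twice: with \<open>t1 = 0\<close> it makes 0 a
  strict maximum for every parameter, and this is the peak condition for general pairs.\<close>

lemma theta_strict:
  assumes l: "0 < l" and c: "cos x' < cos x"
  shows "theta l x' < theta l x"
proof -
  have peak: "theta m r < theta m 0" if "0 < m" "0 < r" "r \<le> pi" for m r
    by (rule theta_strict_step) (use that in auto)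
  have lt: "\<bar>wrap x\<bar> < \<bar>wrap x'\<bar>"
    using fold_mono[of x' x] c cos_fold[of x] cos_fold[of x'] by (metis less_imp_le order_le_imp_less_or_eq less_irrefl)
  have "theta l \<bar>wrap x'\<bar> < theta l \<bar>wrap x\<bar>"
    by (rule theta_strict_step) (use lt fold_bounds[of x] fold_bounds[of x'] l in \<open>auto intro!: peak\<close>)
  then show ?thesis using theta_fold[OF l] by simp
qed

section \<open>Bernstein's theorem\<close>

text \<open>The cut-off makes the signed derivatives nonnegative and Borel measurable on the whole
  line, whatever \<open>f\<close> does outside the open half line.\<close>

definition cm_deriv :: "(real \<Rightarrow> real) \<Rightarrow> nat \<Rightarrow> real \<Rightarrow> real" where
  "cm_deriv f N x = indicator {0<..} x * ((- 1) ^ N * (deriv ^^ N) f x)"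

text \<open>The power \<open>v powr \<tau>\<close> on the unit interval, extended by constants. With
  \<open>v = exp (- l)\<close> it is \<open>exp (- l * \<tau>)\<close>; for
  \<open>\<tau> > 0\<close> it is bounded and continuous on the line, hence a test function for weak
  convergence.\<close>

definition clamp_powr :: "real \<Rightarrow> real \<Rightarrow> real" where
  "clamp_powr \<tau> u = max 0 (min 1 u) powr \<tau>"

lemma clamp_powr_bounds: "0 \<le> clamp_powr \<tau> u" "0 < \<tau> \<Longrightarrow> clamp_powr \<tau> u \<le> 1"
  by (auto simp: clamp_powr_def intro!: powr_le1)

lemma clamp_powr_cont: "0 < \<tau> \<Longrightarrow> continuous_on UNIV (clamp_powr \<tau>)"
  unfolding clamp_powr_def[abs_def]
  by (rule continuous_on_powr') (auto intro!: continuous_intros)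

lemma clamp_powr_measurable [measurable]: "clamp_powr \<tau> \<in> borel_measurable borel"
  unfolding clamp_powr_def[abs_def] by measurable

lemma power_diff_le:
  fixes a b :: real
  assumes "0 \<le> b" "b \<le> a"
  shows "a ^ Suc N - b ^ Suc N \<le> (real N + 1) * (a - b) * a ^ N"
proof (induction N)
  case (Suc N)
  have "a ^ Suc (Suc N) - b ^ Suc (Suc N) = a * (a ^ Suc N - b ^ Suc N) + (a - b) * b ^ Suc N"
    by (simp add: algebra_simps)
  also have "\<dots> \<le> a * ((real N + 1) * (a - b) * a ^ N) + (a - b) * a ^ Suc N"
    using assms Suc by (intro add_mono mult_left_mono power_mono) auto
  also have "\<dots> = (real (Suc N) + 1) * (a - b) * a ^ Suc N" by (simp add: algebra_simps)
  finally show ?case .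
qed simp

text \<open>The error is of order \<open>1 / N\<close> uniformly in \<open>x \<ge> 0\<close>, so it
  can be integrated against measures without control of their tails.\<close>

lemma exp_approx:
  fixes x :: real and N :: nat
  assumes x: "0 \<le> x" and N: "2 \<le> N"
  shows "\<bar>exp (- x) - (max 0 (1 - x / real N)) ^ N\<bar> \<le> real N / (real N - 1)\<^sup>2"
proof -
  have N1: "0 < real N - 1" using N by simp
  show ?thesis
  proof (cases "x \<le> real N")
    case False
    have "x < exp x" using exp_ge_add_one_self[of x] by linarith
    then have "1 / exp x \<le> 1 / x" using False N1 by (intro divide_left_mono) auto
    then have "exp (- x) \<le> 1 / x" by (simp only: exp_minus inverse_eq_divide)
    also have "\<dots> \<le> 1 / real N" using False N1 by (intro divide_left_mono) auto
    also have "\<dots> \<le> real N / (real N - 1)\<^sup>2"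
    proof -
      have "(real N - 1)\<^sup>2 \<le> (real N)\<^sup>2" using N1 by (intro power_mono) auto
      then have "real N / (real N)\<^sup>2 \<le> real N / (real N - 1)\<^sup>2" using N1 by (intro divide_left_mono) auto
      then show ?thesis using N by (simp add: power2_eq_square split: if_splits)
    qed
    finally have "exp (- x) \<le> real N / (real N - 1)\<^sup>2" .
    moreover have "max 0 (1 - x / real N) = 0" using False N by (simp add: max_def field_simps)
    ultimately show ?thesis using N by (simp add: power_0_left)
  next
    case True
    define y where "y = x / real N"
    have y: "0 \<le> y" "y \<le> 1" using x True N by (auto simp: y_def)
    have xy: "x = real N * y" using N by (simp add: y_def)
    obtain M where M: "N = Suc M" "1 \<le> M" using N by (cases N) auto
    have ab: "0 \<le> 1 - y" "1 - y \<le> exp (- y)" using y exp_ge_add_one_self[of "- y"] by auto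
    have e: "exp (- x) = exp (- y) ^ N" by (simp add: xy exp_of_nat_mult[symmetric])
    have lower: "0 \<le> exp (- y) ^ N - (1 - y) ^ N" using ab by (simp add: power_mono)
    have q: "exp (- y) - (1 - y) \<le> y\<^sup>2 / 2"
    proof -
      have "1 + y + y\<^sup>2 / 2 \<le> exp y" using exp_lower_Taylor_quadratic[OF y(1)] .
      moreover have "0 < 1 + y + y\<^sup>2 / 2" using y by (simp add: add_pos_nonneg)
      ultimately have "inverse (exp y) \<le> inverse (1 + y + y\<^sup>2 / 2)" by (rule le_imp_inverse_le)
      then have "exp (- y) \<le> 1 / (1 + y + y\<^sup>2 / 2)" by (simp only: exp_minus inverse_eq_divide)
      also have "\<dots> \<le> 1 - y + y\<^sup>2 / 2"
      proof -
        have "1 \<le> (1 - y + y\<^sup>2 / 2) * (1 + y + y\<^sup>2 / 2)"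
          using y(1) by (simp add: algebra_simps power2_eq_square)
        then show ?thesis using y by (simp add: pos_divide_le_eq add_pos_nonneg)
      qed
      finally show ?thesis by simp
    qed
    have "exp (- y) ^ N - (1 - y) ^ N \<le> (real M + 1) * (exp (- y) - (1 - y)) * exp (- y) ^ M"
      unfolding M(1) by (rule power_diff_le[OF ab])
    also have "\<dots> \<le> (real M + 1) * (y\<^sup>2 / 2) * exp (- y) ^ M"
      using q by (intro mult_right_mono mult_left_mono) auto
    also have "\<dots> \<le> (real M + 1) / (real M)\<^sup>2"
    proof (cases "y = 0")
      case False
      \<comment> \<open>The maximum of \<open>y\<^sup>2 * exp (- M * y)\<close> is of order
        \<open>1 / M\<^sup>2\<close>; \<open>z\<^sup>2 / 2 \<le> exp z\<close> at
        \<open>z = M * y\<close> captures this.\<close>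
      define z where "z = real M * y"
      have z: "0 < z" using False y M by (simp add: z_def)
      have "z\<^sup>2 / 2 \<le> exp z" using exp_lower_Taylor_quadratic[of z] z by simp
      then have "z\<^sup>2 / 2 * exp (- z) \<le> exp z * exp (- z)" by (rule mult_right_mono) simp
      then have "z\<^sup>2 / 2 * exp (- z) \<le> 1" by (simp add: exp_add[symmetric])
      then have "(real M + 1) / (real M)\<^sup>2 * (z\<^sup>2 / 2 * exp (- z)) \<le> (real M + 1) / (real M)\<^sup>2 * 1"
        by (intro mult_left_mono) auto
      moreover have "(real M + 1) / (real M)\<^sup>2 * (z\<^sup>2 / 2 * exp (- z)) = (real M + 1) * (y\<^sup>2 / 2) * exp (- y) ^ M"
        using M(2) by (simp add: z_def power_mult_distrib exp_of_nat_mult[symmetric])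
      ultimately show ?thesis by (simp only: mult_1_right)
    qed simp
    finally have "exp (- y) ^ N - (1 - y) ^ N \<le> real N / (real N - 1)\<^sup>2" by (simp add: M(1) add.commute)
    moreover have "max 0 (1 - x / real N) = 1 - y" using y by (simp add: y_def[symmetric])
    ultimately show ?thesis using lower e by simp
  qed
qed

text \<open>The limit 0 at infinity removes the boundary terms of Taylor's formula there; the bound
  makes the total mass of the representing measures finite.\<close>

locale cm_function =
  fixes f :: "real \<Rightarrow> real" and B :: real
  assumes cm: "completely_monotonic f"
    and f_lim: "(f \<longlongrightarrow> 0) at_top"
    and f_bound: "0 < t \<Longrightarrow> f t \<le> B"
begin

abbreviation g :: "nat \<Rightarrow> real \<Rightarrow> real" where "g \<equiv> cm_deriv f"

lemma g_nonneg: "0 \<le> g N t"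
  using cm unfolding completely_monotonic_def cm_deriv_def
  by (cases "N = 0") (auto simp: indicator_def)

lemma g_deriv:
  assumes "0 < t" shows "(g N has_real_derivative - g (Suc N) t) (at t)"
proof -
  have "((deriv ^^ N) f) differentiable (at t)" using cm assms unfolding completely_monotonic_def by blast
  then have "((deriv ^^ N) f has_real_derivative deriv ((deriv ^^ N) f) t) (at t)"
    by (simp add: DERIV_deriv_iff_real_differentiable)
  then have "((\<lambda>x. (- 1) ^ N * (deriv ^^ N) f x) has_real_derivative (- 1) ^ N * deriv ((deriv ^^ N) f) t) (at t)"
    by (rule DERIV_cmult)
  then have "(g N has_real_derivative (- 1) ^ N * deriv ((deriv ^^ N) f) t) (at t)"
    by (rule has_field_derivative_transform_within_open[where S="{0<..}"])
      (use assms in \<open>auto simp: cm_deriv_def\<close>)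
  then show ?thesis using assms by (simp add: cm_deriv_def)
qed

lemma g_measurable [measurable]: "g N \<in> borel_measurable borel"
proof -
  have "continuous_on {0<..} (\<lambda>x. (- 1) ^ N * (deriv ^^ N) f x)"
  proof (intro continuous_intros)
    show "continuous_on {0<..} ((deriv ^^ N) f)"
      using cm unfolding completely_monotonic_def
      by (intro continuous_at_imp_continuous_on ballI differentiable_imp_continuous_within) auto
  qed
  from borel_measurable_continuous_on_indicator[OF _ this] show ?thesis
    by (simp add: cm_deriv_def[abs_def])
qed

lemma g_antimono: "0 < s \<Longrightarrow> s \<le> t \<Longrightarrow> g N t \<le> g N s"
  by (rule DERIV_nonpos_imp_nonincreasing[of s t "g N"])
    (auto intro!: exI[of _ "- g (Suc N) x" for x] g_deriv simp: g_nonneg)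

text \<open>By the mean value theorem on \<open>{t / 2..t}\<close>, of length at least 1 once
  \<open>t \<ge> 2\<close>, the next signed derivative at \<open>t\<close> is at most the previous
  one at \<open>t / 2\<close>.\<close>

lemma g_lim: "(g N \<longlongrightarrow> 0) at_top"
proof (induction N)
  case 0
  show ?case
    by (rule Lim_transform_eventually[OF f_lim])
      (auto simp: cm_deriv_def intro!: eventually_at_top_linorderI[of 1])
next
  case (Suc N)
  have *: "g (Suc N) t \<le> g N (t / 2)" if "2 \<le> t" for t
  proof -
    have "\<exists>z. t / 2 < z \<and> z < t \<and> g N t - g N (t / 2) = (t - t / 2) * (- g (Suc N) z)"
      by (rule MVT2) (use that in \<open>auto intro!: g_deriv\<close>)
    then obtain z where z: "t / 2 < z" "z < t" "g N t - g N (t / 2) = (t - t / 2) * (- g (Suc N) z)" by blast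
    have "1 * g (Suc N) t \<le> (t - t / 2) * g (Suc N) z"
      using that z g_antimono[of z t "Suc N"] g_nonneg by (intro mult_mono) auto
    then show ?thesis using z(3) g_nonneg[of N t] by simp
  qed
  have half: "filterlim (\<lambda>t::real. t / 2) at_top at_top"
    unfolding filterlim_at_top
  proof
    fix Z :: real
    show "eventually (\<lambda>t. Z \<le> t / 2) at_top" by (rule eventually_at_top_linorderI[of "2 * Z"]) simp
  qed
  have "((\<lambda>t. g N (t / 2)) \<longlongrightarrow> 0) at_top"
    by (rule filterlim_compose[OF Suc half])
  then show ?case
    by (rule tendsto_sandwich[OF _ _ tendsto_const, rotated 2])
      (auto intro!: always_eventually g_nonneg eventually_at_top_linorderI[of 2] *)
qed

lemma g_FTC:
  assumes "0 < a"
  shows "(\<integral>\<^sup>+x. ennreal (g (Suc N) x) * indicator {a..} x \<partial>lborel) = ennreal (g N a)"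
proof -
  have "(\<integral>\<^sup>+x. ennreal (g (Suc N) x) * indicator {a..} x \<partial>lborel) = ennreal (0 - (- g N a))"
  proof (rule nn_integral_FTC_atLeast)
    show "DERIV (\<lambda>x. - g N x) x :> g (Suc N) x" if "a \<le> x" for x
      using DERIV_minus[OF g_deriv[of x N]] that assms by simp
    show "((\<lambda>x. - g N x) \<longlongrightarrow> 0) at_top" using tendsto_minus[OF g_lim[of N]] by simp
  qed (auto simp: g_nonneg)
  then show ?thesis by simp
qed

text \<open>Taylor's formula expanded from infinity, where all derivatives vanish. Integration by
  parts appears as a Tonelli exchange, justified by nonnegativity.\<close>

lemma g_Taylor:
  assumes t: "0 < \<tau>"
  shows "(\<integral>\<^sup>+u. ennreal (g (Suc N) u * ((u - \<tau>) ^ N / fact N)) * indicator {\<tau>..} u \<partial>lborel) = ennreal (g 0 \<tau>)"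
proof (induction N)
  case 0
  then show ?case using g_FTC[OF t, of 0] by simp
next
  case (Suc N)
  have inner: "(\<integral>\<^sup>+v. ennreal ((v - \<tau>) ^ N / fact N) * indicator {\<tau>..u} v \<partial>lborel) = ennreal ((u - \<tau>) ^ Suc N / fact (Suc N))"
    if "\<tau> \<le> u" for u
  proof -
    have "(\<integral>\<^sup>+v. ennreal ((v - \<tau>) ^ N / fact N) * indicator {\<tau>..u} v \<partial>lborel)
       = ennreal ((u - \<tau>) ^ Suc N / fact (Suc N) - (\<tau> - \<tau>) ^ Suc N / fact (Suc N))"
    proof (rule nn_integral_FTC_Icc)
      show "DERIV (\<lambda>x. (x - \<tau>) ^ Suc N / fact (Suc N)) x :> (x - \<tau>) ^ N / fact N" for x
      proof -
        have "DERIV (\<lambda>x. (x - \<tau>) ^ Suc N / fact (Suc N)) x :> real (Suc N) * (x - \<tau>) ^ N / fact (Suc N)"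
          by (auto intro!: derivative_eq_intros simp del: power_Suc fact_Suc of_nat_Suc)
        moreover have "real (Suc N) * (x - \<tau>) ^ N / fact (Suc N) = (x - \<tau>) ^ N / fact N"
          unfolding fact_Suc by (simp del: of_nat_Suc)
        ultimately show ?thesis by simp
      qed
    qed (use that in auto)
    then show ?thesis by simp
  qed
  have "ennreal (g 0 \<tau>) = (\<integral>\<^sup>+v. ennreal (g (Suc N) v * ((v - \<tau>) ^ N / fact N)) * indicator {\<tau>..} v \<partial>lborel)"
    by (rule Suc[symmetric])
  also have "\<dots> = (\<integral>\<^sup>+v. \<integral>\<^sup>+u. ennreal (g (Suc (Suc N)) u) * (ennreal ((v - \<tau>) ^ N / fact N) * indicator {\<tau>..u} v) \<partial>lborel \<partial>lborel)"
  proof (rule nn_integral_cong)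
    fix v :: real
    show "ennreal (g (Suc N) v * ((v - \<tau>) ^ N / fact N)) * indicator {\<tau>..} v =
      (\<integral>\<^sup>+u. ennreal (g (Suc (Suc N)) u) * (ennreal ((v - \<tau>) ^ N / fact N) * indicator {\<tau>..u} v) \<partial>lborel)"
    proof (cases "\<tau> \<le> v")
      case True
      have "(\<integral>\<^sup>+u. ennreal (g (Suc (Suc N)) u) * (ennreal ((v - \<tau>) ^ N / fact N) * indicator {\<tau>..u} v) \<partial>lborel)
        = (\<integral>\<^sup>+u. (ennreal (g (Suc (Suc N)) u) * indicator {v..} u) * ennreal ((v - \<tau>) ^ N / fact N) \<partial>lborel)"
        using True by (intro nn_integral_cong) (auto simp: indicator_def)
      also have "\<dots> = ennreal (g (Suc N) v) * ennreal ((v - \<tau>) ^ N / fact N)"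
        using True t by (subst nn_integral_multc) (auto simp: g_FTC)
      also have "\<dots> = ennreal (g (Suc N) v * ((v - \<tau>) ^ N / fact N))"
        using True by (intro ennreal_mult[symmetric] g_nonneg) simp
      finally show ?thesis using True by simp
    next
      case False
      then have "indicator {\<tau>..u} v = (0 :: ennreal)" for u by (simp add: indicator_def)
      with False show ?thesis by simp
    qed
  qed
  also have "\<dots> = (\<integral>\<^sup>+u. \<integral>\<^sup>+v. ennreal (g (Suc (Suc N)) u) * (ennreal ((v - \<tau>) ^ N / fact N) * indicator {\<tau>..u} v) \<partial>lborel \<partial>lborel)"
  proof (rule lborel_pair.Fubini')
    have [measurable]: "Measurable.pred (lborel \<Otimes>\<^sub>M lborel) (\<lambda>p. snd p \<in> {\<tau>..fst p})"
      unfolding atLeastAtMost_iff by measurable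
    show "(\<lambda>(u, v). ennreal (g (Suc (Suc N)) u) * (ennreal ((v - \<tau>) ^ N / fact N) * indicator {\<tau>..u} v)) \<in> borel_measurable (lborel \<Otimes>\<^sub>M lborel)"
      unfolding indicator_def atLeastAtMost_iff of_bool_def by measurable
  qed
  also have "\<dots> = (\<integral>\<^sup>+u. ennreal (g (Suc (Suc N)) u * ((u - \<tau>) ^ Suc N / fact (Suc N))) * indicator {\<tau>..} u \<partial>lborel)"
  proof (rule nn_integral_cong)
    fix u :: real
    show "(\<integral>\<^sup>+v. ennreal (g (Suc (Suc N)) u) * (ennreal ((v - \<tau>) ^ N / fact N) * indicator {\<tau>..u} v) \<partial>lborel) =
       ennreal (g (Suc (Suc N)) u * ((u - \<tau>) ^ Suc N / fact (Suc N))) * indicator {\<tau>..} u"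
    proof (cases "\<tau> \<le> u")
      case True
      then show ?thesis using g_nonneg
        by (subst nn_integral_cmult) (auto simp: inner ennreal_mult[symmetric] simp del: power_Suc fact_Suc)
    next
      case False
      then have "indicator {\<tau>..u} v = (0 :: ennreal)" for v by (simp add: indicator_def)
      with False show ?thesis by simp
    qed
  qed
  finally show ?case by simp
qed

text \<open>Pulling \<open>u ^ N\<close> out of the Taylor remainder leaves this weight and the
  kernel \<open>(1 - \<tau> / u) ^ N\<close>, close to \<open>exp (- N * \<tau> / u)\<close>, in the
  manner of Post-Widder inversion.\<close>

definition w :: "nat \<Rightarrow> real \<Rightarrow> real" where
  "w N u = g (Suc N) u * (u ^ N / fact N)"

lemma w_measurable [measurable]: "w N \<in> borel_measurable borel"
  unfolding w_def[abs_def] by measurable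

lemma w_nonneg: "0 \<le> w N u"
proof (cases "0 < u")
  case True then show ?thesis using g_nonneg by (simp add: w_def)
next
  case False then show ?thesis by (simp add: w_def cm_deriv_def)
qed

lemma w_zero: "u \<le> 0 \<Longrightarrow> w N u = 0"
  by (simp add: w_def cm_deriv_def)

lemma w_repr:
  assumes t: "0 < \<tau>" and N: "1 \<le> N"
  shows "(\<integral>\<^sup>+u. ennreal (w N u * (max 0 (1 - \<tau> / u)) ^ N) \<partial>lborel) = ennreal (f \<tau>)"
proof -
  have "ennreal (w N u * (max 0 (1 - \<tau> / u)) ^ N) = ennreal (g (Suc N) u * ((u - \<tau>) ^ N / fact N)) * indicator {\<tau>..} u" for u
  proof (cases "\<tau> \<le> u")
    case True
    then have "max 0 (1 - \<tau> / u) = (u - \<tau>) / u" using t by (simp add: field_simps)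
    then show ?thesis using True t by (simp add: w_def power_divide)
  next
    case False
    show ?thesis
    proof (cases "0 < u")
      case True
      \<comment> \<open>Here \<open>N \<ge> 1\<close> matters, because
        \<open>0 ^ 0 = 1\<close>.\<close>
      then have "max 0 (1 - \<tau> / u) = 0" using False by (simp add: max_def field_simps)
      then show ?thesis using False N by (cases N) auto
    qed (use False in \<open>simp add: w_zero\<close>)
  qed
  then show ?thesis using g_Taylor[OF t, of N] t by (simp add: cm_deriv_def)
qed

text \<open>The limit of \<open>f\<close> at 0 from the right, which is the total mass of every
  weight \<open>w N\<close> with \<open>N \<ge> 1\<close>.\<close>

definition f0 :: real where "f0 = (SUP k. f (1 / real (Suc k)))"

lemma f_antimono: "0 < s \<Longrightarrow> s \<le> t \<Longrightarrow> f t \<le> f s"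
  using g_antimono[of s t 0] by (simp add: cm_deriv_def)

lemma f_nonneg: "0 < t \<Longrightarrow> 0 \<le> f t"
  using cm unfolding completely_monotonic_def by blast

lemma f_seq_incseq: "incseq (\<lambda>k. f (1 / real (Suc k)))"
  by (intro incseq_SucI f_antimono) (auto simp: field_simps)

lemma f_seq_lim: "(\<lambda>k. f (1 / real (Suc k))) \<longlonglongrightarrow> f0"
  unfolding f0_def
  by (rule LIMSEQ_incseq_SUP[OF _ f_seq_incseq]) (auto intro!: bdd_aboveI2[of _ _ B] f_bound)

lemma f0_ge: "0 < t \<Longrightarrow> f t \<le> f0"
proof -
  assume t: "0 < t"
  obtain k where k: "1 / real (Suc k) < t" using t reals_Archimedean[of t] by (auto simp: inverse_eq_divide)
  have "f t \<le> f (1 / real (Suc k))" using k by (intro f_antimono) auto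
  also have "\<dots> \<le> f0" unfolding f0_def
    by (intro cSUP_upper) (auto intro!: bdd_aboveI2[of _ _ B] f_bound)
  finally show ?thesis .
qed

text \<open>Monotone convergence in \<open>w_repr\<close>: where the weight lives, the kernel
  increases to 1 as \<open>\<tau>\<close> decreases to 0.\<close>

lemma w_total:
  assumes N: "1 \<le> N"
  shows "(\<integral>\<^sup>+u. ennreal (w N u) \<partial>lborel) = ennreal f0"
proof -
  have "(\<lambda>k. \<integral>\<^sup>+u. ennreal (w N u * (max 0 (1 - (1 / real (Suc k)) / u)) ^ N) \<partial>lborel) \<longlonglongrightarrow> (\<integral>\<^sup>+u. ennreal (w N u) \<partial>lborel)"
  proof (rule nn_integral_LIMSEQ)
    show "incseq (\<lambda>k u. ennreal (w N u * (max 0 (1 - (1 / real (Suc k)) / u)) ^ N))"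
    proof (rule incseq_SucI, rule le_funI)
      fix k u
      show "ennreal (w N u * (max 0 (1 - (1 / real (Suc k)) / u)) ^ N) \<le> ennreal (w N u * (max 0 (1 - (1 / real (Suc (Suc k))) / u)) ^ N)"
      proof (cases "0 < u")
        case True
        have "(1 / real (Suc (Suc k))) / u \<le> (1 / real (Suc k)) / u"
          using True by (intro divide_right_mono divide_left_mono) auto
        then show ?thesis
          by (intro ennreal_leI mult_left_mono power_mono w_nonneg) auto
      qed (simp add: w_zero)
    qed
    show "(\<lambda>k. ennreal (w N u * (max 0 (1 - (1 / real (Suc k)) / u)) ^ N)) \<longlonglongrightarrow> ennreal (w N u)" for u
    proof (rule tendsto_ennrealI)
      have "(\<lambda>k. inverse (real (Suc k)) * inverse u) \<longlonglongrightarrow> 0"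
        by (rule tendsto_mult_left_zero[OF LIMSEQ_inverse_real_of_nat])
      then have L: "(\<lambda>k. (1 / real (Suc k)) / u) \<longlonglongrightarrow> 0" by (simp only: divide_inverse mult_1)
      have "(\<lambda>k. w N u * (max 0 (1 - (1 / real (Suc k)) / u)) ^ N) \<longlonglongrightarrow> w N u * (max 0 (1 - 0)) ^ N"
        by (intro tendsto_mult tendsto_const tendsto_power tendsto_max tendsto_diff L)
      then show "(\<lambda>k. w N u * (max 0 (1 - (1 / real (Suc k)) / u)) ^ N) \<longlonglongrightarrow> w N u" by simp
    qed
  qed measurable
  moreover have "(\<lambda>k. \<integral>\<^sup>+u. ennreal (w N u * (max 0 (1 - (1 / real (Suc k)) / u)) ^ N) \<partial>lborel) \<longlonglongrightarrow> ennreal f0"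
    using tendsto_ennrealI[OF f_seq_lim] by (subst w_repr) (use N in auto)
  ultimately show ?thesis by (rule LIMSEQ_unique)
qed

lemma w_integrable: "1 \<le> N \<Longrightarrow> integrable lborel (w N)"
  by (rule integrableI_nonneg) (auto simp: w_nonneg w_total)

text \<open>The substitution \<open>v = exp (- N / u)\<close> moves all measures to the unit interval, so that tightness is
  automatic.\<close>

definition \<mu> :: "nat \<Rightarrow> real measure" where
  "\<mu> N = distr (density lborel (\<lambda>u. ennreal (w N u / f0))) borel (\<lambda>u. exp (- real N / u))"

text \<open>The interval \<open>{- 1<..2}\<close> merely surrounds the unit interval, in the
  half-open form used by \<open>tight\<close>.\<close>

lemma \<mu>_distribution:
  assumes pos: "0 < f0" and N: "1 \<le> N"
  shows "real_distribution (\<mu> N)" "measure (\<mu> N) {- 1<..2} = 1"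
proof -
  have "emeasure (density lborel (\<lambda>u. ennreal (w N u / f0))) UNIV = (\<integral>\<^sup>+u. ennreal (w N u) / ennreal f0 \<partial>lborel)"
    using pos w_nonneg by (subst emeasure_density) (auto simp: divide_ennreal)
  also have "\<dots> = 1" using pos by (subst nn_integral_divide) (auto simp: w_total[OF N] divide_ennreal)
  finally have p: "prob_space (density lborel (\<lambda>u. ennreal (w N u / f0)))" by (intro prob_spaceI) simp
  interpret p: prob_space "density lborel (\<lambda>u. ennreal (w N u / f0))" by (rule p)
  have m: "prob_space (\<mu> N)" unfolding \<mu>_def by (rule p.prob_space_distr) measurable
  interpret m: prob_space "\<mu> N" by (rule m)
  show "real_distribution (\<mu> N)" by standard (auto simp: \<mu>_def)
  have "AE u in lborel. 0 < ennreal (w N u / f0) \<longrightarrow> exp (- real N / u) \<in> {- 1<..2}"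
  proof (rule AE_I2, rule impI)
    fix u assume "0 < ennreal (w N u / f0)"
    then have "0 < u" using w_zero[of u N] pos by (cases "0 < u") auto
    then have "exp (- real N / u) \<le> 1" by simp
    then show "exp (- real N / u) \<in> {- 1<..2}"
      unfolding greaterThanAtMost_iff using exp_gt_zero[of "- real N / u"] by linarith
  qed
  then have "AE v in \<mu> N. v \<in> {- 1<..2}" unfolding \<mu>_def
    by (subst AE_distr_iff) (auto simp: AE_density)
  then show "measure (\<mu> N) {- 1<..2} = 1" by (subst m.prob_eq_1) (auto simp: \<mu>_def)
qed

text \<open>\<open>exp_approx\<close> is applied with \<open>x = N * \<tau> / u\<close>: the error
  does not depend on \<open>u\<close>, and the normalised weight has mass 1.\<close>

lemma \<mu>_approx:
  assumes pos: "0 < f0" and N: "2 \<le> N" and t: "0 < \<tau>"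
  shows "\<bar>(LINT v|\<mu> N. clamp_powr \<tau> v) - f \<tau> / f0\<bar> \<le> real N / (real N - 1)\<^sup>2"
proof -
  have N1: "1 \<le> N" using N by simp
  have nn: "0 \<le> w N u / f0" for u using w_nonneg pos by simp
  let ?e = "real N / (real N - 1)\<^sup>2"
  let ?a = "\<lambda>u. w N u / f0 * exp (- (real N * \<tau> / u))" and ?b = "\<lambda>u. w N u / f0 * (max 0 (1 - \<tau> / u)) ^ N"
  have iw: "integrable lborel (\<lambda>u. w N u / f0)" using w_integrable[OF N1] by simp
  have ia: "integrable lborel ?a"
  proof (rule Bochner_Integration.integrable_bound[OF iw])
    show "AE u in lborel. norm (?a u) \<le> norm (w N u / f0)"
    proof (rule AE_I2)
      fix u
      show "norm (?a u) \<le> norm (w N u / f0)"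
      proof (cases "0 < u")
        case True
        then have "exp (- (real N * \<tau> / u)) \<le> 1" using t by simp
        from mult_left_mono[OF this nn[of u]] have "?a u \<le> w N u / f0" by (simp only: mult_1_right)
        moreover have "0 \<le> ?a u" using nn[of u] by (intro mult_nonneg_nonneg) auto
        ultimately show ?thesis using nn[of u] by (simp only: real_norm_def abs_of_nonneg)
      qed (simp add: w_zero)
    qed
  qed measurable
  have ib: "integrable lborel ?b"
  proof (rule Bochner_Integration.integrable_bound[OF iw])
    show "AE u in lborel. norm (?b u) \<le> norm (w N u / f0)"
    proof (rule AE_I2)
      fix u
      show "norm (?b u) \<le> norm (w N u / f0)"
      proof (cases "0 < u")
        case True
        then have "(max 0 (1 - \<tau> / u)) ^ N \<le> 1" using t by (intro power_le_one) auto
        from mult_left_mono[OF this nn[of u]] have "?b u \<le> w N u / f0" by (simp only: mult_1_right)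
        moreover have "0 \<le> ?b u" using nn[of u] by (intro mult_nonneg_nonneg) auto
        ultimately show ?thesis using nn[of u] by (simp only: real_norm_def abs_of_nonneg)
      qed (simp add: w_zero)
    qed
  qed measurable
  have "(LINT v|\<mu> N. clamp_powr \<tau> v) = (LINT u|density lborel (\<lambda>u. ennreal (w N u / f0)). clamp_powr \<tau> (exp (- real N / u)))"
    unfolding \<mu>_def by (rule integral_distr) measurable
  also have "\<dots> = (LINT u|lborel. w N u / f0 * clamp_powr \<tau> (exp (- real N / u)))"
    using nn by (subst integral_density) auto
  also have "\<dots> = (LINT u|lborel. ?a u)"
  proof (rule Bochner_Integration.integral_cong[OF refl])
    fix u
    show "w N u / f0 * clamp_powr \<tau> (exp (- real N / u)) = ?a u"
    proof (cases "0 < u")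
      case True
      then have "exp (- real N / u) \<le> 1" by simp
      then have "clamp_powr \<tau> (exp (- real N / u)) = exp (- real N / u) powr \<tau>"
        by (simp add: clamp_powr_def del: exp_le_one_iff)
      also have "\<dots> = exp (- (real N * \<tau> / u))" by (simp add: exp_powr_real algebra_simps)
      finally show ?thesis by simp
    qed (simp add: w_zero)
  qed
  finally have 1: "(LINT v|\<mu> N. clamp_powr \<tau> v) = (LINT u|lborel. ?a u)" .
  have 2: "f \<tau> / f0 = (LINT u|lborel. ?b u)"
  proof -
    have "(LINT u|lborel. w N u * (max 0 (1 - \<tau> / u)) ^ N) = f \<tau>"
      using w_repr[OF t N1] w_nonneg f_nonneg[OF t] by (subst integral_eq_nn_integral) auto
    moreover have "(LINT u|lborel. ?b u) = (LINT u|lborel. w N u * (max 0 (1 - \<tau> / u)) ^ N) / f0"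
      by (subst integral_divide_zero[symmetric]) simp
    ultimately show ?thesis by simp
  qed
  have "\<bar>(LINT v|\<mu> N. clamp_powr \<tau> v) - f \<tau> / f0\<bar> = \<bar>LINT u|lborel. ?a u - ?b u\<bar>"
    unfolding 1 2 using ia ib by simp
  also have "\<dots> \<le> (LINT u|lborel. \<bar>?a u - ?b u\<bar>)" by (rule integral_abs_bound)
  also have "\<dots> \<le> (LINT u|lborel. w N u / f0 * ?e)"
  proof (rule integral_mono)
    show "\<bar>?a u - ?b u\<bar> \<le> w N u / f0 * ?e" for u
    proof (cases "0 < u")
      case True
      have "\<bar>exp (- (real N * \<tau> / u)) - (max 0 (1 - real N * \<tau> / u / real N)) ^ N\<bar> \<le> ?e"
        by (rule exp_approx) (use True t N in auto)
      then have "\<bar>exp (- (real N * \<tau> / u)) - (max 0 (1 - \<tau> / u)) ^ N\<bar> \<le> ?e" using N by simp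
      from mult_left_mono[OF this nn[of u]] show ?thesis
        unfolding right_diff_distrib[symmetric] abs_mult abs_of_nonneg[OF nn] .
    qed (simp add: w_zero)
    show "integrable lborel (\<lambda>u. \<bar>?a u - ?b u\<bar>)" using ia ib by (intro integrable_abs Bochner_Integration.integrable_diff)
    show "integrable lborel (\<lambda>u. w N u / f0 * ?e)" using iw by (rule integrable_mult_left)
  qed
  also have "\<dots> = ?e * (LINT u|lborel. w N u) / f0" by (simp add: mult.commute)
  also have "(LINT u|lborel. w N u) = f0"
    using w_total[OF N1] w_nonneg pos by (subst integral_eq_nn_integral) auto
  finally show ?thesis using pos by simp
qed

text \<open>Helly selection along \<open>\<mu> (n + 2)\<close>, the shift providing
  \<open>2 \<le> N\<close> for the error bound. The support of the limit is not located; clamping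
  the power makes this harmless. If \<open>f0\<close> is not positive, \<open>f\<close> vanishes on
  the half line and \<open>c = 0\<close> serves.\<close>

lemma Bernstein:
  "\<exists>c M. 0 \<le> c \<and> real_distribution M \<and> (\<forall>\<tau>>0. f \<tau> = c * (LINT v|M. clamp_powr \<tau> v))"
proof (cases "0 < f0")
  case False
  have "f \<tau> = 0" if "0 < \<tau>" for \<tau> using f0_ge[OF that] f_nonneg[OF that] False by simp
  moreover have "real_distribution (return borel (0 :: real))"
    by (simp add: real_distribution_def real_distribution_axioms_def prob_space_return)
  ultimately show ?thesis by (intro exI[of _ 0] exI[of _ "return borel 0"]) auto
next
  case True
  let ?\<mu> = "\<lambda>n. \<mu> (n + 2)"
  have rd: "real_distribution (?\<mu> n)" for n by (rule \<mu>_distribution[OF True]) simp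
  have "tight ?\<mu>" unfolding tight_def
  proof (intro conjI allI impI)
    show "real_distribution (\<mu> (n + 2))" for n by (rule rd)
    fix e :: real assume "0 < e"
    then show "\<exists>a b. a < b \<and> (\<forall>n. 1 - e < measure (\<mu> (n + 2)) {a<..b})"
      using \<mu>_distribution(2)[OF True] by (intro exI[of _ "- 1"] exI[of _ 2]) auto
  qed
  from tight_imp_convergent_subsubsequence[OF this strict_mono_id]
  obtain r M where r: "strict_mono r" and M: "real_distribution M" and conv: "weak_conv_m (?\<mu> \<circ> id \<circ> r) M"
    by blast
  have "f \<tau> / f0 = (LINT v|M. clamp_powr \<tau> v)" if t: "0 < \<tau>" for \<tau>
  proof -
    have lim1: "(\<lambda>n. LINT v|(?\<mu> \<circ> id \<circ> r) n. clamp_powr \<tau> v) \<longlonglongrightarrow> (LINT v|M. clamp_powr \<tau> v)"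
    proof (rule weak_conv_imp_integral_bdd_continuous_conv)
      show "isCont (clamp_powr \<tau>) x" for x
        using clamp_powr_cont[OF t] by (simp add: continuous_on_eq_continuous_at)
      show "norm (clamp_powr \<tau> x) \<le> 1" for x using clamp_powr_bounds[of \<tau> x] t by simp
    qed (use rd M conv in \<open>simp_all add: o_def\<close>)
    have e: "(\<lambda>n. real (r n + 2) / (real (r n + 2) - 1)\<^sup>2) \<longlonglongrightarrow> 0"
    proof -
      have "(\<lambda>n. real (n + 2) / (real (n + 2) - 1)\<^sup>2) \<longlonglongrightarrow> 0"
      proof (rule tendsto_sandwich[OF _ _ tendsto_const])
        show "eventually (\<lambda>n. real (n + 2) / (real (n + 2) - 1)\<^sup>2 \<le> 2 * inverse (real (Suc n))) sequentially"
        proof (rule always_eventually, rule allI)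
          fix n
          have 1: "real (n + 2) - 1 = real (Suc n)" by simp
          have "real (n + 2) / (real (Suc n))\<^sup>2 \<le> 2 * real (Suc n) / (real (Suc n))\<^sup>2"
            by (intro divide_right_mono) auto
          also have "\<dots> = 2 * inverse (real (Suc n))" by (simp add: power2_eq_square divide_inverse del: of_nat_Suc)
          finally show "real (n + 2) / (real (n + 2) - 1)\<^sup>2 \<le> 2 * inverse (real (Suc n))" unfolding 1 .
        qed
        show "(\<lambda>n. 2 * inverse (real (Suc n))) \<longlonglongrightarrow> 0"
          using tendsto_mult_right_zero[OF LIMSEQ_inverse_real_of_nat, of 2] by simp
      qed simp
      from LIMSEQ_subseq_LIMSEQ[OF this r] show ?thesis by (simp add: o_def)
    qed
    have "(\<lambda>n. (LINT v|(?\<mu> \<circ> id \<circ> r) n. clamp_powr \<tau> v) - f \<tau> / f0) \<longlonglongrightarrow> 0"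
      by (rule Lim_null_comparison[OF _ e]) (use \<mu>_approx[OF True _ t, of "r n + 2" for n] in \<open>auto intro!: always_eventually\<close>)
    then have "(\<lambda>n. LINT v|(?\<mu> \<circ> id \<circ> r) n. clamp_powr \<tau> v) \<longlonglongrightarrow> f \<tau> / f0"
      by (simp add: LIM_zero_iff)
    with lim1 show ?thesis using LIMSEQ_unique by blast
  qed
  then show ?thesis using True M by (intro exI[of _ f0] exI[of _ M]) (auto simp: field_simps)
qed

end

section \<open>Periodisation of the kernel\<close>

definition periodise :: "(real \<Rightarrow> real) \<Rightarrow> real \<Rightarrow> ennreal" where
  "periodise k t = (\<integral>\<^sup>+m. ennreal (k (t + 2 * pi * of_int m)) \<partial>count_space (UNIV :: int set))"

text \<open>Subtracting the chord over \<open>{a..d}\<close> leaves a convex \<open>e\<close> with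
  zero ends, so \<open>e \<le> 0\<close> inside, and \<open>e b + e c\<close> is the difference of
  the two sides. Equality forces \<open>e b = 0\<close>; vanishing at an interior point,
  \<open>e\<close> vanishes throughout and \<open>f\<close> is affine, which strict convexity on any
  overlapping interval forbids.\<close>

lemma convex_symmetric_pair:
  fixes f :: "real \<Rightarrow> real"
  assumes conv: "convex_on {0<..} f" and a: "0 < a" "a < b" and sum: "a + d = b + c" and ac: "a < c"
  shows "f b + f c \<le> f a + f d"
    and "strictly_convex_on {p<..<q} f \<Longrightarrow> max a p < min d q \<Longrightarrow> f b + f c < f a + f d"
proof -
  have bd: "b < d" "c < d" "a < d" using a sum ac by linarith+
  define s where "s = (f d - f a) / (d - a)"
  define e where "e x = f x - (f a + s * (x - a))" for x
  have sd: "s * (d - a) = f d - f a" using bd by (simp add: s_def)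
  have e_conv: "e ((1 - t) * x + t * y) \<le> (1 - t) * e x + t * e y"
    if "0 \<le> t" "t \<le> 1" "0 < x" "0 < y" for t x y
  proof -
    have "f ((1 - t) * x + t * y) \<le> (1 - t) * f x + t * f y"
      using convex_onD[OF conv that(1,2), of x y] that(3,4) by simp
    then show ?thesis unfolding e_def by (simp add: algebra_simps)
  qed
  have ea: "e a = 0" by (simp add: e_def)
  have ed: "e d = 0" using sd by (simp add: e_def)
  have between: "\<exists>t. 0 < t \<and> t < 1 \<and> z = (1 - t) * x + t * y" if "x < z" "z < y" for x y z :: real
  proof -
    define r where "r = (z - x) / (y - x)"
    have "0 < r" "r < 1" using that by (simp_all add: r_def field_simps)
    moreover have "r * (y - x) = z - x" using that by (simp add: r_def)
    then have "z = (1 - r) * x + r * y" by (simp add: algebra_simps)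
    ultimately show ?thesis by blast
  qed
  have e_le: "e x \<le> 0" if "a < x" "x < d" for x
  proof -
    from between[OF that] obtain t where t: "0 < t" "t < 1" "x = (1 - t) * a + t * d" by blast
    show ?thesis using e_conv[of t a d] t a(1) bd ea ed by simp
  qed
  have ebc: "e b + e c = f b + f c - (f a + f d)"
  proof -
    have "s * (b - a) + s * (c - a) = s * (d - a)"
      unfolding distrib_left[symmetric] using sum by (intro arg_cong[where f="(*) s"]) linarith
    then show ?thesis unfolding e_def using sd by linarith
  qed
  show 1: "f b + f c \<le> f a + f d" using ebc e_le[of b] e_le[of c] a ac bd by linarith
  assume strict: "strictly_convex_on {p<..<q} f" and pq: "max a p < min d q"
  show "f b + f c < f a + f d"
  proof (rule ccontr)
    assume "\<not> ?thesis"
    then have eb: "e b = 0" using ebc 1 e_le[of b] e_le[of c] a ac bd by linarith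
    have zero: "e x = 0" if x: "a < x" "x < d" for x
    proof -
      consider "x < b" | "x = b" | "b < x" by linarith
      then have "0 \<le> e x"
      proof cases
        case 1
        from between[OF 1 bd(1)] obtain t where t: "0 < t" "t < 1" "b = (1 - t) * x + t * d" by blast
        have "0 \<le> (1 - t) * e x" using e_conv[of t x d] t x a(1) bd eb ed by simp
        then show ?thesis using t by (simp add: zero_le_mult_iff)
      next
        case 2 then show ?thesis using eb by simp
      next
        case 3
        from between[OF a(2) 3] obtain t where t: "0 < t" "t < 1" "b = (1 - t) * a + t * x" by blast
        have "0 \<le> t * e x" using e_conv[of t a x] t x a(1) bd eb ea by simp
        then show ?thesis using t by (simp add: zero_le_mult_iff)
      qed
      with e_le[OF x] show ?thesis by simp
    qed
    obtain x where x: "max a p < x" "x < min d q" using dense[OF pq] by blast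
    obtain y where y: "x < y" "y < min d q" using dense[OF x(2)] by blast
    have m: "(1 / 2) * x + (1 - 1 / 2) * y = (x + y) / 2" by simp
    have mem: "x \<in> {p<..<q}" "y \<in> {p<..<q}" using x y by auto
    have "f (1 / 2 * x + (1 - 1 / 2) * y) < 1 / 2 * f x + (1 - 1 / 2) * f y"
      by (rule strict[unfolded strictly_convex_on_def, rule_format, OF mem]) (use y in auto)
    then have "f ((x + y) / 2) < 1 / 2 * f x + (1 - 1 / 2) * f y" unfolding m .
    moreover have "f z = f a + s * (z - a)" if "a < z" "z < d" for z
      using zero[OF that] by (simp add: e_def)
    from this[of x] this[of y] this[of "(x + y) / 2"]
    have "f ((x + y) / 2) = 1 / 2 * f x + (1 - 1 / 2) * f y" using x y by (simp add: algebra_simps add_divide_distrib)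
    ultimately show False by simp
  qed
qed

text \<open>Quadratic decay bounds the periodisation uniformly, whatever the position relative to
  the period.\<close>

locale decaying_kernel =
  fixes k :: "real \<Rightarrow> real" and C :: real
  assumes k_nonneg: "0 \<le> k t" and k_even: "k (- t) = k t" and k_bound: "k t \<le> C / (1 + t\<^sup>2)"
begin

lemma C_nonneg: "0 \<le> C"
  using k_nonneg[of 0] k_bound[of 0] by simp

lemma k_lim: "(k \<longlongrightarrow> 0) at_top"
proof (rule tendsto_sandwich[OF _ _ tendsto_const])
  show "eventually (\<lambda>t. k t \<le> C / t) at_top"
  proof (rule eventually_at_top_linorderI[of 1])
    fix t :: real assume t: "1 \<le> t"
    have "k t \<le> C / (1 + t\<^sup>2)" by (rule k_bound)
    also have "\<dots> \<le> C / t"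
    proof (rule divide_left_mono)
      have "t * 1 \<le> t * t" using t by (intro mult_left_mono) auto
      then show "t \<le> 1 + t\<^sup>2" by (simp add: power2_eq_square)
      show "0 < (1 + t\<^sup>2) * t" using t by (intro mult_pos_pos) (auto simp: add_pos_nonneg)
    qed (rule C_nonneg)
    finally show "k t \<le> C / t" .
  qed
  show "((\<lambda>t. C / t) \<longlongrightarrow> 0) at_top"
    by (rule real_tendsto_divide_at_top[OF tendsto_const filterlim_ident])
qed (use k_nonneg in auto)

lemma periodise_pairs:
  "periodise k t = (\<Sum>n. ennreal (k (2 * pi * real n + t) + k (2 * pi * (real n + 1) - t)))"
proof -
  have "k (t + 2 * pi * of_int (- int n - 1)) = k (2 * pi * (real n + 1) - t)" for n
    using k_even[of "2 * pi * (real n + 1) - t"] by (simp add: algebra_simps)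
  then show ?thesis
    unfolding periodise_def nn_integral_int_pairs
    by (simp add: k_nonneg ennreal_plus[symmetric] add.commute[of t] del: ennreal_plus)
qed

lemma periodic_periodise: "periodic (periodise k)"
  unfolding periodic_def periodise_def
proof
  fix t
  show "(\<integral>\<^sup>+m. ennreal (k (t + 2 * pi + 2 * pi * of_int m)) \<partial>count_space (UNIV :: int set)) =
    (\<integral>\<^sup>+m. ennreal (k (t + 2 * pi * of_int m)) \<partial>count_space (UNIV :: int set))"
    using nn_integral_int_shift[of "\<lambda>m. ennreal (k (t + 2 * pi * of_int m))" 1]
    by (simp add: algebra_simps)
qed

lemma periodise_even: "periodise k (- t) = periodise k t"
proof -
  have "k (- t + 2 * pi * of_int m) = k (t + 2 * pi * of_int (- m))" for m
    using k_even[of "t + 2 * pi * of_int (- m)"] by simp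
  then show ?thesis
    unfolding periodise_def
    using nn_integral_int_uminus[of "\<lambda>m. ennreal (k (t + 2 * pi * of_int m))"] by simp
qed

lemma periodise_fold: "periodise k t = periodise k \<bar>wrap t\<bar>"
  using periodic_wrap_eq[OF periodic_periodise, of t] periodise_even[of "wrap t"]
  by (cases "0 \<le> wrap t") auto

definition total_bound :: real where
  "total_bound = (\<Sum>n. 4 * C * (1 / (real n + 1)\<^sup>2))"

lemma summable_squares: "summable (\<lambda>n. 4 * C * (1 / (real n + 1)\<^sup>2))"
  using sums_summable[OF inverse_squares_sums] by (intro summable_mult) (simp add: add.commute)

lemma total_bound_nonneg: "0 \<le> total_bound"
  unfolding total_bound_def using C_nonneg by (intro suminf_nonneg summable_squares) auto

lemma periodise_le: "periodise k t \<le> ennreal total_bound"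
proof -
  let ?t = "\<bar>wrap t\<bar>"
  have t: "0 \<le> ?t" "?t \<le> pi" by (rule fold_bounds)+
  have le: "k x \<le> 2 * C * (1 / (real n + 1)\<^sup>2)" if "real n \<le> x" for n x
  proof -
    have "(real n + 1)\<^sup>2 \<le> 2 * (1 + (real n)\<^sup>2)"
      using zero_le_power2[of "real n - 1"] by (simp add: power2_eq_square algebra_simps)
    also have "\<dots> \<le> 2 * (1 + x\<^sup>2)" using that by simp
    finally have *: "(real n + 1)\<^sup>2 / 2 \<le> 1 + x\<^sup>2" by simp
    have "k x \<le> C / (1 + x\<^sup>2)" by (rule k_bound)
    also have "\<dots> \<le> C / ((real n + 1)\<^sup>2 / 2)"
      using * C_nonneg by (intro divide_left_mono) (auto simp: add_pos_nonneg)
    finally show ?thesis by (simp add: mult.commute)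
  qed
  have "periodise k t = (\<Sum>n. ennreal (k (2 * pi * real n + ?t) + k (2 * pi * (real n + 1) - ?t)))"
    by (subst periodise_fold) (rule periodise_pairs)
  also have "\<dots> \<le> (\<Sum>n. ennreal (4 * C * (1 / (real n + 1)\<^sup>2)))"
  proof (intro suminf_le ennreal_leI summableI)
    fix n
    have p: "1 * real n \<le> pi * real n" using pi_gt3 by (intro mult_right_mono) auto
    have "real n \<le> 2 * pi * real n + ?t" using p t by linarith
    moreover have "real n \<le> 2 * pi * (real n + 1) - ?t" using p t by (simp add: algebra_simps)
    ultimately have "k (2 * pi * real n + ?t) \<le> 2 * C * (1 / (real n + 1)\<^sup>2)"
      "k (2 * pi * (real n + 1) - ?t) \<le> 2 * C * (1 / (real n + 1)\<^sup>2)" using le by blast+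
    then show "k (2 * pi * real n + ?t) + k (2 * pi * (real n + 1) - ?t) \<le> 4 * C * (1 / (real n + 1)\<^sup>2)"
      by linarith
  qed
  also have "\<dots> = ennreal total_bound"
    unfolding total_bound_def using C_nonneg by (intro suminf_ennreal2 summable_squares) auto
  finally show ?thesis .
qed

text \<open>Composition with \<open>exp\<close> turns the half line part into a monotone function on
  the line; evenness and the single value at 0 supply the rest. Slices of a Lebesgue measurable
  kernel become Borel measurable this way.\<close>

lemma antimono_measurable:
  assumes anti: "\<And>s t. 0 < s \<Longrightarrow> s \<le> t \<Longrightarrow> k t \<le> k s"
  shows "k \<in> borel_measurable borel"
proof -
  have "mono (\<lambda>x. - k (exp x))" by (intro monoI) (simp add: anti)
  then have "(\<lambda>x. - k (exp x)) \<in> borel_measurable borel" by (rule borel_measurable_mono)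
  then have [measurable]: "(\<lambda>x. k (exp x)) \<in> borel_measurable borel"
    using borel_measurable_uminus[of "\<lambda>x. - k (exp x)" borel] by simp
  have "k = (\<lambda>x. if x = 0 then k 0 else (\<lambda>x. k (exp x)) (ln \<bar>x\<bar>))"
    using k_even by (auto simp: fun_eq_iff abs_if)
  also have "\<dots> \<in> borel_measurable borel" by measurable
  finally show ?thesis .
qed

text \<open>If \<open>k s < k t\<close>, decay provides a later \<open>u\<close> with
  \<open>k u < k t\<close>, and the graph at \<open>t\<close> would lie above the chord from
  \<open>s\<close> to \<open>u\<close>.\<close>

lemma convex_antimono:
  assumes conv: "convex_on {0<..} k" and st: "0 < s" "s \<le> t"
  shows "k t \<le> k s"
proof (rule ccontr)
  assume "\<not> ?thesis"
  then have lt: "k s < k t" by simp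
  with st have s_t: "s < t" by (cases "s = t") auto
  have ev: "eventually (\<lambda>u. k u < k t) at_top"
    by (rule order_tendstoD[OF k_lim]) (use lt k_nonneg[of s] in linarith)
  obtain u where u: "t < u" "k u < k t"
    using eventually_conj[OF ev eventually_gt_at_top[of t]] eventually_happens'[of at_top] trivial_limit_at_top_linorder by blast
  define r where "r = (t - s) / (u - s)"
  have r: "0 \<le> r" "r \<le> 1" using s_t u by (simp_all add: r_def field_simps)
  have "r * (u - s) = t - s" using s_t u by (simp add: r_def)
  then have "t = (1 - r) * s + r * u" by (simp add: algebra_simps)
  then have "k t \<le> (1 - r) * k s + r * k u"
    using convex_onD[OF conv r, of s u] st s_t u by simp
  also have "\<dots> \<le> max (k s) (k u)" using r by (intro convex_bound_le) auto
  finally show False using lt u by simp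
qed

lemma cm_function_slice:
  assumes "kernel_cond2 k"
  shows "cm_function (\<lambda>\<tau>. k (sqrt \<tau>)) C"
proof
  show "completely_monotonic (\<lambda>\<tau>. k (sqrt \<tau>))" using assms by (simp add: kernel_cond2_def)
  show "((\<lambda>\<tau>. k (sqrt \<tau>)) \<longlongrightarrow> 0) at_top"
    by (rule filterlim_compose[OF k_lim sqrt_at_top])
  show "k (sqrt t) \<le> C" if "0 < t" for t
  proof -
    have "C / (1 + t) \<le> C / 1" using that C_nonneg by (intro divide_left_mono) auto
    then show ?thesis using k_bound[of "sqrt t"] that by simp
  qed
qed

lemma cm_antimono:
  assumes "kernel_cond2 k" "0 < s" "s \<le> t"
  shows "k t \<le> k s"
  using cm_function.f_antimono[OF cm_function_slice[OF assms(1)], of "s\<^sup>2" "t\<^sup>2"] assms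
  by (simp add: power_mono)

lemma cond3_antimono:
  assumes "kernel_cond3 k" "0 < s" "s \<le> t"
  shows "k t \<le> k s"
proof (cases "t < pi")
  case True
  then show ?thesis using assms unfolding kernel_cond3_def
    by (auto simp: monotone_on_def)
next
  case False
  then show ?thesis using assms k_nonneg[of s] by (simp add: kernel_cond3_def)
qed

lemma antimono:
  assumes "kernel_cond1 k \<or> kernel_cond2 k \<or> kernel_cond3 k" "0 < s" "s \<le> t"
  shows "k t \<le> k s"
  using assms convex_antimono cm_antimono cond3_antimono unfolding kernel_cond1_def by blast

section \<open>Monotonicity of the periodised kernel under each condition\<close>

lemma pairs_less:
  assumes le: "\<And>n. k (2 * pi * real n + t2) + k (2 * pi * (real n + 1) - t2) \<le> k (2 * pi * real n + t1) + k (2 * pi * (real n + 1) - t1)"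
  shows "periodise k t2 \<le> periodise k t1"
    and "k (2 * pi * real j + t2) + k (2 * pi * (real j + 1) - t2) < k (2 * pi * real j + t1) + k (2 * pi * (real j + 1) - t1)
      \<Longrightarrow> periodise k t2 < periodise k t1"
proof -
  show "periodise k t2 \<le> periodise k t1"
    unfolding periodise_pairs by (intro suminf_le ennreal_leI summableI le)
  assume lt: "k (2 * pi * real j + t2) + k (2 * pi * (real j + 1) - t2) < k (2 * pi * real j + t1) + k (2 * pi * (real j + 1) - t1)"
  have "(\<integral>\<^sup>+n. ennreal (k (2 * pi * real n + t2) + k (2 * pi * (real n + 1) - t2)) \<partial>count_space UNIV)
     < (\<integral>\<^sup>+n. ennreal (k (2 * pi * real n + t1) + k (2 * pi * (real n + 1) - t1)) \<partial>count_space UNIV)"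
  proof (rule nn_integral_less)
    have "periodise k t2 < \<infinity>" using periodise_le[of t2] by (rule order_le_less_trans) simp
    then show "(\<integral>\<^sup>+n. ennreal (k (2 * pi * real n + t2) + k (2 * pi * (real n + 1) - t2)) \<partial>count_space UNIV) \<noteq> \<infinity>"
      unfolding nn_integral_count_space_nat periodise_pairs by simp
    show "\<not> (AE n in count_space UNIV. ennreal (k (2 * pi * real n + t1) + k (2 * pi * (real n + 1) - t1))
      \<le> ennreal (k (2 * pi * real n + t2) + k (2 * pi * (real n + 1) - t2)))"
      using lt k_nonneg by (auto simp: AE_count_space ennreal_le_iff add_nonneg_nonneg not_le simp del: ennreal_plus intro!: exI[of _ j])
  qed (auto intro!: ennreal_leI le simp del: ennreal_plus)
  then show "periodise k t2 < periodise k t1"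
    unfolding nn_integral_count_space_nat periodise_pairs .
qed

text \<open>In the \<open>n\<close>-th summand both pairs of arguments are symmetric about
  \<open>2 * pi * n + pi\<close>, and the pair for \<open>t1\<close> is farther apart, so convexity
  compares the sums term by term.\<close>

lemma convex_periodise:
  assumes t: "0 < t1" "t1 < t2" "t2 < pi" and conv: "convex_on {0<..} k"
  shows "periodise k t2 \<le> periodise k t1"
    and "0 \<le> c \<Longrightarrow> strictly_convex_on {c<..<c + 2 * pi} k \<Longrightarrow> periodise k t2 < periodise k t1"
proof -
  let ?a = "\<lambda>n. 2 * pi * real n + t1" and ?b = "\<lambda>n. 2 * pi * real n + t2"
  let ?d = "\<lambda>n. 2 * pi * (real n + 1) - t1" and ?c = "\<lambda>n. 2 * pi * (real n + 1) - t2"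
  have pair: "0 < ?a n" "?a n < ?b n" "?a n + ?d n = ?b n + ?c n" "?a n < ?c n" for n
  proof -
    have q: "2 * pi * (real n + 1) = 2 * pi * real n + 2 * pi" "0 \<le> 2 * pi * real n" by (simp_all add: algebra_simps)
    show "0 < ?a n" "?a n < ?b n" "?a n + ?d n = ?b n + ?c n" "?a n < ?c n"
      unfolding q(1) using q(2) t by linarith+
  qed
  have le: "k (?b n) + k (?c n) \<le> k (?a n) + k (?d n)" for n
    by (rule convex_symmetric_pair(1)[OF conv pair])
  show "periodise k t2 \<le> periodise k t1" by (rule pairs_less(1)[OF le])
  assume c: "0 \<le> c" and strict: "strictly_convex_on {c<..<c + 2 * pi} k"
  \<comment> \<open>A window of full period length meets one of the intervals from
    \<open>2 * pi * j + t1\<close> to \<open>2 * pi * (j + 1) - t1\<close>: that of the period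
    containing \<open>c\<close>, or the next one.\<close>
  have "\<exists>j. max (?a j) c < min (?d j) (c + 2 * pi)"
  proof -
    define n where "n = nat \<lfloor>c / (2 * pi)\<rfloor>"
    have "real n \<le> c / (2 * pi)" "c / (2 * pi) < real n + 1"
      using c by (simp_all add: n_def)
    then have n: "2 * pi * real n \<le> c" "c < 2 * pi * (real n + 1)"
      by (simp_all add: field_simps)
    show ?thesis
    proof (cases "c < ?d n")
      case True
      then show ?thesis using n t by (intro exI[of _ n]) (auto simp: algebra_simps)
    next
      case False
      then show ?thesis using n t by (intro exI[of _ "Suc n"]) (auto simp: algebra_simps)
    qed
  qed
  then obtain j where j: "max (?a j) c < min (?d j) (c + 2 * pi)" by blast
  show "periodise k t2 < periodise k t1"
    by (rule pairs_less(2)[OF le convex_symmetric_pair(2)[OF conv pair strict j]])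
qed

text \<open>All other arguments in the paired sum are at least \<open>pi\<close>, where the kernel
  vanishes.\<close>

lemma cond3_periodise:
  assumes t: "0 < t" "t < pi" and zero: "\<forall>t\<ge>pi. k t = 0"
  shows "periodise k t = ennreal (k t)"
proof -
  have p: "pi \<le> 2 * pi * (real n + 1) - t" for n
  proof -
    have "2 * pi * 1 \<le> 2 * pi * (real n + 1)" by (intro mult_left_mono) auto
    then show ?thesis using t by linarith
  qed
  have q: "pi \<le> 2 * pi * real n + t" if "n \<noteq> 0" for n
  proof -
    have "2 * pi * 1 \<le> 2 * pi * real n" using that by (intro mult_left_mono) auto
    then show ?thesis using t pi_gt_zero by linarith
  qed
  have "ennreal (k (2 * pi * real n + t) + k (2 * pi * (real n + 1) - t)) = (if n \<in> {0} then ennreal (k t) else 0)" for n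
    using zero p[of n] q[of n] by auto
  then have "periodise k t = (\<Sum>n. if n \<in> {0} then ennreal (k t) else 0)" unfolding periodise_pairs by simp
  also have "\<dots> = ennreal (k t)" by (subst suminf_finite[of "{0}"]) auto
  finally show ?thesis .
qed

lemma clamp_powr_theta:
  assumes "0 < v" "v < 1"
  shows "(\<integral>\<^sup>+m. ennreal (clamp_powr ((t + 2 * pi * of_int m)\<^sup>2) v) \<partial>count_space (UNIV :: int set)) = ennreal (theta (- ln v) t)"
proof -
  have "clamp_powr \<tau> v = exp (- (- ln v) * \<tau>)" for \<tau>
    using assms by (simp add: clamp_powr_def powr_def mult.commute)
  then show ?thesis using theta_ennreal[of "- ln v" t] assms by (simp add: ln_less_zero)
qed

text \<open>Bernstein's measure writes the periodisation as a mixture of periodised Gaussians with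
  \<open>l = - ln v\<close>. The ranges \<open>v \<le> 0\<close> and \<open>v \<ge> 1\<close> give
  the values 0 and infinity, both independent of \<open>t\<close>.\<close>

lemma cm_periodise:
  assumes cm: "kernel_cond2 k"
  shows "0 < t1 \<Longrightarrow> t1 < t2 \<Longrightarrow> t2 < pi \<Longrightarrow> periodise k t2 \<le> periodise k t1" (is "?P1 \<Longrightarrow> ?P2 \<Longrightarrow> ?P3 \<Longrightarrow> _")
    and "0 < t1 \<Longrightarrow> t1 < t2 \<Longrightarrow> t2 < pi \<Longrightarrow> \<exists>\<tau>>0. k (sqrt \<tau>) \<noteq> 0 \<Longrightarrow> periodise k t2 < periodise k t1"
proof -
  assume t: ?P1 ?P2 ?P3
  obtain c M where c: "0 \<le> c" and M: "real_distribution M"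
    and rep: "\<And>\<tau>. 0 < \<tau> \<Longrightarrow> k (sqrt \<tau>) = c * (LINT v|M. clamp_powr \<tau> v)"
    using cm_function.Bernstein[OF cm_function_slice[OF cm]] by blast
  interpret M: real_distribution M by (rule M)
  have int: "integrable M (clamp_powr \<tau>)" if "0 < \<tau>" for \<tau>
    by (rule M.integrable_const_bound[where B=1]) (use clamp_powr_bounds[of \<tau>] that in auto)
  have rep2: "ennreal (k x) = ennreal c * (\<integral>\<^sup>+v. ennreal (clamp_powr (x\<^sup>2) v) \<partial>M)" if "x \<noteq> 0" for x
  proof -
    have "k x = k (sqrt (x\<^sup>2))" using k_even[of x] by (simp add: abs_if)
    also have "\<dots> = c * (LINT v|M. clamp_powr (x\<^sup>2) v)" using that by (intro rep) simp
    finally have "ennreal (k x) = ennreal c * ennreal (LINT v|M. clamp_powr (x\<^sup>2) v)"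
      using c clamp_powr_bounds(1) by (simp add: ennreal_mult integral_nonneg_AE)
    also have "ennreal (LINT v|M. clamp_powr (x\<^sup>2) v) = (\<integral>\<^sup>+v. ennreal (clamp_powr (x\<^sup>2) v) \<partial>M)"
      using that by (intro nn_integral_eq_integral[symmetric] int) (auto simp: clamp_powr_bounds)
    finally show ?thesis .
  qed
  define \<Theta> where "\<Theta> t v = (\<integral>\<^sup>+m. ennreal (clamp_powr ((t + 2 * pi * of_int m)\<^sup>2) v) \<partial>count_space (UNIV :: int set))" for t v
  have \<Theta>m [measurable]: "\<Theta> t \<in> borel_measurable M" for t
    unfolding \<Theta>_def[abs_def] by measurable
  have per: "periodise k t = ennreal c * (\<integral>\<^sup>+v. \<Theta> t v \<partial>M)" if "0 < t" "t < pi" for t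
  proof -
    have ne: "t + 2 * pi * of_int m \<noteq> 0" for m :: int
    proof
      assume "t + 2 * pi * of_int m = 0"
      then have "sin (t / 2 + pi * of_int m) = 0" by (simp add: field_simps)
      then show False
        using that sin_gt_zero[of "t / 2"] by (auto simp: sin_add sin_zero_iff_int2 mult.commute cos_int_times_real split: if_splits)
    qed
    have "periodise k t = (\<integral>\<^sup>+m. ennreal c * (\<integral>\<^sup>+v. ennreal (clamp_powr ((t + 2 * pi * of_int m)\<^sup>2) v) \<partial>M) \<partial>count_space (UNIV :: int set))"
      unfolding periodise_def by (intro nn_integral_cong rep2 ne)
    also have "\<dots> = ennreal c * (\<integral>\<^sup>+m. (\<integral>\<^sup>+v. ennreal (clamp_powr ((t + 2 * pi * of_int m)\<^sup>2) v) \<partial>M) \<partial>count_space (UNIV :: int set))"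
      by (rule nn_integral_cmult) simp
    also have "\<dots> = ennreal c * (\<integral>\<^sup>+v. \<Theta> t v \<partial>M)"
      unfolding \<Theta>_def by (subst nn_integral_count_space_nn_integral) auto
    finally show ?thesis .
  qed
  have c21: "cos t2 < cos t1" using t by (intro cos_monotone_0_pi) auto
  have le: "\<Theta> t2 v \<le> \<Theta> t1 v" for v
  proof -
    consider "v \<le> 0" | "0 < v" "v < 1" | "1 \<le> v" by linarith
    then show ?thesis
    proof cases
      case 1
      then have "clamp_powr \<tau> v = 0" for \<tau> by (simp add: clamp_powr_def)
      then show ?thesis by (simp add: \<Theta>_def)
    next
      case 2
      then show ?thesis unfolding \<Theta>_def clamp_powr_theta[OF 2]
        using c21 by (intro ennreal_leI theta_mono) (auto simp: ln_less_zero)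
    next
      case 3
      then have "clamp_powr \<tau> v = 1" for \<tau> by (simp add: clamp_powr_def)
      then show ?thesis by (simp add: \<Theta>_def)
    qed
  qed
  have t': "0 < t2" "t1 < pi" using t by auto
  show "periodise k t2 \<le> periodise k t1"
    unfolding per[OF t(1) t'(2)] per[OF t'(1) t(3)] by (intro mult_left_mono nn_integral_mono le) simp
  assume "\<exists>\<tau>>0. k (sqrt \<tau>) \<noteq> 0"
  then obtain \<tau>0 where \<tau>0: "0 < \<tau>0" "k (sqrt \<tau>0) \<noteq> 0" by blast
  have cpos: "0 < c" using c \<tau>0 rep[OF \<tau>0(1)] by (cases "c = 0") auto
  have "(\<integral>\<^sup>+v. \<Theta> t2 v \<partial>M) < (\<integral>\<^sup>+v. \<Theta> t1 v \<partial>M)"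
  proof (rule nn_integral_less)
    have "periodise k t2 < \<infinity>" using periodise_le[of t2] by (rule order_le_less_trans) simp
    then show "(\<integral>\<^sup>+v. \<Theta> t2 v \<partial>M) \<noteq> \<infinity>"
      unfolding per[OF t'(1) t(3)] using cpos by (auto simp: ennreal_mult_eq_top_iff ennreal_mult_top)
    show "\<not> (AE v in M. \<Theta> t1 v \<le> \<Theta> t2 v)"
    proof
      assume "AE v in M. \<Theta> t1 v \<le> \<Theta> t2 v"
      \<comment> \<open>Without a strict gain, \<open>M\<close> lives where
        \<open>clamp_powr\<close> does not depend on \<open>\<tau>\<close>; then \<open>k\<close> is
        constant on the half line, and decay makes it zero.\<close>
      then have out: "AE v in M. \<not> (0 < v \<and> v < 1)"
      proof eventually_elim
        case (elim v)
        show ?case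
        proof
          assume v: "0 < v \<and> v < 1"
          then have "theta (- ln v) t2 < theta (- ln v) t1"
            using c21 by (intro theta_strict) (auto simp: ln_less_zero)
          moreover have "0 \<le> theta (- ln v) t2" using v by (intro theta_nonneg) (auto simp: ln_less_zero)
          ultimately show False using elim v unfolding \<Theta>_def
            by (simp add: clamp_powr_theta ennreal_le_iff)
        qed
      qed
      have const: "k (sqrt \<tau>) = k (sqrt \<tau>0)" if "0 < \<tau>" for \<tau>
      proof -
        have "(LINT v|M. clamp_powr \<tau> v) = (LINT v|M. clamp_powr \<tau>0 v)"
          by (rule integral_cong_AE, measurable, rule AE_mp[OF out], rule AE_I2)
            (auto simp: clamp_powr_def not_less max_def min_def)
        then show ?thesis using rep[OF that] rep[OF \<tau>0(1)] by simp
      qed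
      have "((\<lambda>\<tau>. k (sqrt \<tau>)) \<longlongrightarrow> k (sqrt \<tau>0)) at_top"
        by (rule Lim_transform_eventually[OF tendsto_const]) (auto intro!: eventually_at_top_linorderI[of 1] const[symmetric])
      moreover have "((\<lambda>\<tau>. k (sqrt \<tau>)) \<longlongrightarrow> 0) at_top"
        by (rule filterlim_compose[OF k_lim sqrt_at_top])
      ultimately have "k (sqrt \<tau>0) = 0" using tendsto_unique[OF trivial_limit_at_top_linorder] by blast
      with \<tau>0 show False by simp
    qed
  qed (auto simp: le)
  then show "periodise k t2 < periodise k t1"
    unfolding per[OF t(1) t'(2)] per[OF t'(1) t(3)] using cpos by (intro ennreal_mult_strict_left_mono) auto
qed

lemma fold_generic: "sin t \<noteq> 0 \<Longrightarrow> 0 < \<bar>wrap t\<bar> \<and> \<bar>wrap t\<bar> < pi"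
proof -
  assume "sin t \<noteq> 0"
  then have "sin (wrap t) \<noteq> 0" by (simp add: periodic_wrap_eq[OF periodic_sin])
  then have "wrap t \<noteq> 0" "wrap t \<noteq> - pi" by auto
  then show ?thesis using wrap_bounds[of t] by auto
qed

lemma fold_less: "cos s < cos t \<Longrightarrow> \<bar>wrap t\<bar> < \<bar>wrap s\<bar>"
  using fold_mono[of t s] fold_mono[of s t] cos_fold[of s] cos_fold[of t]
  by (cases "\<bar>wrap t\<bar> = \<bar>wrap s\<bar>") auto

lemma circ_kernel_periodise:
  assumes cond: "kernel_cond1 k \<or> kernel_cond2 k \<or> kernel_cond3 k"
  shows "circ_kernel (periodise k) total_bound"
proof
  have [measurable]: "k \<in> borel_measurable borel" using antimono_measurable antimono[OF cond] by blast
  show "periodise k \<in> borel_measurable borel" unfolding periodise_def[abs_def] by measurable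
  show "periodise k s \<le> periodise k t" if c: "cos s < cos t" and st: "sin s \<noteq> 0" "sin t \<noteq> 0" for s t
  proof -
    have t: "0 < \<bar>wrap t\<bar>" "\<bar>wrap t\<bar> < \<bar>wrap s\<bar>" "\<bar>wrap s\<bar> < pi"
      using fold_generic st fold_less[OF c] by auto
    have "periodise k \<bar>wrap s\<bar> \<le> periodise k \<bar>wrap t\<bar>"
      using cond
    proof (elim disjE)
      assume "kernel_cond1 k"
      then show ?thesis using convex_periodise(1)[OF t] by (simp add: kernel_cond1_def)
    next
      assume "kernel_cond2 k"
      then show ?thesis by (rule cm_periodise(1)[OF _ t])
    next
      assume k3: "kernel_cond3 k"
      then have z: "\<forall>t\<ge>pi. k t = 0" by (simp add: kernel_cond3_def)
      show ?thesis
        using cond3_periodise[OF t(1) _ z] cond3_periodise[OF _ t(3) z] t cond3_antimono[OF k3 t(1)]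
        by (auto intro: ennreal_leI)
    qed
    then show ?thesis using periodise_fold[of s] periodise_fold[of t] by simp
  qed
qed (auto simp: periodic_periodise periodise_even periodise_le total_bound_nonneg)

lemma strict_circ_kernel_periodise:
  assumes cond: "kernel_cond1_strict k \<or> kernel_cond2_strict k \<or> kernel_cond3_strict k"
  shows "strict_circ_kernel (periodise k) total_bound"
proof -
  have sa: "strict_antimono_on {0<..<pi} k \<Longrightarrow> antimono_on {0<..<pi} k"
    by (auto simp: monotone_on_def order_le_less)
  have cond': "kernel_cond1 k \<or> kernel_cond2 k \<or> kernel_cond3 k"
    using cond sa unfolding kernel_cond1_strict_def kernel_cond1_def kernel_cond2_strict_def
      kernel_cond3_strict_def kernel_cond3_def by blast
  interpret circ_kernel "periodise k" total_bound by (rule circ_kernel_periodise[OF cond'])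
  show ?thesis
  proof
    fix s t :: real assume c: "cos s < cos t" and st: "sin s \<noteq> 0" "sin t \<noteq> 0"
    have t: "0 < \<bar>wrap t\<bar>" "\<bar>wrap t\<bar> < \<bar>wrap s\<bar>" "\<bar>wrap s\<bar> < pi"
      using fold_generic st fold_less[OF c] by auto
    have "periodise k \<bar>wrap s\<bar> < periodise k \<bar>wrap t\<bar>"
      using cond
    proof (elim disjE)
      assume "kernel_cond1_strict k"
      then show ?thesis using convex_periodise(2)[OF t] by (auto simp: kernel_cond1_strict_def)
    next
      assume "kernel_cond2_strict k"
      then show ?thesis using cm_periodise(2)[OF _ t] by (simp add: kernel_cond2_strict_def)
    next
      assume k3: "kernel_cond3_strict k"
      then have z: "\<forall>t\<ge>pi. k t = 0" by (simp add: kernel_cond3_strict_def)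
      have "k \<bar>wrap s\<bar> < k \<bar>wrap t\<bar>"
        using k3 t unfolding kernel_cond3_strict_def monotone_on_def by auto
      then show ?thesis
        using cond3_periodise[OF t(1) _ z] cond3_periodise[OF _ t(3) z] t k_nonneg
        by (auto intro: ennreal_lessI simp: ennreal_less_iff)
    qed
    then show "periodise k s < periodise k t" using periodise_fold[of s] periodise_fold[of t] by simp
  qed
qed

end

section \<open>Slicing the perimeter\<close>

context circ_kernel
begin

lemma riesz_Compl:
  assumes "pset A" "pset B"
  shows "riesz G A B + riesz G A (- B) = emeasure circ A * (\<integral>\<^sup>+y. G y \<partial>circ)"
proof -
  have [measurable]: "A \<in> sets borel" "B \<in> sets borel" using assms by (auto simp: pset_def)
  have "riesz G A B + riesz G A (- B) = (\<integral>\<^sup>+x. (\<integral>\<^sup>+y. indicator A x * indicator B y * G (x - y) \<partial>circ)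
      + (\<integral>\<^sup>+y. indicator A x * indicator (- B) y * G (x - y) \<partial>circ) \<partial>circ)"
    unfolding riesz_def by (simp add: nn_integral_add)
  also have "\<dots> = (\<integral>\<^sup>+x. indicator A x * (\<integral>\<^sup>+y. G y \<partial>circ) \<partial>circ)"
  proof (rule nn_integral_cong)
    fix x
    have "(\<integral>\<^sup>+y. indicator A x * indicator B y * G (x - y) \<partial>circ) + (\<integral>\<^sup>+y. indicator A x * indicator (- B) y * G (x - y) \<partial>circ)
      = (\<integral>\<^sup>+y. indicator A x * indicator B y * G (x - y) + indicator A x * indicator (- B) y * G (x - y) \<partial>circ)"
      by (simp add: nn_integral_add)
    also have "\<dots> = (\<integral>\<^sup>+y. indicator A x * G (x - y) \<partial>circ)"
      by (intro nn_integral_cong) (auto split: split_indicator)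
    also have "\<dots> = indicator A x * (\<integral>\<^sup>+y. G (x - y) \<partial>circ)" by (rule nn_integral_cmult) measurable
    also have "(\<integral>\<^sup>+y. G (x - y) \<partial>circ) = (\<integral>\<^sup>+y. G y \<partial>circ)"
      by (rule nn_integral_circ_reflect[OF G_meas G_periodic])
    finally show "(\<integral>\<^sup>+y. indicator A x * indicator B y * G (x - y) \<partial>circ) + (\<integral>\<^sup>+y. indicator A x * indicator (- B) y * G (x - y) \<partial>circ)
      = indicator A x * (\<integral>\<^sup>+y. G y \<partial>circ)" .
  qed
  also have "\<dots> = emeasure circ A * (\<integral>\<^sup>+y. G y \<partial>circ)"
    by (subst nn_integral_multc) auto
  finally show ?thesis .
qed

text \<open>By \<open>riesz_Compl\<close> a larger overlap with \<open>B\<close> is a smaller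
  interaction with its complement; finiteness permits the subtraction.\<close>

lemma riesz_Compl_rearrangement:
  assumes A: "pset A" and B: "pset B"
  defines "R \<equiv> circ_arc 0 (measure circ A)" and "S \<equiv> circ_arc 0 (measure circ B)"
  shows "riesz G R (- S) \<le> riesz G A (- B)"
    and "riesz G R (- S) = riesz G A (- B) \<Longrightarrow> riesz G A B = riesz G R S"
proof -
  have mR: "emeasure circ R = emeasure circ A"
    unfolding R_def by (simp add: circ.emeasure_eq_measure measure_arc measure_circ_le)
  have eq: "riesz G R S + riesz G R (- S) = riesz G A B + riesz G A (- B)"
    using riesz_Compl[OF A B] riesz_Compl[OF pset_arc pset_arc, of 0 "measure circ A" 0 "measure circ B"]
    unfolding R_def[symmetric] S_def[symmetric] mR by simp
  have le: "riesz G A B \<le> riesz G R S" unfolding R_def S_def by (rule riesz_rearrangement[OF A B])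
  show "riesz G R (- S) \<le> riesz G A (- B)"
  proof (rule ccontr)
    assume "\<not> ?thesis"
    then have "riesz G A (- B) < riesz G R (- S)" by simp
    then have "riesz G A B + riesz G A (- B) < riesz G A B + riesz G R (- S)"
      using riesz_finite[of A B] by (simp add: ennreal_add_left_cancel_less less_top[symmetric])
    also have "\<dots> \<le> riesz G R S + riesz G R (- S)" using le by (rule add_right_mono)
    finally show False using eq by simp
  qed
  assume "riesz G R (- S) = riesz G A (- B)"
  then show "riesz G A B = riesz G R S"
    using eq riesz_finite[of A "- B"] ennreal_add_left_cancel[of "riesz G A (- B)" "riesz G A B" "riesz G R S"]
    by (auto simp: add.commute)
qed

lemma riesz_shift:
  assumes A: "pset A" and B: "pset B"
  shows "riesz G {x. x - c \<in> A} {x. x - c \<in> B} = riesz G A B"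
proof -
  have [measurable]: "A \<in> sets borel" "B \<in> sets borel" using assms by (auto simp: pset_def)
  define \<phi> where "\<phi> x = (\<integral>\<^sup>+y. indicator B y * G (x - y) \<partial>circ)" for x
  have [measurable]: "\<phi> \<in> borel_measurable borel" unfolding \<phi>_def by measurable
  have G_shift: "G (x + 2 * pi - y) = G (x - y)" for x y
    using G_periodic unfolding periodic_def by (metis add_diff_eq diff_add_eq)
  have per: "periodic \<phi>" unfolding periodic_def \<phi>_def G_shift by simp
  have ind: "indicator {x. x - c \<in> X} x = (indicator X (x - c) :: ennreal)" for X x
    by (simp split: split_indicator)
  have sh: "(\<integral>\<^sup>+y. indicator B (y - c) * G (x - y) \<partial>circ) = \<phi> (x - c)" for x
  proof -
    have "periodic (\<lambda>y. indicator B y * G (x - c - y))"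
      by (rule periodic_comp2[OF pset_indicator[OF B] periodic_cong_reflect[OF G_periodic]])
    from nn_integral_circ_shift[OF _ this, of "- c"] show ?thesis unfolding \<phi>_def by simp
  qed
  have "riesz G {x. x - c \<in> A} {x. x - c \<in> B} = (\<integral>\<^sup>+x. indicator A (x - c) * \<phi> (x - c) \<partial>circ)"
    unfolding riesz_def ind by (simp add: mult.assoc nn_integral_cmult sh)
  also have "\<dots> = (\<integral>\<^sup>+x. indicator A x * \<phi> x \<partial>circ)"
    using nn_integral_circ_shift[of "\<lambda>x. indicator A x * \<phi> x" "- c"] periodic_comp2[where h="(*)", OF pset_indicator[OF A] per]
    by simp
  also have "\<dots> = riesz G A B"
    unfolding riesz_def \<phi>_def by (simp add: mult.assoc nn_integral_cmult)
  finally show ?thesis .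
qed

lemma riesz_arc_shift: "riesz G (circ_arc c m) (- circ_arc c m') = riesz G (circ_arc 0 m) (- circ_arc 0 m')"
  using riesz_shift[OF pset_arc pset_Compl[OF pset_arc], of c 0 m 0 m'] by (simp add: circ_arc_def Compl_eq)

end

text \<open>Only \<open>s\<close> is confined to one period. Unfolding \<open>t\<close> leaves the
  periodic set \<open>B\<close> unchanged and periodises the kernel.\<close>

lemma riesz_strip:
  assumes A: "pset A" and B: "pset B" and [measurable]: "k \<in> borel_measurable borel"
  shows "(\<integral>\<^sup>+s. \<integral>\<^sup>+t. indicator {- pi..<pi} s * indicator A s * indicator B t * ennreal (k (s - t)) \<partial>lborel \<partial>lborel)
    = riesz (periodise k) A B"
proof -
  have [measurable]: "A \<in> sets borel" "B \<in> sets borel" using assms by (auto simp: pset_def)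
  have inner: "(\<integral>\<^sup>+t. indicator A s * indicator B t * ennreal (k (s - t)) \<partial>lborel) =
     (\<integral>\<^sup>+t. indicator A s * indicator B t * periodise k (s - t) \<partial>circ)" for s
  proof -
    have B_per: "indicator B (t + 2 * pi * of_int m) = (indicator B t :: ennreal)" for t and m :: int
      using periodic_int[OF pset_indicator[OF B]] .
    have p: "periodise k (s - t) = (\<integral>\<^sup>+m. ennreal (k (s - (t + 2 * pi * of_int m))) \<partial>count_space (UNIV :: int set))" for t
      unfolding periodise_def
      by (subst nn_integral_int_uminus[symmetric]) (simp add: algebra_simps)
    have "(\<integral>\<^sup>+t. indicator A s * indicator B t * ennreal (k (s - t)) \<partial>lborel) =
      (\<integral>\<^sup>+t. \<integral>\<^sup>+m. indicator A s * indicator B (t + 2 * pi * of_int m) * ennreal (k (s - (t + 2 * pi * of_int m))) \<partial>count_space (UNIV :: int set) \<partial>circ)"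
      by (rule nn_integral_lborel_unfold) measurable
    also have "\<dots> = (\<integral>\<^sup>+t. indicator A s * indicator B t * periodise k (s - t) \<partial>circ)"
      unfolding B_per p by (simp only: nn_integral_cmult[OF borel_measurable_count_space])
    finally show ?thesis .
  qed
  have [measurable]: "periodise k \<in> borel_measurable borel" unfolding periodise_def[abs_def] by measurable
  have "(\<integral>\<^sup>+s. \<integral>\<^sup>+t. indicator {- pi..<pi} s * indicator A s * indicator B t * ennreal (k (s - t)) \<partial>lborel \<partial>lborel)
     = (\<integral>\<^sup>+s. indicator {- pi..<pi} s * (\<integral>\<^sup>+t. indicator A s * indicator B t * periodise k (s - t) \<partial>circ) \<partial>lborel)"
    unfolding inner[symmetric] by (simp add: mult.assoc nn_integral_cmult)
  also have "\<dots> = riesz (periodise k) A B"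
    unfolding riesz_def by (rule nn_integral_circ[symmetric]) measurable
  finally show ?thesis .
qed

section \<open>Null sets under reflection, slicing and periodic extension\<close>

lemma AE_lborel_reflect:
  fixes x :: "'a :: euclidean_space"
  assumes "AE z in lborel. P z"
  shows "AE y in lborel. P (x - y)"
proof -
  have "AE z in density (distr lborel borel (\<lambda>y. x + (- 1) *\<^sub>R y)) (\<lambda>_. ennreal (\<bar>- 1\<bar> ^ DIM('a))). P z"
    using assms by (subst (asm) lborel_affine[of "- 1" x]) simp_all
  moreover have "(\<lambda>_ :: 'a. ennreal (\<bar>- 1\<bar> ^ DIM('a))) = (\<lambda>_. 1)" by simp
  ultimately have "AE z in distr lborel borel (\<lambda>y. x + (- 1) *\<^sub>R y). P z" by (simp only: density_1)
  then have "AE y in lborel. P (x + (- 1) *\<^sub>R y)" by (rule AE_distrD[rotated]) simp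
  then show ?thesis by simp
qed

text \<open>The exceptional set is first enlarged to a Borel null set, since \<open>P\<close> may be
  nonmeasurable.\<close>

lemma AE_lborel_snd:
  fixes P :: "('a :: euclidean_space \<times> 'b :: euclidean_space) \<Rightarrow> bool"
  assumes "AE z in lborel. P z"
  shows "AE y in lborel. AE x in lborel. P (x, y)"
proof -
  obtain N where N: "{z \<in> space lborel. \<not> P z} \<subseteq> N" "emeasure lborel N = 0" "N \<in> sets lborel"
    using AE_E[OF assms] by metis
  have [measurable]: "N \<in> sets (borel \<Otimes>\<^sub>M borel)" using N(3) unfolding borel_prod by simp
  have ae: "AE z in lborel \<Otimes>\<^sub>M lborel. z \<notin> N"
    unfolding lborel_prod by (rule AE_not_in) (use N in \<open>simp add: null_sets_def\<close>)
  have "AE x in lborel. AE y in lborel. (x, y) \<notin> N"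
    using lborel_pair.AE_pair[OF ae] .
  moreover have "{z \<in> space (lborel \<Otimes>\<^sub>M lborel). (fst z, snd z) \<notin> N} \<in> sets (lborel \<Otimes>\<^sub>M lborel)"
  proof -
    have "{z \<in> space (lborel \<Otimes>\<^sub>M lborel). (fst z, snd z) \<notin> N} = space (lborel \<Otimes>\<^sub>M lborel) - N" by auto
    also have "\<dots> \<in> sets (lborel \<Otimes>\<^sub>M lborel)" using N(3) unfolding lborel_prod by simp
    finally show ?thesis .
  qed
  ultimately have "AE y in lborel. AE x in lborel. (x, y) \<notin> N"
    using lborel_pair.AE_commute[where P="\<lambda>x y. (x, y) \<notin> N"] by simp
  then show ?thesis
  proof eventually_elim
    case (elim y)
    then show ?case by eventually_elim (use N(1) in auto)
  qed
qed

lemma AE_lborel_prodI: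
  fixes P :: "('a :: euclidean_space \<times> 'b :: euclidean_space) \<Rightarrow> bool"
  assumes meas: "{z. P z} \<in> sets borel" and ae: "AE y in lborel. AE x in lborel. P (x, y)"
  shows "AE z in lborel. P z"
proof -
  have m: "{z \<in> space (lborel \<Otimes>\<^sub>M lborel). P (fst z, snd z)} \<in> sets (lborel \<Otimes>\<^sub>M lborel)"
    using meas unfolding lborel_prod by simp
  have "AE x in lborel. AE y in lborel. P (x, y)"
    using lborel_pair.AE_commute[where P="\<lambda>x y. P (x, y)", OF m] ae by simp
  with m have "AE z in lborel \<Otimes>\<^sub>M lborel. P z" by (intro lborel_pair.AE_pair_measure) auto
  then show ?thesis unfolding lborel_prod .
qed

lemma AE_lborel_wrap:
  assumes [measurable]: "{t. P t} \<in> sets borel" and ae: "AE t in circ. P t"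
  shows "AE t in lborel. P (wrap t)"
proof -
  have [measurable]: "Measurable.pred borel P" using assms(1) by (simp add: pred_def)
  have "(\<integral>\<^sup>+t. indicator {t. \<not> P t} (wrap t) \<partial>lborel) =
    (\<integral>\<^sup>+t. \<integral>\<^sup>+m. indicator {t. \<not> P t} (wrap (t + 2 * pi * of_int m)) \<partial>count_space (UNIV :: int set) \<partial>circ)"
    by (rule nn_integral_lborel_unfold) measurable
  also have "\<dots> = (\<integral>\<^sup>+t. 0 \<partial>circ)"
  proof (rule nn_integral_cong_AE)
    have ran: "AE t in circ. - pi \<le> t \<and> t < pi" by (simp add: AE_circ)
    show "AE t in circ. (\<integral>\<^sup>+m. indicator {t. \<not> P t} (wrap (t + 2 * pi * of_int m)) \<partial>count_space (UNIV :: int set)) = (0 :: ennreal)"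
      using ae ran
    proof eventually_elim
      case (elim t)
      have "wrap (t + 2 * pi * of_int m) = t" for m :: int
        using periodic_int[OF periodic_wrap, of t m] wrap_id[of t] elim by simp
      with elim show ?case by simp
    qed
  qed
  finally have "(\<integral>\<^sup>+t. indicator {t. \<not> P t} (wrap t) \<partial>lborel) = (0 :: ennreal)" by simp
  then have "AE t in lborel. indicator {t. \<not> P t} (wrap t) = (0 :: ennreal)"
    by (subst (asm) nn_integral_0_iff_AE) auto
  then show ?thesis by eventually_elim (auto split: split_indicator_asm)
qed

text \<open>\<open>K0\<close> and \<open>S\<close> are meant as Borel versions of the kernel and the
  set, to which Tonelli applies. The half-open period matches \<open>circ\<close> and differs from
  \<open>slab\<close> by a null hyperplane.\<close>

definition slice_energy :: "(real \<times> 'b \<Rightarrow> ennreal) \<Rightarrow> (real \<times> 'b) set \<Rightarrow> 'b \<Rightarrow> 'b :: euclidean_space \<Rightarrow> ennreal" where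
  "slice_energy K0 S x' y' = (\<integral>\<^sup>+s. \<integral>\<^sup>+t. indicator {- pi..<pi} s * indicator S (s, x') * indicator (- S) (t, y')
     * K0 (s - t, x' - y') \<partial>lborel \<partial>lborel)"

lemma slice_energy_measurable:
  fixes K0 :: "real \<times> 'b :: euclidean_space \<Rightarrow> ennreal"
  assumes "K0 \<in> borel_measurable borel" "S \<in> sets borel"
  shows "(\<lambda>z. slice_energy K0 S (fst z) (snd z)) \<in> borel_measurable (lborel \<Otimes>\<^sub>M lborel)"
proof -
  have [measurable]: "K0 \<in> borel_measurable (borel \<Otimes>\<^sub>M borel)" "S \<in> sets (borel \<Otimes>\<^sub>M borel)"
    using assms unfolding borel_prod by simp_all
  show ?thesis unfolding slice_energy_def by measurable
qed

lemma perimeter_slices: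
  fixes K :: "real \<times> (real^'m) \<Rightarrow> real" and K0 :: "real \<times> (real^'m) \<Rightarrow> ennreal"
  assumes K0m: "K0 \<in> borel_measurable borel" and K0: "AE z in lborel. ennreal (K z) = K0 z"
    and Sm: "S \<in> sets borel" and S: "AE z in lborel. z \<in> E \<longleftrightarrow> z \<in> S"
  shows "periodic_perimeter K E = (\<integral>\<^sup>+x'. \<integral>\<^sup>+y'. slice_energy K0 S x' y' \<partial>lborel \<partial>lborel)"
proof -
  have [measurable]: "K0 \<in> borel_measurable (borel \<Otimes>\<^sub>M borel)" "S \<in> sets (borel \<Otimes>\<^sub>M borel)"
    using K0m Sm unfolding borel_prod by simp_all
  have slab: "AE z :: real \<times> (real^'m) in lborel. fst z \<noteq> - pi"
  proof (rule AE_lborel_prodI)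
    have "Measurable.pred (borel \<Otimes>\<^sub>M borel) (\<lambda>z :: real \<times> (real^'m). fst z \<noteq> - pi)" by measurable
    then show "{z :: real \<times> (real^'m). fst z \<noteq> - pi} \<in> sets borel" unfolding borel_prod pred_def by simp
    show "AE y :: real^'m in lborel. AE x in lborel. fst (x, y) \<noteq> - pi"
      using AE_lborel_singleton[of "- pi"] by simp
  qed
  have "periodic_perimeter K E = (\<integral>\<^sup>+x. (\<integral>\<^sup>+y. ennreal (K (x - y)) * indicator (- E) y \<partial>lborel) * indicator (E \<inter> slab) x \<partial>lborel)"
    unfolding periodic_perimeter_def nn_integral_completion ..
  also have "\<dots> = (\<integral>\<^sup>+x. (\<integral>\<^sup>+y. K0 (x - y) * indicator (- S) y \<partial>lborel) * (indicator S x * indicator {- pi..<pi} (fst x)) \<partial>lborel)"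
  proof (rule nn_integral_cong_AE)
    have inner: "(\<integral>\<^sup>+y. ennreal (K (x - y)) * indicator (- E) y \<partial>lborel) = (\<integral>\<^sup>+y. K0 (x - y) * indicator (- S) y \<partial>lborel)" for x
      by (rule nn_integral_cong_AE, rule AE_mp[OF AE_conjI[OF AE_lborel_reflect[OF K0, of x] S]], rule AE_I2)
        (auto split: split_indicator)
    show "AE x in lborel. (\<integral>\<^sup>+y. ennreal (K (x - y)) * indicator (- E) y \<partial>lborel) * indicator (E \<inter> slab) x =
       (\<integral>\<^sup>+y. K0 (x - y) * indicator (- S) y \<partial>lborel) * (indicator S x * indicator {- pi..<pi} (fst x))"
      using S slab unfolding inner
      by eventually_elim (auto simp: slab_def split: split_indicator)
  qed
  also have "\<dots> = (\<integral>\<^sup>+x'. \<integral>\<^sup>+s. (\<integral>\<^sup>+y. K0 ((s, x') - y) * indicator (- S) y \<partial>lborel) * (indicator S (s, x') * indicator {- pi..<pi} s) \<partial>lborel \<partial>lborel)"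
  proof -
    let ?f = "\<lambda>x. (\<integral>\<^sup>+y. K0 (x - y) * indicator (- S) y \<partial>lborel) * (indicator S x * indicator {- pi..<pi} (fst x))"
    have "?f = (\<lambda>x. (\<integral>\<^sup>+y. K0 (fst x - fst y, snd x - snd y) * indicator (- S) y \<partial>(lborel \<Otimes>\<^sub>M lborel)) * (indicator S x * indicator {- pi..<pi} (fst x)))"
      unfolding lborel_prod minus_prod_def ..
    also have "\<dots> \<in> borel_measurable (lborel \<Otimes>\<^sub>M lborel)" by measurable
    finally have "?f \<in> borel_measurable (lborel \<Otimes>\<^sub>M lborel)" .
    from lborel_pair.nn_integral_snd[OF this] show ?thesis unfolding lborel_prod by simp
  qed
  also have "\<dots> = (\<integral>\<^sup>+x'. \<integral>\<^sup>+s. \<integral>\<^sup>+y'. (\<integral>\<^sup>+t. indicator {- pi..<pi} s * indicator S (s, x') * indicator (- S) (t, y')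
     * K0 (s - t, x' - y') \<partial>lborel) \<partial>lborel \<partial>lborel \<partial>lborel)"
  proof (intro nn_integral_cong)
    fix x' :: "real^'m" and s :: real
    let ?g = "\<lambda>y. indicator {- pi..<pi} s * indicator S (s, x') * indicator (- S) y * K0 (s - fst y, x' - snd y)"
    have "(\<integral>\<^sup>+y. K0 ((s, x') - y) * indicator (- S) y \<partial>lborel) * (indicator S (s, x') * indicator {- pi..<pi} s)
      = (\<integral>\<^sup>+y. K0 (s - fst y, x' - snd y) * indicator (- S) y \<partial>(lborel \<Otimes>\<^sub>M lborel)) * (indicator S (s, x') * indicator {- pi..<pi} s)"
      unfolding lborel_prod minus_prod_def by simp
    also have "\<dots> = (\<integral>\<^sup>+y. K0 (s - fst y, x' - snd y) * indicator (- S) y * (indicator S (s, x') * indicator {- pi..<pi} s) \<partial>(lborel \<Otimes>\<^sub>M lborel))"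
      by (rule nn_integral_multc[symmetric]) measurable
    also have "\<dots> = (\<integral>\<^sup>+y. ?g y \<partial>(lborel \<Otimes>\<^sub>M lborel))"
      by (intro nn_integral_cong) (simp add: ac_simps)
    also have "\<dots> = (\<integral>\<^sup>+y'. \<integral>\<^sup>+t. ?g (t, y') \<partial>lborel \<partial>lborel)"
      by (rule lborel_pair.nn_integral_snd[symmetric]) measurable
    finally show "(\<integral>\<^sup>+y. K0 ((s, x') - y) * indicator (- S) y \<partial>lborel) * (indicator S (s, x') * indicator {- pi..<pi} s)
      = (\<integral>\<^sup>+y'. (\<integral>\<^sup>+t. indicator {- pi..<pi} s * indicator S (s, x') * indicator (- S) (t, y')
     * K0 (s - t, x' - y') \<partial>lborel) \<partial>lborel)" by simp
  qed
  also have "\<dots> = (\<integral>\<^sup>+x'. \<integral>\<^sup>+y'. slice_energy K0 S x' y' \<partial>lborel \<partial>lborel)"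
    unfolding slice_energy_def
  proof (rule nn_integral_cong)
    fix x' :: "real^'m"
    show "(\<integral>\<^sup>+s. \<integral>\<^sup>+y'. (\<integral>\<^sup>+t. indicator {- pi..<pi} s * indicator S (s, x') * indicator (- S) (t, y')
     * K0 (s - t, x' - y') \<partial>lborel) \<partial>lborel \<partial>lborel) = (\<integral>\<^sup>+y'. \<integral>\<^sup>+s. (\<integral>\<^sup>+t. indicator {- pi..<pi} s * indicator S (s, x') * indicator (- S) (t, y')
     * K0 (s - t, x' - y') \<partial>lborel) \<partial>lborel \<partial>lborel)"
      by (rule lborel_pair.Fubini') measurable
  qed
  finally show ?thesis .
qed

text \<open>The shape conditions concern the given kernel \<open>K\<close>, measurability its Borel
  version \<open>K0\<close>; agreement almost everywhere along the slice links the two.\<close>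

definition good_slice :: "(real \<times> 'b \<Rightarrow> real) \<Rightarrow> (real \<times> 'b \<Rightarrow> ennreal) \<Rightarrow> 'b \<Rightarrow> bool" where
  "good_slice K K0 z' \<longleftrightarrow> (\<exists>C. decaying_kernel (\<lambda>t. K (t, z')) C) \<and>
     (kernel_cond1 (\<lambda>t. K (t, z')) \<or> kernel_cond2 (\<lambda>t. K (t, z')) \<or> kernel_cond3 (\<lambda>t. K (t, z'))) \<and>
     (AE t in lborel. ennreal (K (t, z')) = K0 (t, z'))"

lemma slice_energy_riesz:
  fixes K :: "real \<times> 'b :: euclidean_space \<Rightarrow> real"
  assumes good: "good_slice K K0 (x' - y')" and A: "pset {t. (t, x') \<in> S}" and B: "pset {t. (t, y') \<in> S}"
  shows "slice_energy K0 S x' y' = riesz (periodise (\<lambda>t. K (t, x' - y'))) {t. (t, x') \<in> S} (- {t. (t, y') \<in> S})"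
proof -
  obtain C where C: "decaying_kernel (\<lambda>t. K (t, x' - y')) C" using good by (auto simp: good_slice_def)
  interpret decaying_kernel "\<lambda>t. K (t, x' - y')" C by (rule C)
  have m: "(\<lambda>t. K (t, x' - y')) \<in> borel_measurable borel"
    using antimono_measurable antimono good unfolding good_slice_def by blast
  have ae: "AE t in lborel. ennreal (K (t, x' - y')) = K0 (t, x' - y')" using good by (simp add: good_slice_def)
  have "slice_energy K0 S x' y' = (\<integral>\<^sup>+s. \<integral>\<^sup>+t. indicator {- pi..<pi} s * indicator {t. (t, x') \<in> S} s
     * indicator (- {t. (t, y') \<in> S}) t * ennreal (K (s - t, x' - y')) \<partial>lborel \<partial>lborel)"
    unfolding slice_energy_def
  proof (rule nn_integral_cong, rule nn_integral_cong_AE)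
    fix s
    show "AE t in lborel. indicator {- pi..<pi} s * indicator S (s, x') * indicator (- S) (t, y') * K0 (s - t, x' - y') =
      indicator {- pi..<pi} s * indicator {t. (t, x') \<in> S} s * indicator (- {t. (t, y') \<in> S}) t * ennreal (K (s - t, x' - y'))"
      using AE_lborel_reflect[OF ae, of s] by eventually_elim (simp split: split_indicator)
  qed
  then show ?thesis using riesz_strip[OF A pset_Compl[OF B] m] by simp
qed

text \<open>The norm is at least \<open>norm z'\<close>, so after splitting off the power
  \<open>- 2\<close>, which gives the quadratic decay, the remaining power is at most its value at
  \<open>t = 0\<close>. The constant depends on \<open>z'\<close> and may blow up near 0.\<close>

lemma decaying_slice:
  fixes K :: "real \<times> 'b :: euclidean_space \<Rightarrow> real"
  assumes nn: "\<And>x. 0 \<le> K x" and p: "2 \<le> p" and L: "0 < \<Lambda>"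
    and bound: "\<And>x. x \<noteq> 0 \<Longrightarrow> K x \<le> \<Lambda> * norm x powr (- p)"
    and even: "\<forall>t. K (- t, z') = K (t, z')" and z: "z' \<noteq> 0"
  shows "\<exists>C. decaying_kernel (\<lambda>t. K (t, z')) C"
proof -
  define r where "r = norm z'"
  have r: "0 < r" using z by (simp add: r_def)
  define C where "C = \<Lambda> * r powr (- (p - 2)) * (1 + 1 / r\<^sup>2)"
  have "K (t, z') \<le> C / (1 + t\<^sup>2)" for t
  proof -
    define \<rho> where "\<rho> = norm (t, z')"
    have \<rho>2: "\<rho>\<^sup>2 = t\<^sup>2 + r\<^sup>2" by (simp add: \<rho>_def r_def norm_Pair)
    have \<rho>r: "r \<le> \<rho>" unfolding \<rho>_def r_def by (rule norm_snd_le)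
    have \<rho>: "0 < \<rho>" using r \<rho>r by linarith
    have "K (t, z') \<le> \<Lambda> * \<rho> powr (- p)" unfolding \<rho>_def by (rule bound) (use z in \<open>simp add: zero_prod_def\<close>)
    also have "\<rho> powr (- p) = \<rho> powr (- (p - 2)) * \<rho> powr (- 2)" by (simp add: powr_add[symmetric])
    also have "\<rho> powr (- 2) = 1 / \<rho>\<^sup>2" using \<rho> by (simp add: powr_minus_divide)
    also have "\<Lambda> * (\<rho> powr (- (p - 2)) * (1 / \<rho>\<^sup>2)) \<le> \<Lambda> * (r powr (- (p - 2)) * ((1 + 1 / r\<^sup>2) / (1 + t\<^sup>2)))"
    proof (intro mult_left_mono mult_mono)
      show "\<rho> powr (- (p - 2)) \<le> r powr (- (p - 2))" using r \<rho>r p by (intro powr_mono2') auto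
      have "1 + t\<^sup>2 \<le> (1 + 1 / r\<^sup>2) * (t\<^sup>2 + r\<^sup>2)" using r by (simp add: field_simps)
      then show "1 / \<rho>\<^sup>2 \<le> (1 + 1 / r\<^sup>2) / (1 + t\<^sup>2)"
        unfolding \<rho>2 using r by (simp add: divide_le_eq le_divide_eq add_pos_nonneg add_nonneg_pos mult.commute)
    qed (use L in auto)
    also have "\<dots> = C / (1 + t\<^sup>2)" by (simp add: C_def)
    finally show ?thesis .
  qed
  then have "decaying_kernel (\<lambda>t. K (t, z')) C" using nn even by unfold_locales auto
  then show ?thesis by blast
qed

section \<open>The periodic rearrangement\<close>

lemma mem_translate: "z \<in> translate v A \<longleftrightarrow> z - v \<in> A"
  unfolding translate_def by (auto simp: image_iff intro!: bexI[of _ "z - v"])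

lemma minus_e1: "(t, x') - c *\<^sub>R e1 = (t - c, x')"
  by (simp add: e1_def)

lemma periodic_set_iff:
  assumes "periodic_set E"
  shows "(t - 2 * pi * of_int k, x') \<in> E \<longleftrightarrow> (t, x') \<in> E"
  using assms mem_translate[of "(t, x')" "(2 * pi * of_int k) *\<^sub>R e1" E]
  unfolding periodic_set_def minus_e1 by simp

lemma AE_lborel_sndI:
  assumes "AE y in lborel. Q y"
  shows "AE z in (lborel :: ('a :: euclidean_space \<times> 'b :: euclidean_space) measure). Q (snd z)"
proof -
  obtain N where N: "{y \<in> space lborel. \<not> Q y} \<subseteq> N" "emeasure lborel N = 0" "N \<in> sets lborel"
    using AE_E[OF assms] by metis
  have Nm [measurable]: "N \<in> sets borel" using N(3) by simp
  have "AE z in (lborel :: ('a \<times> 'b) measure). snd z \<notin> N"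
  proof (rule AE_lborel_prodI)
    have "Measurable.pred (borel \<Otimes>\<^sub>M borel) (\<lambda>z :: 'a \<times> 'b. snd z \<notin> N)" by measurable
    then show "{z :: 'a \<times> 'b. snd z \<notin> N} \<in> sets borel" unfolding borel_prod pred_def by simp
    have "AE y in lborel. y \<notin> N" by (rule AE_not_in) (use N in \<open>simp add: null_sets_def\<close>)
    then show "AE y in lborel. AE x :: 'a in lborel. snd (x, y) \<notin> N" by eventually_elim simp
  qed
  then show ?thesis by eventually_elim (use N(1) in auto)
qed

text \<open>A Borel core of \<open>E\<close> in one period is extended through \<open>wrap\<close>,
  which makes every slice exactly periodic; the discrepancy lies in the periodic extension of a null
  set.\<close>

lemma periodic_borel_version:
  fixes E :: "(real \<times> (real^'m)) set"
  assumes E: "E \<in> sets lebesgue" and per: "periodic_set E"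
  obtains S where "S \<in> sets borel" "\<And>x'. pset {t. (t, x') \<in> S}" "AE z in lborel. z \<in> E \<longleftrightarrow> z \<in> S"
proof -
  obtain S0 N N' where E_eq: "E = S0 \<union> N" "N \<subseteq> N'" "N' \<in> null_sets lborel" "S0 \<in> sets lborel"
    using sets_completionE[OF E] by blast
  have [measurable]: "S0 \<in> sets (borel \<Otimes>\<^sub>M borel)" "N' \<in> sets (borel \<Otimes>\<^sub>M borel)"
    using E_eq(3,4) unfolding borel_prod by (auto simp: null_sets_def)
  define S where "S = {z. (wrap (fst z), snd z) \<in> S0}"
  have "Measurable.pred (borel \<Otimes>\<^sub>M borel) (\<lambda>z :: real \<times> (real^'m). (wrap (fst z), snd z) \<in> S0)" by measurable
  then have Sm: "S \<in> sets borel" unfolding borel_prod pred_def S_def by simp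
  have slices: "pset {t. (t, x') \<in> S}" for x'
  proof -
    have "{t. (wrap t, x') \<in> S0} \<in> sets borel" by measurable
    then show ?thesis using periodic_comp[OF periodic_wrap, of "\<lambda>t. (t, x') \<in> S0"] by (simp add: pset_def S_def)
  qed
  have N'0: "AE z in lborel. z \<notin> N'" using E_eq(3) by (rule AE_not_in)
  have "AE z in lborel. (wrap (fst z), snd z) \<notin> N'"
  proof (rule AE_lborel_prodI)
    have "Measurable.pred (borel \<Otimes>\<^sub>M borel) (\<lambda>z :: real \<times> (real^'m). (wrap (fst z), snd z) \<notin> N')" by measurable
    then show "{z. (wrap (fst z), snd z) \<notin> N'} \<in> sets borel" unfolding borel_prod pred_def by simp
    show "AE x' in lborel. AE t in lborel. (wrap (fst (t, x')), snd (t, x')) \<notin> N'"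
      using AE_lborel_snd[OF N'0]
    proof eventually_elim
      case (elim x')
      have "AE t in circ. (t, x') \<notin> N'" using elim unfolding AE_circ by eventually_elim simp
      moreover have "{t. (t, x') \<notin> N'} \<in> sets borel" by measurable
      ultimately have "AE t in lborel. (wrap t, x') \<notin> N'" by (rule AE_lborel_wrap[rotated])
      then show ?case by simp
    qed
  qed
  then have "AE z in lborel. z \<in> E \<longleftrightarrow> z \<in> S"
  proof eventually_elim
    case (elim z)
    obtain t x' where z: "z = (t, x')" by (cases z)
    have "z \<in> E \<longleftrightarrow> (wrap t, x') \<in> E" unfolding z wrap_def periodic_set_iff[OF per] ..
    also have "\<dots> \<longleftrightarrow> (wrap t, x') \<in> S0" using elim E_eq(1,2) by (auto simp: z)
    finally show ?case by (simp add: S_def z)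
  qed
  with Sm slices show ?thesis by (rule that)
qed

section \<open>The rearrangement as a family of arcs\<close>

lemma arc_iff_shift:
  assumes "0 \<le> m" "m \<le> 2 * pi"
  shows "(\<exists>k::int. \<bar>t - 2 * pi * of_int k\<bar> < m / 2) \<longleftrightarrow> cos (m / 2) < cos t"
proof
  assume "\<exists>k::int. \<bar>t - 2 * pi * of_int k\<bar> < m / 2"
  then obtain k :: int where k: "\<bar>t - 2 * pi * of_int k\<bar> < m / 2" by blast
  then have "cos (m / 2) < cos (t - 2 * pi * of_int k)"
    using assms by (subst cos_less_iff_abs) auto
  then show "cos (m / 2) < cos t" by (simp only: periodic_int'[OF periodic_cos])
next
  assume "cos (m / 2) < cos t"
  then have "cos (m / 2) < cos (wrap t)" by (simp add: periodic_wrap_eq[OF periodic_cos])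
  then have "\<bar>wrap t\<bar> < \<bar>m / 2\<bar>"
    using assms fold_bounds[of t] by (subst (asm) cos_less_iff_abs) auto
  then show "\<exists>k::int. \<bar>t - 2 * pi * of_int k\<bar> < m / 2"
    using assms by (intro exI[of _ "\<lfloor>(t + pi) / (2 * pi)\<rfloor>"]) (simp add: wrap_def)
qed

lemma mem_periodic_rearrangement:
  "(t, x') \<in> periodic_rearrangement E \<longleftrightarrow>
    (\<exists>k::int. \<bar>t - 2 * pi * of_int k\<bar> < measure lebesgue (slice (E \<inter> slab) x') / 2)"
proof -
  have "x \<in> {- (M / 2)<..<M / 2} \<longleftrightarrow> \<bar>x\<bar> < M / 2" for x M :: real
    unfolding greaterThanLessThan_iff by linarith
  then show ?thesis
    unfolding periodic_rearrangement_def UN_iff mem_translate minus_e1 steiner_def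
    by (simp del: greaterThanLessThan_iff)
qed

text \<open>Completeness of Lebesgue measure makes such a slice measurable, so the convention for
  nonmeasurable slices in \<open>steiner\<close> does not interfere.\<close>

lemma measure_slice:
  assumes B: "pset B" and ae: "AE t in lborel. (t, x') \<in> E \<longleftrightarrow> t \<in> B"
  shows "measure lebesgue (slice (E \<inter> slab) x') = measure circ B"
proof -
  let ?B = "{- pi..<pi} \<inter> B"
  have [measurable]: "B \<in> sets borel" using B by (rule psetD)
  have eq: "AE t in lebesgue. t \<in> slice (E \<inter> slab) x' \<longleftrightarrow> t \<in> ?B"
    unfolding AE_completion_iff using ae AE_lborel_singleton[of "- pi"]
    by eventually_elim (auto simp: slice_def slab_def)
  have Bs: "?B \<in> sets lebesgue" by (rule sets_completionI_sets) simp
  have "AE t in lebesgue. t \<in> ?B \<longleftrightarrow> t \<in> slice (E \<inter> slab) x'" using eq by eventually_elim blast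
  then have "slice (E \<inter> slab) x' \<in> sets lebesgue"
    by (rule completion.in_sets_AE[OF _ Bs]) simp
  with eq Bs have "emeasure lebesgue (slice (E \<inter> slab) x') = emeasure lebesgue ?B"
    by (intro emeasure_eq_AE)
  also have "\<dots> = emeasure lborel ?B" by (subst emeasure_completion[OF Bs]) simp
  also have "\<dots> = (\<integral>\<^sup>+t. indicator {- pi..<pi} t * indicator B t \<partial>lborel)"
    by (simp add: indicator_inter_arith[symmetric])
  also have "\<dots> = emeasure circ B"
    by (subst nn_integral_circ[symmetric]) auto
  finally show ?thesis by (simp add: measure_def)
qed

text \<open>Borel model of the translated rearrangement; the slice over \<open>x'\<close> is the arc
  of length \<open>m x'\<close> with centre \<open>c\<close>.\<close>

definition arc_set :: "('b \<Rightarrow> real) \<Rightarrow> real \<Rightarrow> (real \<times> 'b) set" where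
  "arc_set m c = {z. cos (m (snd z) / 2) < cos (fst z - c)}"

lemma slice_arc_set: "{t. (t, x') \<in> arc_set m c} = circ_arc c (m x')"
  by (simp add: arc_set_def circ_arc_def)

lemma arc_set_measurable:
  fixes m :: "'b :: euclidean_space \<Rightarrow> real"
  assumes [measurable]: "m \<in> borel_measurable borel"
  shows "arc_set m c \<in> sets borel"
proof -
  have "Measurable.pred (borel \<Otimes>\<^sub>M borel) (\<lambda>z :: real \<times> 'b. cos (m (snd z) / 2) < cos (fst z - c))" by measurable
  then show ?thesis unfolding borel_prod pred_def arc_set_def by simp
qed

lemma slice_measure_measurable:
  fixes S :: "(real \<times> 'b :: euclidean_space) set"
  assumes S: "S \<in> sets borel"
  shows "(\<lambda>x'. measure circ {t. (t, x') \<in> S}) \<in> borel_measurable borel"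
proof -
  have [measurable]: "S \<in> sets (borel \<Otimes>\<^sub>M borel)" using S unfolding borel_prod .
  have "measure circ {t. (t, x') \<in> S} = enn2real (\<integral>\<^sup>+t. indicator S (t, x') \<partial>circ)" for x'
  proof -
    have "{t. (t, x') \<in> S} \<in> sets borel" by measurable
    then have "emeasure circ {t. (t, x') \<in> S} = (\<integral>\<^sup>+t. indicator {t. (t, x') \<in> S} t \<partial>circ)"
      by (rule emeasure_circ_nn)
    also have "\<dots> = (\<integral>\<^sup>+t. indicator S (t, x') \<partial>circ)"
      by (intro nn_integral_cong) (simp split: split_indicator)
    finally show ?thesis by (simp add: measure_def)
  qed
  then show ?thesis by simp
qed

lemma AE_rearrangement_arc_set:
  fixes E S :: "(real \<times> (real^'m)) set"
  assumes slices: "\<And>x'. pset {t. (t, x') \<in> S}" and ae: "AE z in lborel. z \<in> E \<longleftrightarrow> z \<in> S"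
  shows "AE z in lborel. z \<in> translate (c *\<^sub>R e1) (periodic_rearrangement E) \<longleftrightarrow>
    z \<in> arc_set (\<lambda>x'. measure circ {t. (t, x') \<in> S}) c"
proof -
  have "AE x' in lborel. \<forall>t. (t, x') \<in> periodic_rearrangement E \<longleftrightarrow> cos (measure circ {t. (t, x') \<in> S} / 2) < cos t"
    using AE_lborel_snd[OF ae]
  proof eventually_elim
    case (elim x')
    have "AE t in lborel. (t, x') \<in> E \<longleftrightarrow> t \<in> {t. (t, x') \<in> S}" using elim by simp
    note eq = measure_slice[OF slices this]
    show ?case unfolding mem_periodic_rearrangement eq
      by (intro allI arc_iff_shift) (auto simp: measure_circ_le)
  qed
  from AE_lborel_sndI[OF this] show ?thesis
  proof eventually_elim
    case (elim z)
    then show ?case by (cases z) (simp add: mem_translate minus_e1 arc_set_def)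
  qed
qed

text \<open>Null and full slices are arcs about any centre, so they do not constrain the common
  one.\<close>

lemma AE_trivial_arc:
  assumes A: "pset A" and m: "measure circ A \<in> {0, 2 * pi}"
  shows "AE t in circ. t \<in> A \<longleftrightarrow> t \<in> circ_arc c (measure circ A)"
proof (cases "measure circ A = 0")
  case True
  have "A \<in> null_sets circ" using True psetD(1)[OF A] by (simp add: null_sets_def circ.emeasure_eq_measure)
  from AE_not_in[OF this] show ?thesis unfolding True by eventually_elim (simp add: circ_arc_def not_less)
next
  case False
  with m have full: "measure circ A = 2 * pi" by simp
  have "measure circ (- A) = 0"
    using circ.finite_measure_compl[of A] psetD(1)[OF A] full by (simp add: Compl_eq_Diff_UNIV measure_circ_UNIV)
  then have "- A \<in> null_sets circ" using psetD(1)[OF A] by (simp add: null_sets_def circ.emeasure_eq_measure)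
  from AE_not_in[OF this] AE_sin_neq0[of c] show ?thesis unfolding full
  proof eventually_elim
    case (elim t)
    \<comment> \<open>The arc of full length misses only the antipode of \<open>c\<close>, where the
      sine vanishes.\<close>
    have "cos (t - c) \<noteq> - 1" using elim sin_squared_eq[of "t - c"] by auto
    then have "- 1 < cos (t - c)" using cos_ge_minus_one[of "t - c"] by linarith
    then show ?case using elim by (simp add: circ_arc_def)
  qed
qed

section \<open>The isoperimetric inequality and its equality case\<close>

lemma null_sets_lebesgueI:
  assumes "AE z in lborel. z \<notin> A" shows "A \<in> null_sets lebesgue"
proof -
  obtain N where N: "{z \<in> space lborel. \<not> z \<notin> A} \<subseteq> N" "emeasure lborel N = 0" "N \<in> sets lborel"
    using AE_E[OF assms] by metis
  then show ?thesis unfolding null_sets_completion_iff2 by (intro bexI[of _ N]) (auto simp: null_sets_def)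
qed

lemma nn_integral_eq_AE:
  fixes f g :: "'a \<times> 'b \<Rightarrow> ennreal"
  assumes "sigma_finite_measure M" "sigma_finite_measure N"
    and [measurable]: "f \<in> borel_measurable (M \<Otimes>\<^sub>M N)" "g \<in> borel_measurable (M \<Otimes>\<^sub>M N)"
    and le: "AE x in M. AE y in N. f (x, y) \<le> g (x, y)"
    and eq: "(\<integral>\<^sup>+x. \<integral>\<^sup>+y. f (x, y) \<partial>N \<partial>M) = (\<integral>\<^sup>+x. \<integral>\<^sup>+y. g (x, y) \<partial>N \<partial>M)"
    and fin: "(\<integral>\<^sup>+x. \<integral>\<^sup>+y. f (x, y) \<partial>N \<partial>M) < \<infinity>"
  shows "AE x in M. AE y in N. f (x, y) = g (x, y)"
proof -
  interpret M: sigma_finite_measure M by fact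
  interpret N: sigma_finite_measure N by fact
  interpret pair_sigma_finite M N ..
  have ae: "AE z in M \<Otimes>\<^sub>M N. f z \<le> g z" by (rule AE_pair_measure[OF _ le]) measurable
  have "AE z in M \<Otimes>\<^sub>M N. g z \<le> f z"
  proof (rule ccontr)
    assume *: "\<not> ?thesis"
    have "(\<integral>\<^sup>+z. f z \<partial>(M \<Otimes>\<^sub>M N)) < (\<integral>\<^sup>+z. g z \<partial>(M \<Otimes>\<^sub>M N))"
      by (rule nn_integral_less[OF _ _ _ ae *]) (use fin in \<open>simp_all add: N.nn_integral_fst\<close>)
    then show False using eq by (simp add: N.nn_integral_fst)
  qed
  with ae have "AE z in M \<Otimes>\<^sub>M N. f z = g z" by eventually_elim simp
  from AE_pair[OF this] show ?thesis .
qed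

theorem theorem1p3:
  fixes n :: nat and \<alpha> \<Lambda> :: real
    and K :: "real \<times> (real^'m) \<Rightarrow> real"
    and E :: "(real \<times> (real^'m)) set"
  assumes "n \<ge> 2" and "CARD('m) = n - 1"
    and "0 < \<alpha>" and "\<alpha> < 1" and "0 < \<Lambda>"
    and K_measurable: "K \<in> borel_measurable lebesgue"
    and K_nonneg: "\<And>x. 0 \<le> K x"
    and K_bound: "\<And>x. x \<noteq> 0 \<Longrightarrow> K x \<le> \<Lambda> * norm x powr (- real n - \<alpha>)"
    and K_even: "AE x' in lebesgue. \<forall>t. K (- t, x') = K (t, x')"
    and E_measurable: "E \<in> sets lebesgue"
    and E_periodic: "periodic_set E"
    and E_finite: "periodic_perimeter K E < \<infinity>"
    and K_cond: "AE x' in lebesgue.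
        kernel_cond1 (\<lambda>t. K (t, x')) \<or> kernel_cond2 (\<lambda>t. K (t, x')) \<or>
        kernel_cond3 (\<lambda>t. K (t, x'))"
  shows "periodic_perimeter K (periodic_rearrangement E) \<le> periodic_perimeter K E \<and>
    ((AE x' in lebesgue.
        kernel_cond1_strict (\<lambda>t. K (t, x')) \<or> kernel_cond2_strict (\<lambda>t. K (t, x')) \<or>
        kernel_cond3_strict (\<lambda>t. K (t, x'))) \<longrightarrow>
      (periodic_perimeter K (periodic_rearrangement E) = periodic_perimeter K E \<longleftrightarrow>
        (\<exists>c::real.
          (E - translate (c *\<^sub>R e1) (periodic_rearrangement E)) \<union>
          (translate (c *\<^sub>R e1) (periodic_rearrangement E) - E) \<in> null_sets lebesgue)))"
proof -
  let ?F = "periodic_rearrangement E"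
  have p: "2 \<le> real n + \<alpha>" using \<open>n \<ge> 2\<close> \<open>0 < \<alpha>\<close> by linarith
  obtain S where Sm: "S \<in> sets borel" and slices: "\<And>x'. pset {t. (t, x') \<in> S}"
    and ES: "AE z in lborel. z \<in> E \<longleftrightarrow> z \<in> S"
    using periodic_borel_version[OF E_measurable E_periodic] by blast
  obtain K0 where K0m: "K0 \<in> borel_measurable borel" and K0: "AE z in lborel. ennreal (K z) = K0 z"
    using completion_ex_borel_measurable[of "\<lambda>z. ennreal (K z)" lborel] K_measurable by auto
  define m where "m x' = measure circ {t. (t, x') \<in> S}" for x'
  have m_meas: "m \<in> borel_measurable borel" unfolding m_def[abs_def] by (rule slice_measure_measurable[OF Sm])
  note arc_meas = arc_set_measurable[OF m_meas]
  have F_arc: "AE z in lborel. z \<in> translate (c *\<^sub>R e1) ?F \<longleftrightarrow> z \<in> arc_set m c" for c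
    using AE_rearrangement_arc_set[OF slices ES, of c] unfolding m_def[abs_def] .
  have "AE z' in lborel. good_slice K K0 z'"
  proof -
    have "AE z' in lborel. \<forall>t. K (- t, z') = K (t, z')" using K_even by (simp add: AE_completion_iff)
    moreover have "AE z' in lborel. kernel_cond1 (\<lambda>t. K (t, z')) \<or> kernel_cond2 (\<lambda>t. K (t, z')) \<or> kernel_cond3 (\<lambda>t. K (t, z'))"
      using K_cond by (simp add: AE_completion_iff)
    \<comment> \<open>The slice over 0 is discarded, because the kernel bound gives no finite
      constant there.\<close>
    ultimately show ?thesis using AE_lborel_singleton[of 0] AE_lborel_snd[OF K0]
    proof eventually_elim
      case (elim z')
      have "\<exists>C. decaying_kernel (\<lambda>t. K (t, z')) C"
        using K_bound elim(1,3) by (intro decaying_slice[OF K_nonneg p \<open>0 < \<Lambda>\<close>]) auto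
      with elim show ?case by (simp add: good_slice_def)
    qed
  qed
  then have good: "AE y' in lborel. good_slice K K0 (x' - y')" for x' by (rule AE_lborel_reflect)
  have energies: "slice_energy K0 (arc_set m c) x' y' = slice_energy K0 (arc_set m 0) x' y'"
    "slice_energy K0 (arc_set m 0) x' y' \<le> slice_energy K0 S x' y'"
    if g: "good_slice K K0 (x' - y')" for x' y' c
  proof -
    obtain C where C: "decaying_kernel (\<lambda>t. K (t, x' - y')) C" using g by (auto simp: good_slice_def)
    interpret decaying_kernel "\<lambda>t. K (t, x' - y')" C by (rule C)
    interpret circ_kernel "periodise (\<lambda>t. K (t, x' - y'))" total_bound
      using circ_kernel_periodise g by (simp add: good_slice_def)
    have arcs: "slice_energy K0 (arc_set m c) x' y' =
        riesz (periodise (\<lambda>t. K (t, x' - y'))) (circ_arc c (m x')) (- circ_arc c (m y'))" for c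
      using slice_energy_riesz[OF g, of "arc_set m c"] by (simp add: slice_arc_set pset_arc)
    show "slice_energy K0 (arc_set m c) x' y' = slice_energy K0 (arc_set m 0) x' y'"
      unfolding arcs by (rule riesz_arc_shift)
    show "slice_energy K0 (arc_set m 0) x' y' \<le> slice_energy K0 S x' y'"
      unfolding arcs slice_energy_riesz[OF g slices slices] m_def
      by (rule riesz_Compl_rearrangement(1)[OF slices slices])
  qed
  have P_E: "periodic_perimeter K E = (\<integral>\<^sup>+x'. \<integral>\<^sup>+y'. slice_energy K0 S x' y' \<partial>lborel \<partial>lborel)"
    by (rule perimeter_slices[OF K0m K0 Sm ES])
  have F0: "AE z in lborel. z \<in> ?F \<longleftrightarrow> z \<in> arc_set m 0"
    using F_arc[of 0] by (simp add: translate_def)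
  have P_F: "periodic_perimeter K ?F = (\<integral>\<^sup>+x'. \<integral>\<^sup>+y'. slice_energy K0 (arc_set m 0) x' y' \<partial>lborel \<partial>lborel)"
    by (rule perimeter_slices[OF K0m K0 arc_meas F0])
  have le_slices: "AE y' in lborel. slice_energy K0 (arc_set m 0) x' y' \<le> slice_energy K0 S x' y'" for x'
    using good[of x'] by eventually_elim (rule energies(2))
  have le: "periodic_perimeter K ?F \<le> periodic_perimeter K E"
    unfolding P_E P_F by (intro nn_integral_mono nn_integral_mono_AE le_slices)
  moreover have "periodic_perimeter K ?F = periodic_perimeter K E \<longleftrightarrow>
      (\<exists>c. (E - translate (c *\<^sub>R e1) ?F) \<union> (translate (c *\<^sub>R e1) ?F - E) \<in> null_sets lebesgue)"
    if strict: "AE x' in lebesgue.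
        kernel_cond1_strict (\<lambda>t. K (t, x')) \<or> kernel_cond2_strict (\<lambda>t. K (t, x')) \<or>
        kernel_cond3_strict (\<lambda>t. K (t, x'))"
  proof
    assume "\<exists>c. (E - translate (c *\<^sub>R e1) ?F) \<union> (translate (c *\<^sub>R e1) ?F - E) \<in> null_sets lebesgue"
    then obtain c where "(E - translate (c *\<^sub>R e1) ?F) \<union> (translate (c *\<^sub>R e1) ?F - E) \<in> null_sets lebesgue"
      by blast
    from AE_not_in[OF this]
    have "AE z in lborel. z \<notin> (E - translate (c *\<^sub>R e1) ?F) \<union> (translate (c *\<^sub>R e1) ?F - E)"
      unfolding AE_completion_iff .
    with F_arc[of c] have "AE z in lborel. z \<in> E \<longleftrightarrow> z \<in> arc_set m c" by eventually_elim blast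
    from perimeter_slices[OF K0m K0 arc_meas this]
    have "periodic_perimeter K E = (\<integral>\<^sup>+x'. \<integral>\<^sup>+y'. slice_energy K0 (arc_set m c) x' y' \<partial>lborel \<partial>lborel)" .
    also have "\<dots> = periodic_perimeter K ?F"
      unfolding P_F
    proof (rule nn_integral_cong, rule nn_integral_cong_AE)
      fix x'
      show "AE y' in lborel. slice_energy K0 (arc_set m c) x' y' = slice_energy K0 (arc_set m 0) x' y'"
        using good[of x'] by eventually_elim (rule energies(1))
    qed
    finally show "periodic_perimeter K ?F = periodic_perimeter K E" by simp
  next
    assume eq: "periodic_perimeter K ?F = periodic_perimeter K E"
    have "AE z' in lborel. kernel_cond1_strict (\<lambda>t. K (t, z')) \<or> kernel_cond2_strict (\<lambda>t. K (t, z')) \<or>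
        kernel_cond3_strict (\<lambda>t. K (t, z'))" using strict by (simp add: AE_completion_iff)
    then have strict': "AE y' in lborel. kernel_cond1_strict (\<lambda>t. K (t, x' - y')) \<or>
      kernel_cond2_strict (\<lambda>t. K (t, x' - y')) \<or> kernel_cond3_strict (\<lambda>t. K (t, x' - y'))" for x'
      by (rule AE_lborel_reflect)
    \<comment> \<open>The slicewise inequality together with equal finite integrals puts almost
      every pair of slices into the equality case.\<close>
    have "AE x' in lborel. AE y' in lborel. slice_energy K0 (arc_set m 0) (fst (x', y')) (snd (x', y'))
        = slice_energy K0 S (fst (x', y')) (snd (x', y'))"
    proof (rule nn_integral_eq_AE[where f="\<lambda>z. slice_energy K0 (arc_set m 0) (fst z) (snd z)"
          and g="\<lambda>z. slice_energy K0 S (fst z) (snd z)"])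
      show "(\<integral>\<^sup>+x'. \<integral>\<^sup>+y'. slice_energy K0 (arc_set m 0) (fst (x', y')) (snd (x', y')) \<partial>lborel \<partial>lborel) < \<infinity>"
        using E_finite eq P_F by simp
    qed (use eq P_E P_F le_slices slice_energy_measurable[OF K0m Sm] slice_energy_measurable[OF K0m arc_meas]
        in \<open>auto intro: sigma_finite_lborel\<close>)
    \<comment> \<open>The angle \<open>\<beta>\<close> is read off from the slice over
      \<open>x'\<close>, whereas the arc is the slice over \<open>y'\<close>; one nontrivial
      \<open>x'\<close> will therefore fix the centre for all others.\<close>
    then have pairs: "AE x' in lborel. AE y' in lborel. m x' \<notin> {0, 2 * pi} \<longrightarrow> m y' \<notin> {0, 2 * pi} \<longrightarrow>
      (\<exists>r \<beta>. 0 < r \<and> circ_cos {t. (t, x') \<in> S} = r * cos \<beta> \<and> circ_sin {t. (t, x') \<in> S} = r * sin \<beta> \<and>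
         (AE t in circ. t \<in> {t. (t, y') \<in> S} \<longleftrightarrow> t \<in> circ_arc \<beta> (m y')))"
    proof eventually_elim
      case (elim x')
      from elim good[of x'] strict'[of x'] show ?case
      proof eventually_elim
        case (elim y')
        note g = elim(2)
        obtain C where C: "decaying_kernel (\<lambda>t. K (t, x' - y')) C" using g by (auto simp: good_slice_def)
        interpret decaying_kernel "\<lambda>t. K (t, x' - y')" C by (rule C)
        interpret strict_circ_kernel "periodise (\<lambda>t. K (t, x' - y'))" total_bound
          by (rule strict_circ_kernel_periodise[OF elim(3)])
        have "riesz (periodise (\<lambda>t. K (t, x' - y'))) (circ_arc 0 (m x')) (- circ_arc 0 (m y')) =
          riesz (periodise (\<lambda>t. K (t, x' - y'))) {t. (t, x') \<in> S} (- {t. (t, y') \<in> S})"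
          using elim(1) slice_energy_riesz[OF g slices slices] slice_energy_riesz[OF g, of "arc_set m 0"]
          by (simp add: slice_arc_set pset_arc)
        from riesz_Compl_rearrangement(2)[OF slices slices this[unfolded m_def]]
        show ?case using riesz_equality[OF slices slices, of x' y'] unfolding m_def by blast
      qed
    qed
    have "\<exists>\<beta>. AE y' in lborel. AE t in circ. t \<in> {t. (t, y') \<in> S} \<longleftrightarrow> t \<in> circ_arc \<beta> (m y')"
    proof (cases "AE x' in lborel. \<not> m x' \<notin> {0, 2 * pi}")
      case True
      then have "AE y' in lborel. AE t in circ. t \<in> {t. (t, y') \<in> S} \<longleftrightarrow> t \<in> circ_arc 0 (m y')"
      proof eventually_elim
        case (elim y')
        then show ?case using AE_trivial_arc[OF slices, of y' 0] unfolding m_def by blast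
      qed
      then show ?thesis by blast
    next
      case False
      from not_AE_D[OF False pairs] obtain x0 where x0: "m x0 \<notin> {0, 2 * pi}"
        "AE y' in lborel. m x0 \<notin> {0, 2 * pi} \<longrightarrow> m y' \<notin> {0, 2 * pi} \<longrightarrow>
          (\<exists>r \<beta>. 0 < r \<and> circ_cos {t. (t, x0) \<in> S} = r * cos \<beta> \<and> circ_sin {t. (t, x0) \<in> S} = r * sin \<beta> \<and>
           (AE t in circ. t \<in> {t. (t, y') \<in> S} \<longleftrightarrow> t \<in> circ_arc \<beta> (m y')))" by blast
      \<comment> \<open>The statement yields an angle only in the presence of a nontrivial partner;
        \<open>y0\<close> is there to provide one.\<close>
      obtain y0 where "m y0 \<notin> {0, 2 * pi}" and ex: "m x0 \<notin> {0, 2 * pi} \<longrightarrow> m y0 \<notin> {0, 2 * pi} \<longrightarrow>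
          (\<exists>r \<beta>. 0 < r \<and> circ_cos {t. (t, x0) \<in> S} = r * cos \<beta> \<and> circ_sin {t. (t, x0) \<in> S} = r * sin \<beta> \<and>
           (AE t in circ. t \<in> {t. (t, y0) \<in> S} \<longleftrightarrow> t \<in> circ_arc \<beta> (m y0)))"
        using not_AE_D[OF False x0(2)] by blast
      then obtain r \<beta> where r: "0 < r" "circ_cos {t. (t, x0) \<in> S} = r * cos \<beta>" "circ_sin {t. (t, x0) \<in> S} = r * sin \<beta>"
        using x0(1) by blast
      \<comment> \<open>The coefficients of the slice over \<open>x0\<close> determine radius and
        direction, so angles obtained with different partners differ by multiples of
        \<open>2 * pi\<close> and define the same arcs.\<close>
      have same: "circ_arc \<beta>' = circ_arc \<beta>"
        if "0 < r'" "circ_cos {t. (t, x0) \<in> S} = r' * cos \<beta>'" "circ_sin {t. (t, x0) \<in> S} = r' * sin \<beta>'" for r' \<beta>'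
      proof -
        have sq: "s\<^sup>2 = (s * cos b)\<^sup>2 + (s * sin b)\<^sup>2" for s b :: real
          unfolding power_mult_distrib distrib_left[symmetric] by simp
        have "r'\<^sup>2 = r\<^sup>2" using sq[of r' \<beta>'] sq[of r \<beta>] r(2,3) that(2,3) by metis
        then have "r' = r" using r(1) that(1) by (simp add: power2_eq_iff_nonneg)
        then have "cos \<beta>' = cos \<beta>" "sin \<beta>' = sin \<beta>" using r that by simp_all
        then show ?thesis by (simp add: circ_arc_def fun_eq_iff cos_diff)
      qed
      from x0(2) have "AE y' in lborel. AE t in circ. t \<in> {t. (t, y') \<in> S} \<longleftrightarrow> t \<in> circ_arc \<beta> (m y')"
      proof eventually_elim
        case (elim y')
        show ?case
        proof (cases "m y' \<in> {0, 2 * pi}")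
          case True
          then show ?thesis using AE_trivial_arc[OF slices, of y' \<beta>] unfolding m_def by blast
        next
          case False
          then obtain r' \<beta>' where "0 < r'" "circ_cos {t. (t, x0) \<in> S} = r' * cos \<beta>'" "circ_sin {t. (t, x0) \<in> S} = r' * sin \<beta>'"
            and arc: "AE t in circ. t \<in> {t. (t, y') \<in> S} \<longleftrightarrow> t \<in> circ_arc \<beta>' (m y')" using elim x0(1) by blast
          from same[OF this(1-3)] arc show ?thesis by simp
        qed
      qed
      then show ?thesis by blast
    qed
    then obtain \<beta> where \<beta>: "AE y' in lborel. AE t in circ. t \<in> {t. (t, y') \<in> S} \<longleftrightarrow> t \<in> circ_arc \<beta> (m y')" by blast
    have "AE z in lborel. z \<in> S \<longleftrightarrow> z \<in> arc_set m \<beta>"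
    proof (rule AE_lborel_prodI)
      have [measurable]: "S \<in> sets borel" "arc_set m \<beta> \<in> sets borel" by (rule Sm, rule arc_meas)
      show "{z. z \<in> S \<longleftrightarrow> z \<in> arc_set m \<beta>} \<in> sets borel" by measurable
      show "AE y' in lborel. AE t in lborel. (t, y') \<in> S \<longleftrightarrow> (t, y') \<in> arc_set m \<beta>"
        using \<beta>
      proof eventually_elim
        case (elim y')
        have [measurable]: "{t. (t, y') \<in> S} \<in> sets borel" using slices by (rule psetD)
        let ?P = "\<lambda>t. t \<in> {t. (t, y') \<in> S} \<longleftrightarrow> t \<in> circ_arc \<beta> (m y')"
        have per: "periodic ?P"
          by (rule periodic_comp2[where h="(=)", OF psetD(2)[OF slices] psetD(2)[OF pset_arc]])
        have "{t. ?P t} \<in> sets borel" by measurable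
        from AE_lborel_wrap[OF this elim]
        have "AE t in lborel. ?P t" unfolding periodic_wrap_eq[OF per] .
        then show ?case unfolding slice_arc_set[symmetric] by simp
      qed
    qed
    with ES F_arc[of \<beta>] have "AE z in lborel. z \<notin> (E - translate (\<beta> *\<^sub>R e1) ?F) \<union> (translate (\<beta> *\<^sub>R e1) ?F - E)"
      by eventually_elim blast
    then show "\<exists>c. (E - translate (c *\<^sub>R e1) ?F) \<union> (translate (c *\<^sub>R e1) ?F - E) \<in> null_sets lebesgue"
      by (intro exI[of _ \<beta>] null_sets_lebesgueI)
  qed
  ultimately show ?thesis by blast
qed

end
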